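(* Let $n\in\mathbb{Z}$ and let $m\in\mathbb{Z}_{>0}$. Then $$\inf_{\gamma\in A_{n,m}} I(\gamma) = i_{n,m} := n+m-m\left\lceil \frac{n}{m}\right\rceil .$$ The index $i_{n,m}$ is the unique element of $(n+m\mathbb{Z})\cap\{1,\dots,m\}$, and $i_{n,m}=n$ holds if and only if $1\leq n\leq m$. Moreover, the infimum is attained if and only if $i_{n,m}=n$ and $\gamma$ is a counterclockwise $n$-times covered round circle; that is, a curve $\gamma\in A_{n,m}$ satisfies $I(\gamma)=i_{n,m}$ if and only if $i_{n,m}=n$ and $\gamma$ is a counterclockwise $n$-times covered round circle.
   Context: $\mathbb{S}^1:=\mathbb{R}/\mathbb{Z}$. $R_\theta$ denotes the counterclockwise rotation matrix in $\mathbb{R}^2$ through the angle $\theta$, and $R:=R_{\pi/2}$. For a closed Lipschitz curve $\gamma:\mathbb{S}^1\to\mathbb{R}^2$, the length and the signed area are $$\mathcal{L}(\gamma):=\int_0^1|\partial_x\gamma|\,dx,\qquad \mathcal{A}(\gamma):=-\frac12\int_0^1\gamma\cdot R\,\partial_x\gamma\,dx$$ (so the area of a counterclockwise circle is positive). The isoperimetric ratio is $I(\gamma):=\dfrac{\mathcal{L}(\gamma)^2}{4\pi\mathcal{A}(\gamma)}$ if $\mathcal{A}(\gamma)>0$ and $I(\gamma):=\infty$ if $\mathcal{A}(\gamma)\leq 0$. For a regular (immersed, i.e. $\min|\partial_x\gamma|>0$) curve $\gamma\in W^{2,1}(\mathbb{S}^1;\mathbb{R}^2)\subset C^1(\mathbb{S}^1;\mathbb{R}^2)$,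 let $s$ be the arclength parameter, $\nu:=R\,\partial_s\gamma$ the unit normal, $\kappa:=\partial_s^2\gamma\cdot\nu$ the signed curvature, and $\mathcal{N}(\gamma):=\frac{1}{2\pi}\int_\gamma\kappa\,ds$ the rotation number. A closed curve $\gamma:\mathbb{S}^1\to\mathbb{R}^2$ is $m$-th rotationally symmetric if there exists $i\in\{1,\dots,m\}$ such that $\gamma(x+1/m)=R_{2\pi i/m}\gamma(x)$ for all $x\in\mathbb{S}^1$. $A_{n,m}$ is the set of all regular curves $\gamma\in W^{2,1}(\mathbb{S}^1;\mathbb{R}^2)$ with $\mathcal{N}(\gamma)=n$ that are $m$-th rotationally symmetric. *)

theory Defs
  imports "HOL-Analysis.Analysis"
begin

text \<open>
  Functions on the circle \<open>S\<^sup>1 = R/Z\<close> are represented by 1-periodic functions on the reals, and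
  integrals over the circle are integrals over the fundamental domain \<open>{0..1}\<close>. For the
  absolutely integrable functions occurring below, the gauge integral \<open>integral\<close> coincides with the
  Lebesgue integral.
\<close>

definition periodic1 :: "(real \<Rightarrow> 'a) \<Rightarrow> bool" where
  "periodic1 f \<longleftrightarrow> (\<forall>x. f (x + 1) = f x)"

definition rot :: "real \<Rightarrow> real^2^2" where
  "rot \<theta> = vector [vector [cos \<theta>, - sin \<theta>], vector [sin \<theta>, cos \<theta>]]"

abbreviation rot90 :: "real^2^2" where
  "rot90 \<equiv> rot (pi / 2)"

text \<open>
  \<open>dx \<gamma>\<close> is the classical derivative. It exists almost everywhere if \<open>\<gamma>\<close> is Lipschitz, and
  everywhere if \<open>\<gamma>\<close> is the continuous representative of a \<open>W\<^sup>2\<^sup>,\<^sup>1\<close> curve.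
\<close>

definition dx :: "(real \<Rightarrow> real^2) \<Rightarrow> real \<Rightarrow> real^2" where
  "dx \<gamma> x = vector_derivative \<gamma> (at x)"

definition curve_length :: "(real \<Rightarrow> real^2) \<Rightarrow> real" where
  "curve_length \<gamma> = integral {0..1} (\<lambda>x. norm (dx \<gamma> x))"

definition signed_area :: "(real \<Rightarrow> real^2) \<Rightarrow> real" where
  "signed_area \<gamma> = - (1/2) * integral {0..1} (\<lambda>x. \<gamma> x \<bullet> (rot90 *v dx \<gamma> x))"

definition isoperimetric_ratio :: "(real \<Rightarrow> real^2) \<Rightarrow> ereal" where
  "isoperimetric_ratio \<gamma> =
     (if signed_area \<gamma> > 0 then ereal ((curve_length \<gamma>)^2 / (4 * pi * signed_area \<gamma>)) else \<infinity>)"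

definition test_function :: "(real \<Rightarrow> real) \<Rightarrow> bool" where
  "test_function \<phi> \<longleftrightarrow> periodic1 \<phi> \<and> (\<forall>k x. (deriv ^^ k) \<phi> field_differentiable at x)"

text \<open>Both functions are only looked at on \<open>{0..1}\<close>, that is, up to periodic extension.\<close>

definition has_weak_derivative :: "(real \<Rightarrow> real^2) \<Rightarrow> (real \<Rightarrow> real^2) \<Rightarrow> bool" where
  "has_weak_derivative f g \<longleftrightarrow>
     f absolutely_integrable_on {0..1} \<and> g absolutely_integrable_on {0..1} \<and>
     (\<forall>\<phi>. test_function \<phi> \<longrightarrow>
        integral {0..1} (\<lambda>x. deriv \<phi> x *\<^sub>R f x) = - integral {0..1} (\<lambda>x. \<phi> x *\<^sub>R g x))"

text \<open>Weak derivatives are unique up to null sets on \<open>{0..1}\<close>; an arbitrary one is chosen.\<close>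

definition weak_dx :: "(real \<Rightarrow> real^2) \<Rightarrow> real \<Rightarrow> real^2" where
  "weak_dx f = (SOME g. has_weak_derivative f g)"

text \<open>
  Because of the embedding into \<open>C\<^sup>1\<close>, elements of \<open>W\<^sup>2\<^sup>,\<^sup>1\<close> are identified with
  their continuous representatives.
\<close>

definition W21_curve :: "(real \<Rightarrow> real^2) \<Rightarrow> bool" where
  "W21_curve \<gamma> \<longleftrightarrow> periodic1 \<gamma> \<and> continuous_on UNIV \<gamma> \<and>
     (\<exists>g h. has_weak_derivative \<gamma> g \<and> has_weak_derivative g h)"

definition regular_curve :: "(real \<Rightarrow> real^2) \<Rightarrow> bool" where
  "regular_curve \<gamma> \<longleftrightarrow> (\<exists>c>0. \<forall>x. c \<le> norm (dx \<gamma> x))"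

text \<open>
  Arclength differentiation is \<open>(1 / |dx \<gamma>|) dx\<close>. The unit tangent of a regular
  \<open>W\<^sup>2\<^sup>,\<^sup>1\<close> curve is only of class \<open>W\<^sup>1\<^sup>,\<^sup>1\<close>, so the second
  differentiation is a weak one.
\<close>

definition unit_tangent :: "(real \<Rightarrow> real^2) \<Rightarrow> real \<Rightarrow> real^2" where
  "unit_tangent \<gamma> x = (1 / norm (dx \<gamma> x)) *\<^sub>R dx \<gamma> x"

definition unit_normal :: "(real \<Rightarrow> real^2) \<Rightarrow> real \<Rightarrow> real^2" where
  "unit_normal \<gamma> x = rot90 *v unit_tangent \<gamma> x"

definition curvature :: "(real \<Rightarrow> real^2) \<Rightarrow> real \<Rightarrow> real" where
  "curvature \<gamma> x = ((1 / norm (dx \<gamma> x)) *\<^sub>R weak_dx (unit_tangent \<gamma>) x) \<bullet> unit_normal \<gamma> x"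

definition rotation_number :: "(real \<Rightarrow> real^2) \<Rightarrow> real" where
  "rotation_number \<gamma> = 1 / (2 * pi) * integral {0..1} (\<lambda>x. curvature \<gamma> x * norm (dx \<gamma> x))"

definition rotationally_symmetric :: "int \<Rightarrow> (real \<Rightarrow> real^2) \<Rightarrow> bool" where
  "rotationally_symmetric m \<gamma> \<longleftrightarrow>
     (\<exists>i\<in>{1..m}. \<forall>x. \<gamma> (x + 1 / of_int m) = rot (2 * pi * of_int i / of_int m) *v \<gamma> x)"

definition A_set :: "int \<Rightarrow> int \<Rightarrow> (real \<Rightarrow> real^2) set" where
  "A_set n m = {\<gamma>. W21_curve \<gamma> \<and> regular_curve \<gamma> \<and> rotation_number \<gamma> = of_int n \<and>
                   rotationally_symmetric m \<gamma>}"

definition idx :: "int \<Rightarrow> int \<Rightarrow> int" where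
  "idx n m = n + m - m * \<lceil>real_of_int n / real_of_int m\<rceil>"

text \<open>
  An arbitrary parametrization is allowed: \<open>\<phi>\<close> is the lift of an orientation preserving
  homeomorphism of the circle, and the centre \<open>c\<close> and radius \<open>r\<close> are arbitrary.
\<close>

definition ccw_round_circle :: "int \<Rightarrow> (real \<Rightarrow> real^2) \<Rightarrow> bool" where
  "ccw_round_circle n \<gamma> \<longleftrightarrow> n \<ge> 1 \<and>
     (\<exists>c r \<phi>. r > 0 \<and> continuous_on UNIV \<phi> \<and> strict_mono \<phi> \<and> (\<forall>x. \<phi> (x + 1) = \<phi> x + 1) \<and>
        (\<forall>x. \<gamma> x = c + r *\<^sub>R vector [cos (2 * pi * of_int n * \<phi> x), sin (2 * pi * of_int n * \<phi> x)]))"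

end

theory Submission
  imports Defs
begin

text \<open>
  Identify the plane with \<open>\<complex>\<close> and write \<open>z\<close> for the curve and \<open>L\<close>, \<open>A\<close> for its length and area. If
  \<open>z(x + 1/m) = cis(2\<pi>k/m) z(x)\<close> with \<open>1 \<le> k \<le> m\<close>, then the tangent turns by \<open>2\<pi>k/m\<close> modulo \<open>2\<pi>\<close>
  over each of the \<open>m\<close> periods, and by the same amount over each. So the rotation number \<open>n\<close> is
  congruent to \<open>k\<close> modulo \<open>m\<close>, and \<open>k\<close> is \<open>idx n m\<close> (\<open>symmetry_index_cong\<close>, \<open>idx_unique\<close>).

  Lower bound. Let \<open>s\<close> be the arclength divided by \<open>L\<close>, and \<open>\<sigma> = s'\<close>. In the rotating frame
  \<open>w = cis(- 2\<pi>k s) z\<close> the curve becomes \<open>1/m\<close>-periodic, and with \<open>t = k/m\<close>, \<open>\<alpha> = 2\<pi>m\<close> and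
  \<open>u = w - c\<close> for a constant \<open>c\<close>, the quantity \<open>L\<^sup>2 - 4\<pi>k A\<close> is the integral over \<open>[0, 1]\<close> of
  \<open>(1 - t) |w'|\<^sup>2/\<sigma> + (t/2) (|w'|\<^sup>2/\<sigma> - \<alpha>\<^sup>2 \<sigma> |u|\<^sup>2) + (t/2) |w' + \<i>\<alpha>\<sigma>u|\<^sup>2/\<sigma>\<close>.
  The outer terms are nonnegative, and for a good choice of \<open>c\<close> the middle one has a nonnegative
  integral by Wirtinger's inequality for functions of period \<open>1/m\<close> (\<open>weighted_wirtinger\<close>). This is
  \<open>symmetric_isoperimetric\<close>.

  Equality. The last term vanishes, hence \<open>u\<close> is a multiple of \<open>cis(- \<alpha> s)\<close>; the first term
  excludes this for \<open>k < m\<close> unless \<open>u = 0\<close>. In both cases \<open>z\<close> is a circle covered \<open>k\<close> times. The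
  rotation number of such a circle is \<open>k\<close>, so equality occurs only if \<open>k = n\<close>. Conversely a circle
  covered \<open>n\<close> times has the ratio \<open>n\<close> (\<open>ccw_round_circle_isoperimetric_ratio\<close>).

  Sharpness. Put \<open>q = (n - k)/m\<close> and let the tangent angle be \<open>2\<pi>k x + 2\<pi>q \<eta>(m x)\<close>, where \<open>\<eta>\<close> is
  a smooth approximation of a step function that jumps by one at each integer. The curve is close
  to the circle covered \<open>k\<close> times, and all the missing turns are made by tiny loops near the jumps,
  which contribute nothing to length and area in the limit (\<open>near_optimal_curve\<close>).

  Regularity. A curve of class \<open>W\<^sup>2\<^sup>,\<^sup>1\<close> is \<open>C\<^sup>1\<close>, and its derivative is the primitive of an integrable
  function, because weak derivatives are already determined by their pairing with trigonometric
  waves (\<open>wave_derivative_imp_is_primitive\<close>). Primitives of integrable functions obey the product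
  rule and the chain rule for the exponential, so a nowhere vanishing primitive \<open>p\<close> of \<open>h\<close> is
  \<open>p(0) exp(\<integral> h/p)\<close> (\<open>is_primitive_log\<close>). For the unit tangent this makes \<open>\<integral> \<kappa> ds\<close> a continuous
  choice of the tangent angle.
\<close>

section \<open>Trigonometric polynomials on the circle\<close>

text \<open>
  A loop is homotopic to itself, and homotopies of loops are homotopies of maps of the unit circle;
  continuity of the factor map across the branch cut of \<open>Arg2pi\<close> comes with this.
\<close>

lemma circle_factorization:
  fixes f :: "real \<Rightarrow> 'a::real_normed_vector"
  assumes f: "continuous_on {0..1} f" and end_eq: "f 0 = f 1"
  obtains q where "continuous_on (sphere (0::complex) 1) q"
    and "\<And>x. x \<in> {0..1} \<Longrightarrow> q (cis (2 * pi * x)) = f x"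
proof
  have "homotopic_loops UNIV f f"
    using f end_eq by (simp add: homotopic_loops_refl path_def pathfinish_def pathstart_def)
  then show "continuous_on (sphere (0::complex) 1) (f \<circ> (\<lambda>z. Arg2pi z / (2 * pi)))"
    using homotopic_loops_imp_homotopic_circlemaps homotopic_with_imp_continuous by blast
  show "(f \<circ> (\<lambda>z. Arg2pi z / (2 * pi))) (cis (2 * pi * x)) = f x" if x: "x \<in> {0..1}" for x
  proof (cases "x = 1")
    case True
    moreover have "Arg2pi 1 = 0"
      by (simp add: Arg2pi_eq_0)
    ultimately show ?thesis
      using end_eq by simp
  next
    case False
    have "2 * pi * x < 2 * pi * 1"
      using x False by (intro mult_strict_left_mono) auto
    then have "Arg2pi (cis (2 * pi * x)) = 2 * pi * x"
      using x by (intro Arg2pi_unique[of 1]) (auto simp: cis_conv_exp)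
    then show ?thesis
      by simp
  qed
qed

text \<open>
  Composing the map of the circle with \<open>cis (2\<pi>x)\<close> gives periodicity and continuity at the integers
  at once.
\<close>

lemma periodic_continuous_extension:
  fixes f :: "real \<Rightarrow> 'a::real_normed_vector"
  assumes "continuous_on {0..1} f" and "f 0 = f 1"
  obtains F where "continuous_on UNIV F" "\<And>x. F (x + 1) = F x" "\<And>x. x \<in> {0..1} \<Longrightarrow> F x = f x"
proof -
  obtain q where q: "continuous_on (sphere (0::complex) 1) q"
      "\<And>x. x \<in> {0..1} \<Longrightarrow> q (cis (2 * pi * x)) = f x"
    using circle_factorization[OF assms] by blast
  show ?thesis
  proof
    show "continuous_on UNIV (\<lambda>x. q (cis (2 * pi * x)))"
      by (rule continuous_on_compose2[OF q(1)]) (auto intro!: continuous_intros)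
    show "q (cis (2 * pi * (x + 1))) = q (cis (2 * pi * x))" for x
      by (simp add: distrib_left flip: cis_mult)
  qed (use q in auto)
qed

text \<open>
  A single wave with an arbitrary phase covers sine, cosine and constants; negative frequencies are
  allowed so that the product formula needs no case distinction.
\<close>

inductive trig_poly :: "(real \<Rightarrow> real) \<Rightarrow> bool" where
  wave: "trig_poly (\<lambda>x. c * cos (2 * pi * of_int k * x + a))"
| add: "trig_poly p \<Longrightarrow> trig_poly q \<Longrightarrow> trig_poly (\<lambda>x. p x + q x)"

lemma trig_poly_mult_wave:
  "trig_poly q \<Longrightarrow> trig_poly (\<lambda>x. c * cos (2 * pi * of_int k * x + a) * q x)"
proof (induction rule: trig_poly.induct)
  case (wave d l b)
  have "c * cos (2 * pi * of_int k * x + a) * (d * cos (2 * pi * of_int l * x + b))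
      = c * d / 2 * cos (2 * pi * of_int (k - l) * x + (a - b))
        + c * d / 2 * cos (2 * pi * of_int (k + l) * x + (a + b))" for x
  proof -
    have "cos (2 * pi * of_int k * x + a) * cos (2 * pi * of_int l * x + b)
      = cos (2 * pi * of_int (k - l) * x + (a - b)) / 2
        + cos (2 * pi * of_int (k + l) * x + (a + b)) / 2"
      by (simp add: cos_times_cos add_divide_distrib algebra_simps)
    then show ?thesis
      by (simp add: algebra_simps)
  qed
  then show ?case
    using trig_poly.add[OF trig_poly.wave[of "c * d / 2" "k - l" "a - b"]
        trig_poly.wave[of "c * d / 2" "k + l" "a + b"]] by simp
next
  case (add p q)
  then show ?case
    using trig_poly.add[OF add.IH] by (simp add: distrib_left)
qed

lemma trig_poly_mult: "trig_poly p \<Longrightarrow> trig_poly q \<Longrightarrow> trig_poly (\<lambda>x. p x * q x)"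
proof (induction rule: trig_poly.induct)
  case (wave c k a)
  then show ?case by (rule trig_poly_mult_wave)
next
  case (add p1 p2)
  then show ?case
    using trig_poly.add[OF add.IH] by (simp add: distrib_right)
qed

text \<open>
  Stone--Weierstrass supplies polynomials in the two coordinates of the circle. They restrict to
  trigonometric polynomials since the coordinates do and these are closed under multiplication.
\<close>

lemma trig_poly_real_polynomial_function:
  assumes "real_polynomial_function (p :: complex \<Rightarrow> real)"
  shows "trig_poly (\<lambda>x. p (cis (2 * pi * x)))"
  using assms
proof (induction rule: real_polynomial_function.induct)
  case (linear f)
  have "f (cis (2 * pi * x)) = f 1 * cos (2 * pi * of_int 1 * x + 0)
      + f \<i> * cos (2 * pi * of_int 1 * x + (- (pi / 2)))" for x
  proof -
    interpret bounded_linear f by fact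
    have "cis (2 * pi * x) = cos (2 * pi * x) *\<^sub>R 1 + sin (2 * pi * x) *\<^sub>R \<i>"
      by (simp add: complex_eq_iff)
    then have "f (cis (2 * pi * x)) = cos (2 * pi * x) * f 1 + sin (2 * pi * x) * f \<i>"
      by (simp add: add scaleR)
    then show ?thesis
      by (simp add: cos_diff)
  qed
  then show ?case
    using trig_poly.add[OF trig_poly.wave[of "f 1" 1 0] trig_poly.wave[of "f \<i>" 1 "- (pi / 2)"]]
    by simp
next
  case (const c)
  then show ?case
    using trig_poly.wave[of c 0 0] by simp
qed (auto intro: trig_poly.add trig_poly_mult)

lemma trig_poly_continuous: "trig_poly q \<Longrightarrow> continuous_on S q"
  by (induction rule: trig_poly.induct) (auto intro!: continuous_intros)

lemma integral_trig_poly_eq_0: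
  fixes f :: "real \<Rightarrow> real"
  assumes f: "continuous_on {0..1} f"
    and orth: "\<And>k a. integral {0..1} (\<lambda>x. cos (2 * pi * of_int k * x + a) * f x) = 0"
    and q: "trig_poly q"
  shows "integral {0..1} (\<lambda>x. q x * f x) = 0"
  using q
proof (induction rule: trig_poly.induct)
  case (wave c k a)
  then show ?case
    using orth[of k a] by (simp add: mult.assoc)
next
  case (add p q)
  have "(\<lambda>x. p x * f x) integrable_on {0..1}" "(\<lambda>x. q x * f x) integrable_on {0..1}"
    using add.hyps[THEN trig_poly_continuous] f
    by (auto intro!: integrable_continuous_real continuous_intros)
  then show ?case
    using add.IH by (simp add: distrib_right integral_add)
qed

text \<open>
  By Stone--Weierstrass \<open>f\<close> is within \<open>e\<close> of a trigonometric polynomial, to which it is orthogonal;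
  therefore the integral of \<open>f\<^sup>2\<close> is at most \<open>e\<close> times that of \<open>|f|\<close>.
\<close>

lemma orthogonal_to_waves_imp_zero:
  fixes f :: "real \<Rightarrow> real"
  assumes f: "continuous_on {0..1} f" and end_eq: "f 0 = f 1"
    and orth: "\<And>k a. integral {0..1} (\<lambda>x. cos (2 * pi * of_int k * x + a) * f x) = 0"
    and x: "x \<in> {0..1}"
  shows "f x = 0"
proof -
  obtain q where q: "continuous_on (sphere (0::complex) 1) q"
      "\<And>x. x \<in> {0..1} \<Longrightarrow> q (cis (2 * pi * x)) = f x"
    using circle_factorization[OF f end_eq] by blast
  have int2: "(\<lambda>x. (f x)\<^sup>2) integrable_on {0..1}" and int1: "(\<lambda>x. \<bar>f x\<bar>) integrable_on {0..1}"
    using f by (auto intro!: integrable_continuous_real continuous_intros)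
  have le: "integral {0..1} (\<lambda>x. (f x)\<^sup>2) \<le> e * integral {0..1} (\<lambda>x. \<bar>f x\<bar>)" if e: "e > 0" for e
  proof -
    obtain p where p: "real_polynomial_function p"
        "\<And>z. z \<in> sphere 0 1 \<Longrightarrow> \<bar>q z - p z\<bar> < e"
      using Stone_Weierstrass_real_polynomial_function[OF compact_sphere q(1) e] by blast
    define r where "r x = p (cis (2 * pi * x))" for x
    have r: "trig_poly r"
      unfolding r_def by (rule trig_poly_real_polynomial_function[OF p(1)])
    have close: "\<bar>f x - r x\<bar> \<le> e" if "x \<in> {0..1}" for x
      using p(2)[of "cis (2 * pi * x)"] q(2)[OF that] by (simp add: r_def)
    have intr: "(\<lambda>x. r x * f x) integrable_on {0..1}"
      using f trig_poly_continuous[OF r] by (auto intro!: integrable_continuous_real continuous_intros)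
    have "integral {0..1} (\<lambda>x. (f x)\<^sup>2) = integral {0..1} (\<lambda>x. (f x)\<^sup>2 - r x * f x)"
      using integral_trig_poly_eq_0[OF f orth r] int2 intr by (simp add: integral_diff)
    also have "\<dots> \<le> integral {0..1} (\<lambda>x. e * \<bar>f x\<bar>)"
    proof (rule integral_le)
      show "(\<lambda>x. (f x)\<^sup>2 - r x * f x) integrable_on {0..1}"
        using int2 intr by (rule integrable_diff)
      show "(\<lambda>x. e * \<bar>f x\<bar>) integrable_on {0..1}"
        using f by (auto intro!: integrable_continuous_real continuous_intros)
      show "(f x)\<^sup>2 - r x * f x \<le> e * \<bar>f x\<bar>" if "x \<in> {0..1}" for x
      proof -
        have "(f x)\<^sup>2 - r x * f x = (f x - r x) * f x"
          by (simp add: power2_eq_square algebra_simps)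
        also have "\<dots> \<le> \<bar>f x - r x\<bar> * \<bar>f x\<bar>"
          by (metis abs_ge_self abs_mult)
        also have "\<dots> \<le> e * \<bar>f x\<bar>"
          by (rule mult_right_mono[OF close[OF that]]) simp
        finally show ?thesis .
      qed
    qed
    finally show ?thesis by simp
  qed
  have "integral {0..1} (\<lambda>x. (f x)\<^sup>2) \<le> 0"
  proof (rule field_le_epsilon)
    fix e :: real assume e: "e > 0"
    have nn: "integral {0..1} (\<lambda>x. \<bar>f x\<bar>) \<ge> 0"
      using int1 by (intro integral_nonneg) auto
    define J where "J = integral {0..1} (\<lambda>x. \<bar>f x\<bar>)"
    have "integral {0..1} (\<lambda>x. (f x)\<^sup>2) \<le> e / (J + 1) * J"
      using le[of "e / (J + 1)"] e nn by (simp add: J_def)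
    also have "\<dots> \<le> 0 + e"
      using e nn by (simp add: J_def field_simps)
    finally show "integral {0..1} (\<lambda>x. (f x)\<^sup>2) \<le> 0 + e" .
  qed
  moreover have "integral {0..1} (\<lambda>x. (f x)\<^sup>2) \<ge> 0"
    using int2 by (intro integral_nonneg) auto
  ultimately have "((\<lambda>x. (f x)\<^sup>2) has_integral 0) (cbox 0 1)"
    using int2 by (metis antisym box_real(2) integrable_integral)
  then have "(f x)\<^sup>2 = 0"
    using f x by (intro has_integral_0_cbox_imp_0[of 0 1 "\<lambda>x. (f x)\<^sup>2"])
      (auto intro!: continuous_intros)
  then show ?thesis by simp
qed

text \<open>
  The previous lemma applies to every component of \<open>f\<close> after its mean is subtracted; the mean does
  not interact with waves of nonzero frequency.
\<close>

lemma orthogonal_to_waves_imp_constant: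
  fixes f :: "real \<Rightarrow> 'a::euclidean_space"
  assumes f: "continuous_on {0..1} f" and end_eq: "f 0 = f 1"
    and orth: "\<And>k a. k \<noteq> 0 \<Longrightarrow>
      integral {0..1} (\<lambda>x. cos (2 * pi * of_int k * x + a) *\<^sub>R f x) = 0"
    and x: "x \<in> {0..1}"
  shows "f x = f 0"
proof -
  have "f x \<bullet> b = f 0 \<bullet> b" for b
  proof -
    define c where "c = integral {0..1} (\<lambda>x. f x \<bullet> b)"
    define g where "g x = f x \<bullet> b - c" for x
    have fi: "(\<lambda>x. f x \<bullet> b) integrable_on {0..1}"
      using f by (auto intro!: integrable_continuous_real continuous_intros)
    have g: "continuous_on {0..1} g" "g 0 = g 1"
      using f end_eq by (auto simp: g_def intro!: continuous_intros)
    have "integral {0..1} (\<lambda>x. cos (2 * pi * of_int k * x + a) * g x) = 0" for k a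
    proof (cases "k = 0")
      case True
      then show ?thesis
        using integral_diff[OF fi integrable_const_ivl, of c] by (simp add: g_def c_def)
    next
      case False
      define h where "h x = cos (2 * pi * of_int k * x + a)" for x
      have h: "continuous_on {0..1} h"
        by (auto simp: h_def intro!: continuous_intros)
      have "((\<lambda>x. sin (2 * pi * of_int k * x + a) / (2 * pi * of_int k)) has_vector_derivative h x)
          (at x within {0..1})" for x
        unfolding h_def has_real_derivative_iff_has_vector_derivative[symmetric]
        using False by (auto intro!: derivative_eq_intros)
      then have "(h has_integral (sin (2 * pi * of_int k * 1 + a) / (2 * pi * of_int k)
          - sin (2 * pi * of_int k * 0 + a) / (2 * pi * of_int k))) {0..1}"
        by (intro fundamental_theorem_of_calculus) auto
      moreover have "sin (2 * pi * of_int k + a) = sin a"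
        by (simp add: sin_add)
      ultimately have h0: "integral {0..1} h = 0" "h integrable_on {0..1}"
        by (auto simp: integral_unique has_integral_integrable)
      have "integral {0..1} (\<lambda>x. h x * (f x \<bullet> b)) = integral {0..1} (\<lambda>x. (h x *\<^sub>R f x) \<bullet> b)"
        by simp
      also have "\<dots> = integral {0..1} (\<lambda>x. h x *\<^sub>R f x) \<bullet> b"
        using integral_linear[of "\<lambda>x. h x *\<^sub>R f x" "{0..1}" "\<lambda>y. y \<bullet> b"] f h
        by (simp add: o_def bounded_linear_inner_left integrable_continuous_real continuous_intros)
      also have "\<dots> = 0"
        using orth[OF False, of a] by (simp add: h_def)
      finally have hf: "integral {0..1} (\<lambda>x. h x * (f x \<bullet> b)) = 0" .
      have "integral {0..1} (\<lambda>x. h x * g x) = integral {0..1} (\<lambda>x. h x * (f x \<bullet> b) - c * h x)"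
        by (simp add: g_def algebra_simps)
      also have "\<dots> = 0"
        using hf h0 f h by (subst integral_diff)
          (auto intro!: integrable_continuous_real continuous_intros)
      finally show ?thesis by (simp add: h_def)
    qed
    from orthogonal_to_waves_imp_zero[OF g this] have "g x = 0" "g 0 = 0"
      using x by auto
    then show ?thesis by (simp add: g_def)
  qed
  then show ?thesis
    by (intro euclidean_eqI[where 'a = 'a]) auto
qed

section \<open>Calculus of primitives of integrable functions\<close>

text \<open>
  Telescoping over a fine uniform partition bounds the total increment of \<open>F\<close> by \<open>e\<close> times the
  integral of \<open>w\<close>. This replaces differentiation almost everywhere: the rules of calculus for
  primitives reduce to an estimate of order \<open>o(1) \<integral> w\<close> on short intervals.
\<close>

lemma small_increments_imp_constant:
  fixes F :: "real \<Rightarrow> 'a::real_normed_vector"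
  assumes w: "w integrable_on {0..1}"
    and small: "\<And>e. e > 0 \<Longrightarrow> \<exists>d>0. \<forall>a b. 0 \<le> a \<longrightarrow> a \<le> b \<longrightarrow> b \<le> 1 \<longrightarrow> b - a < d \<longrightarrow>
      norm (F b - F a) \<le> e * integral {a..b} w"
    and x: "x \<in> {0..1}"
  shows "F x = F 0"
proof -
  have bound: "norm (F x - F 0) \<le> e * integral {0..x} w" if e: "e > 0" for e
  proof -
    obtain d where d: "d > 0" "\<And>a b. 0 \<le> a \<Longrightarrow> a \<le> b \<Longrightarrow> b \<le> 1 \<Longrightarrow> b - a < d \<Longrightarrow>
        norm (F b - F a) \<le> e * integral {a..b} w"
      using small[OF e] by blast
    obtain N where N: "inverse (of_nat (Suc N)) < d"
      using reals_Archimedean[OF d(1)] by blast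
    define t where "t j = x * (of_nat j / of_nat (Suc N))" for j
    have t_Suc: "t (Suc j) = t j + x / of_nat (Suc N)" for j
      by (simp add: t_def add_divide_distrib distrib_left)
    have step: "x / of_nat (Suc N) < d" "0 \<le> x / of_nat (Suc N)"
    proof -
      have "x * inverse (of_nat (Suc N)) \<le> 1 * inverse (of_nat (Suc N))"
        using x by (intro mult_right_mono) (auto simp del: of_nat_Suc)
      also have "\<dots> < d"
        using N by (simp del: of_nat_Suc)
      finally show "x / of_nat (Suc N) < d"
        by (simp add: divide_inverse del: of_nat_Suc)
    qed (use x in simp)
    have t01: "0 \<le> t j" "t j \<le> 1" if "j \<le> Suc N" for j
      using that x mult_le_one[of x "of_nat j / of_nat (Suc N)"] by (auto simp: t_def simp del: of_nat_Suc)
    have "norm (F (t j) - F 0) \<le> e * integral {0..t j} w" if "j \<le> Suc N" for j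
      using that
    proof (induction j)
      case 0
      then show ?case by (simp add: t_def)
    next
      case (Suc j)
      have le: "t j \<le> t (Suc j)"
        using step by (simp add: t_Suc)
      have "norm (F (t (Suc j)) - F 0) \<le> norm (F (t (Suc j)) - F (t j)) + norm (F (t j) - F 0)"
        by norm
      also have "\<dots> \<le> e * integral {t j..t (Suc j)} w + e * integral {0..t j} w"
      proof (rule add_mono)
        show "norm (F (t (Suc j)) - F (t j)) \<le> e * integral {t j..t (Suc j)} w"
          using Suc.prems step t01[of j] t01[of "Suc j"] le by (intro d(2)) (auto simp: t_Suc)
      qed (use Suc in auto)
      also have "\<dots> = e * integral {0..t (Suc j)} w"
      proof -
        have "w integrable_on {0..t (Suc j)}"
          using w t01[OF Suc.prems] by (rule_tac integrable_subinterval_real) auto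
        from Henstock_Kurzweil_Integration.integral_combine[OF _ le this] show ?thesis
          using t01[of j] Suc.prems by (simp flip: distrib_left add: add.commute)
      qed
      finally show ?case .
    qed
    from this[of "Suc N"] show ?thesis
      by (simp add: t_def del: of_nat_Suc)
  qed
  have "norm (F x - F 0) \<le> 0"
  proof (rule field_le_epsilon)
    fix e :: real assume e: "e > 0"
    define J where "J = integral {0..x} w"
    have "norm (F x - F 0) \<le> e / (\<bar>J\<bar> + 1) * J"
      using bound[of "e / (\<bar>J\<bar> + 1)"] e by (simp add: J_def)
    also have "\<dots> \<le> e / (\<bar>J\<bar> + 1) * (\<bar>J\<bar> + 1)"
      using e by (intro mult_left_mono) auto
    also have "\<dots> = 0 + e"
      by simp
    finally show "norm (F x - F 0) \<le> 0 + e" .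
  qed
  then show ?thesis by simp
qed

text \<open>
  The absolutely continuous functions on the unit interval, together with an integrable
  representative of the derivative. No pointwise derivative is involved.
\<close>

definition is_primitive :: "(real \<Rightarrow> 'a::euclidean_space) \<Rightarrow> (real \<Rightarrow> 'a) \<Rightarrow> bool" where
  "is_primitive f g \<longleftrightarrow> g absolutely_integrable_on {0..1} \<and>
     (\<forall>x\<in>{0..1}. f x = f 0 + integral {0..x} g)"

lemma is_primitive_absolutely_integrable:
  "is_primitive f g \<Longrightarrow> g absolutely_integrable_on {0..1}"
  unfolding is_primitive_def by blast

lemma is_primitive_eq:
  "is_primitive f g \<Longrightarrow> x \<in> {0..1} \<Longrightarrow> f x = f 0 + integral {0..x} g"
  unfolding is_primitive_def by blast

lemma is_primitive_increment:
  assumes "is_primitive f g" "0 \<le> a" "a \<le> b" "b \<le> 1"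
  shows "(g has_integral (f b - f a)) {a..b}"
proof -
  have g: "g integrable_on {0..1}"
    using is_primitive_absolutely_integrable[OF assms(1)] by (simp add: absolutely_integrable_on_def)
  have gb: "g integrable_on {0..b}" and "g integrable_on {a..b}"
    by (rule integrable_subinterval_real[OF g]; use assms in auto)+
  moreover have "integral {0..a} g + integral {a..b} g = integral {0..b} g"
    using Henstock_Kurzweil_Integration.integral_combine[OF assms(2,3) gb] .
  moreover have "f a = f 0 + integral {0..a} g" "f b = f 0 + integral {0..b} g"
    by (rule is_primitive_eq[OF assms(1)]; use assms(2-4) in simp)+
  ultimately show ?thesis
    by (simp add: has_integral_iff algebra_simps)
qed

lemma is_primitive_continuous_on:
  assumes "is_primitive f g"
  shows "continuous_on {0..1} f"
proof -
  have "continuous_on {0..1} (\<lambda>x. f 0 + integral {0..x} g)"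
    using assms by (intro continuous_intros indefinite_integral_continuous_1)
      (use is_primitive_absolutely_integrable in \<open>auto simp: absolutely_integrable_on_def\<close>)
  then show ?thesis
    by (rule continuous_on_eq) (use assms in \<open>metis is_primitive_def\<close>)
qed

lemma is_primitiveI_integral:
  assumes "g absolutely_integrable_on {0..1}"
  shows "is_primitive (\<lambda>x. c + integral {0..x} g) g"
  using assms by (simp add: is_primitive_def)

lemma C1_is_primitive:
  assumes "\<And>x. x \<in> {0..1} \<Longrightarrow> (f has_vector_derivative f' x) (at x within {0..1})"
    and "continuous_on {0..1} f'"
  shows "is_primitive f f'"
proof -
  have I: "(f' has_integral (f x - f 0)) {0..x}" if "x \<in> {0..1}" for x
    using that by (intro fundamental_theorem_of_calculus)
      (auto intro: has_vector_derivative_within_subset[OF assms(1)])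
  have "f x = f 0 + integral {0..x} f'" if "x \<in> {0..1}" for x
    using integral_unique[OF I[OF that]] by simp
  then show ?thesis
    using absolutely_integrable_continuous_real[OF assms(2)] unfolding is_primitive_def by blast
qed

lemma continuous_times_absolutely_integrable:
  fixes prod :: "'a::euclidean_space \<Rightarrow> 'b::euclidean_space \<Rightarrow> 'c::euclidean_space"
  assumes "bounded_bilinear prod" and f: "continuous_on {a..b::real} f"
    and g: "g absolutely_integrable_on {a..b}"
  shows "(\<lambda>x. prod (f x) (g x)) absolutely_integrable_on {a..b}"
proof (rule absolutely_integrable_bounded_measurable_product[where h = prod, OF _ _ _ _ g])
  show "bilinear prod"
    using assms(1) by (simp add: bilinear_conv_bounded_bilinear)
  show "f \<in> borel_measurable (lebesgue_on {a..b})"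
    using f by (rule continuous_imp_measurable_on_sets_lebesgue) auto
  show "bounded (f ` {a..b})"
    using f by (intro compact_imp_bounded compact_continuous_image) auto
qed auto

text \<open>
  The product rule. On \<open>[a, b]\<close> the error is the integral of
  \<open>prod (f b - f t) (g' t) + prod (f' t) (g a - g t)\<close>, and \<open>f\<close> and \<open>g\<close> are uniformly continuous.
\<close>

lemma is_primitive_bilinear:
  fixes prod :: "'a::euclidean_space \<Rightarrow> 'b::euclidean_space \<Rightarrow> 'c::euclidean_space"
  assumes prod: "bounded_bilinear prod" and f: "is_primitive f f'" and g: "is_primitive g g'"
  shows "is_primitive (\<lambda>x. prod (f x) (g x)) (\<lambda>x. prod (f x) (g' x) + prod (f' x) (g x))"
proof -
  interpret P: bounded_bilinear prod by fact
  define w where "w x = prod (f x) (g' x) + prod (f' x) (g x)" for x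
  have f': "f' absolutely_integrable_on {0..1}" and g': "g' absolutely_integrable_on {0..1}"
    using f g by (auto intro: is_primitive_absolutely_integrable)
  note fc = is_primitive_continuous_on[OF f] and gc = is_primitive_continuous_on[OF g]
  have w: "w absolutely_integrable_on {0..1}"
    unfolding w_def
    using continuous_times_absolutely_integrable[OF prod fc g']
      continuous_times_absolutely_integrable[OF P.flip gc f']
    by (rule set_integral_add(1))
  obtain K where K: "K > 0" "\<And>a b. norm (prod a b) \<le> norm a * norm b * K"
    using P.pos_bounded by blast
  define v where "v t = norm (f' t) + norm (g' t)" for t
  have v: "v integrable_on {0..1}"
    unfolding v_def using f' g' by (intro integrable_add) (auto simp: absolutely_integrable_on_def)
  have const: "prod (f x) (g x) - integral {0..x} w = prod (f 0) (g 0) - integral {0..0} w"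
    if x: "x \<in> {0..1}" for x
  proof (rule small_increments_imp_constant[OF v _ x])
    fix e :: real assume e: "e > 0"
    have "e / K > 0"
      using e K(1) by simp
    obtain d1 where d1: "d1 > 0"
        "\<And>a b. a \<in> {0..1} \<Longrightarrow> b \<in> {0..1} \<Longrightarrow> dist b a < d1 \<Longrightarrow> dist (f b) (f a) < e / K"
      using uniformly_continuous_onE[OF compact_uniformly_continuous[OF fc compact_Icc] \<open>e / K > 0\<close>] by blast
    obtain d2 where d2: "d2 > 0"
        "\<And>a b. a \<in> {0..1} \<Longrightarrow> b \<in> {0..1} \<Longrightarrow> dist b a < d2 \<Longrightarrow> dist (g b) (g a) < e / K"
      using uniformly_continuous_onE[OF compact_uniformly_continuous[OF gc compact_Icc] \<open>e / K > 0\<close>] by blast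
    have "norm ((prod (f b) (g b) - integral {0..b} w) - (prod (f a) (g a) - integral {0..a} w))
        \<le> e * integral {a..b} v"
      if ab: "0 \<le> a" "a \<le> b" "b \<le> 1" "b - a < min d1 d2" for a b
    proof -
      have "((\<lambda>t. prod (f b) (g' t)) has_integral prod (f b) (g b - g a)) {a..b}"
        using has_integral_linear[OF is_primitive_increment[OF g ab(1-3)] P.bounded_linear_right]
        by (simp add: o_def)
      moreover have "((\<lambda>t. prod (f' t) (g a)) has_integral prod (f b - f a) (g a)) {a..b}"
        using has_integral_linear[OF is_primitive_increment[OF f ab(1-3)] P.bounded_linear_left]
        by (simp add: o_def)
      moreover have "(w has_integral (integral {0..b} w - integral {0..a} w)) {a..b}"
        using is_primitive_increment[OF is_primitiveI_integral[OF w, of 0] ab(1-3)] by simp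
      ultimately have I: "((\<lambda>t. prod (f b) (g' t) + prod (f' t) (g a) - w t) has_integral
          (prod (f b) (g b - g a) + prod (f b - f a) (g a) - (integral {0..b} w - integral {0..a} w))) {a..b}"
        by (intro has_integral_diff has_integral_add)
      have "norm (integral {a..b} (\<lambda>t. prod (f b) (g' t) + prod (f' t) (g a) - w t))
          \<le> integral {a..b} (\<lambda>t. e * v t)"
      proof (rule integral_norm_bound_integral)
        show "(\<lambda>t. e * v t) integrable_on {a..b}"
          using integrable_subinterval_real[OF v, of a b] ab integrable_on_cmult_left by force
        fix t assume t: "t \<in> {a..b}"
        have "norm (f b - f t) \<le> e / K" "norm (g a - g t) \<le> e / K"
          using d1(2)[of t b] d2(2)[of t a] ab t by (auto simp: dist_norm)
        then have "norm (f b - f t) * K \<le> e" "norm (g a - g t) * K \<le> e"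
          using K(1) by (auto simp: field_simps)
        then have *: "norm (prod (f b - f t) (g' t)) \<le> e * norm (g' t)"
          "norm (prod (f' t) (g a - g t)) \<le> e * norm (f' t)"
          using K(2)[of "f b - f t" "g' t"] K(2)[of "f' t" "g a - g t"]
            mult_right_mono[of "norm (f b - f t) * K" e "norm (g' t)"]
            mult_right_mono[of "norm (g a - g t) * K" e "norm (f' t)"]
          by (simp_all add: mult_ac)
        have "prod (f b) (g' t) + prod (f' t) (g a) - w t
            = prod (f b - f t) (g' t) + prod (f' t) (g a - g t)"
          by (simp add: w_def P.diff_left P.diff_right)
        then show "norm (prod (f b) (g' t) + prod (f' t) (g a) - w t) \<le> e * v t"
          using norm_triangle_mono[OF *] by (simp add: v_def distrib_left add.commute)
      qed (use I in auto)
      then show ?thesis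
        using integral_unique[OF I] by (simp add: P.diff_left P.diff_right algebra_simps)
    qed
    then show "\<exists>d>0. \<forall>a b. 0 \<le> a \<longrightarrow> a \<le> b \<longrightarrow> b \<le> 1 \<longrightarrow> b - a < d \<longrightarrow>
      norm ((prod (f b) (g b) - integral {0..b} w) - (prod (f a) (g a) - integral {0..a} w))
        \<le> e * integral {a..b} v"
      using d1(1) d2(1) by (intro exI[of _ "min d1 d2"]) auto
  qed
  have "prod (f x) (g x) = prod (f 0) (g 0) + integral {0..x} w" if "x \<in> {0..1}" for x
    using const[OF that] by (simp add: algebra_simps)
  then show ?thesis
    using w unfolding is_primitive_def w_def[symmetric] by blast
qed

text \<open>
  The chain rule. On \<open>[a, b]\<close> with \<open>D = f b - f a\<close> the error splits into \<open>exp (f a) (exp D - 1 - D)\<close>,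
  which is small compared with \<open>|D|\<close>, and the integral of \<open>(exp (f a) - exp (f t)) (f' t)\<close>.
\<close>

lemma is_primitive_exp:
  fixes f :: "real \<Rightarrow> complex"
  assumes f: "is_primitive f f'"
  shows "is_primitive (\<lambda>x. exp (f x)) (\<lambda>x. exp (f x) * f' x)"
proof -
  have f': "f' absolutely_integrable_on {0..1}"
    using f by (rule is_primitive_absolutely_integrable)
  note fc = is_primitive_continuous_on[OF f]
  have ec: "continuous_on {0..1} (\<lambda>x. exp (f x))"
    using fc by (intro continuous_intros)
  define w where "w x = exp (f x) * f' x" for x
  have w: "w absolutely_integrable_on {0..1}"
    unfolding w_def using bounded_bilinear_mult ec f'
    by (rule continuous_times_absolutely_integrable)
  have v: "(\<lambda>t. norm (f' t)) integrable_on {0..1}"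
    using f' by (auto simp: absolutely_integrable_on_def)
  have const: "exp (f x) - integral {0..x} w = exp (f 0) - integral {0..0} w"
    if x: "x \<in> {0..1}" for x
  proof (rule small_increments_imp_constant[OF v _ x])
    fix e :: real assume e: "e > 0"
    have "bounded ((\<lambda>x. exp (f x)) ` {0..1})"
      using ec by (intro compact_imp_bounded compact_continuous_image) auto
    then obtain M where M: "M > 0" "\<And>t. t \<in> {0..1} \<Longrightarrow> norm (exp (f t)) \<le> M"
      by (auto simp: bounded_pos)
    have "\<forall>e>0. \<exists>d>0. \<forall>z::complex. norm (z - 0) < d \<longrightarrow>
        norm (exp z - exp 0 - exp 0 * (z - 0)) \<le> e * norm (z - 0)"
      using DERIV_exp[of "0::complex"] unfolding has_field_derivative_def has_derivative_at_alt by blast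
    moreover have "e / (2 * M) > 0"
      using e M(1) by simp
    ultimately obtain r where "r > 0" "\<forall>z::complex. norm (z - 0) < r \<longrightarrow>
        norm (exp z - exp 0 - exp 0 * (z - 0)) \<le> e / (2 * M) * norm (z - 0)"
      by blast
    then have r: "r > 0" "\<And>z::complex. norm z < r \<Longrightarrow> norm (exp z - 1 - z) \<le> e / (2 * M) * norm z"
      by auto
    obtain d1 where d1: "d1 > 0"
        "\<And>a b. a \<in> {0..1} \<Longrightarrow> b \<in> {0..1} \<Longrightarrow> dist b a < d1 \<Longrightarrow> dist (f b) (f a) < r"
      using uniformly_continuous_onE[OF compact_uniformly_continuous[OF fc compact_Icc] r(1)] by blast
    obtain d2 where d2: "d2 > 0"
        "\<And>a b. a \<in> {0..1} \<Longrightarrow> b \<in> {0..1} \<Longrightarrow> dist b a < d2 \<Longrightarrow> dist (exp (f b)) (exp (f a)) < e / 2"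
      using uniformly_continuous_onE[OF compact_uniformly_continuous[OF ec compact_Icc] half_gt_zero[OF e]] by blast
    have "norm ((exp (f b) - integral {0..b} w) - (exp (f a) - integral {0..a} w))
        \<le> e * integral {a..b} (\<lambda>t. norm (f' t))"
      if ab: "0 \<le> a" "a \<le> b" "b \<le> 1" "b - a < min d1 d2" for a b
    proof -
      note F = is_primitive_increment[OF f ab(1-3)]
      have vab: "(\<lambda>t. norm (f' t)) integrable_on {a..b}"
        using integrable_subinterval_real[OF v, of a b] ab by auto
      define D where "D = f b - f a"
      have D: "norm D \<le> integral {a..b} (\<lambda>t. norm (f' t))"
        using integral_norm_bound_integral[OF has_integral_integrable[OF F] vab] integral_unique[OF F]
        by (simp add: D_def)
      have "norm D < r"
        using d1(2)[of a b] ab by (auto simp: dist_norm D_def)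
      have "norm (exp (f a) * (exp D - 1 - D)) \<le> M * (e / (2 * M) * norm D)"
        unfolding norm_mult using r(2)[OF \<open>norm D < r\<close>] M ab by (intro mult_mono) auto
      also have "\<dots> \<le> e / 2 * integral {a..b} (\<lambda>t. norm (f' t))"
        using M(1) D e by simp
      finally have 1: "norm (exp (f a) * (exp D - 1 - D)) \<le> e / 2 * integral {a..b} (\<lambda>t. norm (f' t))" .
      have "((\<lambda>t. exp (f a) * f' t) has_integral exp (f a) * D) {a..b}"
        unfolding D_def using has_integral_mult_right[OF F] .
      moreover have "(w has_integral (integral {0..b} w - integral {0..a} w)) {a..b}"
        using is_primitive_increment[OF is_primitiveI_integral[OF w, of 0] ab(1-3)] by simp
      ultimately have I: "((\<lambda>t. exp (f a) * f' t - w t) has_integral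
          (exp (f a) * D - (integral {0..b} w - integral {0..a} w))) {a..b}"
        by (rule has_integral_diff)
      have "norm (integral {a..b} (\<lambda>t. exp (f a) * f' t - w t)) \<le> integral {a..b} (\<lambda>t. e / 2 * norm (f' t))"
      proof (rule integral_norm_bound_integral)
        show "(\<lambda>t. e / 2 * norm (f' t)) integrable_on {a..b}"
          using integrable_on_cmult_left[OF vab, of "e / 2"] by simp
        fix t assume t: "t \<in> {a..b}"
        have "norm (exp (f a) - exp (f t)) \<le> e / 2"
          using d2(2)[of t a] ab t by (auto simp: dist_norm)
        then show "norm (exp (f a) * f' t - w t) \<le> e / 2 * norm (f' t)"
          unfolding w_def left_diff_distrib[symmetric] norm_mult by (intro mult_right_mono) auto
      qed (use I in auto)
      then have 2: "norm (exp (f a) * D - (integral {0..b} w - integral {0..a} w))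
          \<le> e / 2 * integral {a..b} (\<lambda>t. norm (f' t))"
        using integral_unique[OF I] by simp
      have "exp (f b) = exp (f a) * exp D"
        by (simp add: D_def flip: exp_add)
      then have "(exp (f b) - integral {0..b} w) - (exp (f a) - integral {0..a} w)
          = exp (f a) * (exp D - 1 - D) + (exp (f a) * D - (integral {0..b} w - integral {0..a} w))"
        by (simp add: algebra_simps)
      moreover have "e / 2 * J + e / 2 * J = e * J" for J
        by simp
      ultimately show ?thesis
        using norm_triangle_mono[OF 1 2] by (simp only:)
    qed
    then show "\<exists>d>0. \<forall>a b. 0 \<le> a \<longrightarrow> a \<le> b \<longrightarrow> b \<le> 1 \<longrightarrow> b - a < d \<longrightarrow>
      norm ((exp (f b) - integral {0..b} w) - (exp (f a) - integral {0..a} w))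
        \<le> e * integral {a..b} (\<lambda>t. norm (f' t))"
      using d1(1) d2(1) by (intro exI[of _ "min d1 d2"]) auto
  qed
  have "exp (f x) = exp (f 0) + integral {0..x} w" if "x \<in> {0..1}" for x
    using const[OF that] by (simp add: algebra_simps)
  then show ?thesis
    using w unfolding is_primitive_def w_def[symmetric] by blast
qed

text \<open>
  By the two rules above, \<open>p exp(- \<integral> h/p)\<close> has derivative zero. This provides a continuous complex
  logarithm of \<open>p\<close> without any choice of branches.
\<close>

lemma is_primitive_log:
  fixes p :: "real \<Rightarrow> complex"
  assumes p: "is_primitive p h" and nz: "\<And>x. x \<in> {0..1} \<Longrightarrow> p x \<noteq> 0"
  shows "(\<lambda>x. h x / p x) absolutely_integrable_on {0..1}"
    and "x \<in> {0..1} \<Longrightarrow> p x = p 0 * exp (integral {0..x} (\<lambda>x. h x / p x))"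
proof -
  have h: "h absolutely_integrable_on {0..1}"
    using p by (rule is_primitive_absolutely_integrable)
  have "continuous_on {0..1} (\<lambda>x. inverse (p x))"
    using is_primitive_continuous_on[OF p] nz by (intro continuous_intros) auto
  from continuous_times_absolutely_integrable[OF bounded_bilinear_mult this h]
  show ai: "(\<lambda>x. h x / p x) absolutely_integrable_on {0..1}"
    by (simp add: field_simps)
  define q where "q x = h x / p x" for x
  define E where "E x = exp (0 + integral {0..x} (\<lambda>x. - q x))" for x
  have "is_primitive (\<lambda>x. 0 + integral {0..x} (\<lambda>x. - q x)) (\<lambda>x. - q x)"
    using absolutely_integrable_linear[OF ai bounded_linear_minus[OF bounded_linear_ident]]
    by (intro is_primitiveI_integral) (simp add: o_def q_def)
  from is_primitive_exp[OF this] have E: "is_primitive E (\<lambda>x. E x * - q x)"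
    unfolding E_def .
  note pE = is_primitive_bilinear[OF bounded_bilinear_mult p E]
  show "p x = p 0 * exp (integral {0..x} (\<lambda>x. h x / p x))" if x: "x \<in> {0..1}"
  proof -
    have "((\<lambda>x. p x * (E x * - q x) + h x * E x) has_integral (p x * E x - p 0 * E 0)) {0..x}"
      using is_primitive_increment[OF pE, of 0 x] x by simp
    moreover have "p t * (E t * - q t) + h t * E t = 0" if "t \<in> {0..x}" for t
    proof -
      have "p t * q t = h t"
        using nz[of t] that x by (simp add: q_def)
      then have "h t * E t = p t * (E t * q t)"
        by (simp only: mult_ac)
      then show ?thesis
        by simp
    qed
    then have "((\<lambda>x. p x * (E x * - q x) + h x * E x) has_integral 0) {0..x}"
      by (intro has_integral_is_0) auto
    ultimately have "p x * E x - p 0 * E 0 = 0"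
      by (rule has_integral_unique)
    then have "p x * E x = p 0"
      by (simp add: E_def)
    moreover have "E x * exp (integral {0..x} q) = 1"
      by (simp add: E_def exp_minus)
    ultimately have "p x = p 0 * exp (integral {0..x} q)"
      by (metis mult.assoc mult.right_neutral)
    then show ?thesis
      unfolding q_def .
  qed
qed

section \<open>Weak derivatives and trigonometric waves\<close>

lemma equal_derivatives_imp_equal_differences:
  fixes f g :: "real \<Rightarrow> 'a::real_normed_vector"
  assumes "\<And>x. (f has_vector_derivative D x) (at x)" "\<And>x. (g has_vector_derivative D x) (at x)"
  shows "f x - f y = g x - g y"
proof -
  have "((\<lambda>x. f x - g x) has_vector_derivative 0) (at x)" for x
    using has_vector_derivative_diff[OF assms(1)[of x] assms(2)[of x]] by simp
  then have "f x - g x = f y - g y"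
    by (intro has_derivative_zero_unique[of UNIV]) (auto simp: has_vector_derivative_def)
  then show ?thesis by (simp add: algebra_simps)
qed

lemma has_vector_derivative_shift:
  fixes f :: "real \<Rightarrow> 'a::real_normed_vector"
  assumes "(f has_vector_derivative D) (at (x + c))"
  shows "((\<lambda>x. f (x + c)) has_vector_derivative D) (at x)"
proof -
  have "((\<lambda>x. x + c) has_vector_derivative 1) (at x)"
    by (auto intro!: derivative_eq_intros)
  from vector_diff_chain_at[OF this, of f D] assms show ?thesis
    by (simp add: o_def)
qed

text \<open>
  Used both for periodic functions (\<open>c = 0\<close>) and for the arclength or an angle, which grows by a
  fixed amount over each period.
\<close>

lemma quasi_periodic_of_int:
  fixes g :: "real \<Rightarrow> 'a::ring_1"
  assumes "\<And>x. g (x + w) = g x + c"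
  shows "g (x + of_int k * w) = g x + of_int k * c"
proof -
  have nat: "g (x + of_nat n * w) = g x + of_nat n * c" for x n
  proof (induction n)
    case (Suc n)
    have "g (x + of_nat (Suc n) * w) = g (x + of_nat n * w + w)"
      by (simp add: algebra_simps)
    then show ?case
      using Suc assms[of "x + of_nat n * w"] by (simp add: distrib_right)
  qed simp
  show ?thesis
  proof (cases "k \<ge> 0")
    case True
    then show ?thesis
      using nat[of x "nat k"] by simp
  next
    case False
    then show ?thesis
      using nat[of "x + of_int k * w" "nat (- k)"] by (simp add: algebra_simps)
  qed
qed

lemma is_primitive_linear:
  assumes "bounded_linear l" and f: "is_primitive f g"
  shows "is_primitive (\<lambda>x. l (f x)) (\<lambda>x. l (g x))"
proof -
  have "l (f x) = l (f 0) + integral {0..x} (\<lambda>x. l (g x))" if x: "x \<in> {0..1}" for x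
  proof -
    have "((\<lambda>x. l (g x)) has_integral l (f x - f 0)) {0..x}"
      using has_integral_linear[OF is_primitive_increment[OF f, of 0 x] assms(1)] x by (simp add: o_def)
    then have "integral {0..x} (\<lambda>x. l (g x)) = l (f x) - l (f 0)"
      using bounded_linear.linear[OF assms(1)] by (simp add: integral_unique linear_diff)
    then show ?thesis
      by simp
  qed
  moreover have "(\<lambda>x. l (g x)) absolutely_integrable_on {0..1}"
    using absolutely_integrable_linear[OF is_primitive_absolutely_integrable[OF f] assms(1)]
    by (simp add: o_def)
  ultimately show ?thesis
    unfolding is_primitive_def by blast
qed

lemma is_primitive_cong:
  assumes f: "is_primitive f g" and eq: "\<And>x. x \<in> {0..1} \<Longrightarrow> f x = F x"
  shows "is_primitive F g"
proof -
  have "F x = F 0 + integral {0..x} g" if "x \<in> {0..1}" for x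
    using is_primitive_eq[OF f that] eq[OF that] eq[of 0] by auto
  then show ?thesis
    using is_primitive_absolutely_integrable[OF f] unfolding is_primitive_def by blast
qed

text \<open>
  The phase \<open>a\<close> makes the family closed under differentiation, which shifts it by \<open>\<pi>/2\<close>.
\<close>

definition wave :: "int \<Rightarrow> real \<Rightarrow> real \<Rightarrow> real" where
  "wave k a x = cos (2 * pi * of_int k * x + a)"

lemma wave_periodic: "wave k a (x + 1) = wave k a x"
proof -
  have *: "2 * pi * of_int k * (x + 1) + a = (2 * pi * of_int k * x + a) + 2 * pi * of_int k"
    by (simp add: algebra_simps)
  have "cos (y + 2 * pi * of_int k) = cos y" for y
    by (simp add: cos_add)
  then show ?thesis
    unfolding wave_def * by blast
qed

lemma wave_has_real_derivative:
  "(wave k a has_real_derivative 2 * pi * of_int k * wave k (a + pi / 2) x) (at x within S)"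
proof -
  have "- sin y = cos (y + pi / 2)" for y :: real
    by (simp add: cos_add)
  then show ?thesis
    unfolding wave_def[abs_def]
    by (auto intro!: derivative_eq_intros simp: algebra_simps)
qed

lemma wave_continuous_on [continuous_intros]: "continuous_on S (wave k a)"
  unfolding wave_def[abs_def] by (intro continuous_intros)

lemma wave_zero_freq: "wave 0 a x = cos a"
  by (simp add: wave_def)

lemma test_function_wave: "test_function (wave k a)"
proof -
  have "\<exists>c b. (deriv ^^ j) (wave k a) = (\<lambda>x. c * wave k b x)" for j
  proof (induction j)
    case 0
    then show ?case by (intro exI[of _ 1] exI[of _ a]) simp
  next
    case (Suc j)
    then obtain c b where "(deriv ^^ j) (wave k a) = (\<lambda>x. c * wave k b x)" by blast
    moreover have "deriv (\<lambda>x. c * wave k b x) x = (c * (2 * pi * of_int k)) * wave k (b + pi / 2) x" for x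
      using DERIV_cmult[OF wave_has_real_derivative, of c k b x UNIV]
      by (intro DERIV_imp_deriv) (simp add: mult.assoc)
    ultimately show ?case
      by auto
  qed
  moreover have "(\<lambda>x. c * wave k b x) field_differentiable at x" for c b x
    using DERIV_cmult[OF wave_has_real_derivative, of c k b x UNIV]
    unfolding field_differentiable_def by blast
  ultimately have "(deriv ^^ j) (wave k a) field_differentiable at x" for j x
    by metis
  then show ?thesis
    unfolding test_function_def periodic1_def using wave_periodic by blast
qed

definition wave_coeff :: "(real \<Rightarrow> 'a::euclidean_space) \<Rightarrow> int \<Rightarrow> real \<Rightarrow> 'a" where
  "wave_coeff f k a = integral {0..1} (\<lambda>x. wave k a x *\<^sub>R f x)"

text \<open>
  The relation between a function and its weak derivative, tested with waves only.
\<close>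

definition wave_derivative :: "(real \<Rightarrow> 'a::euclidean_space) \<Rightarrow> (real \<Rightarrow> 'a) \<Rightarrow> bool" where
  "wave_derivative f g \<longleftrightarrow>
     (\<forall>k a. (2 * pi * of_int k) *\<^sub>R wave_coeff f k (a + pi / 2) = - wave_coeff g k a)"

lemma wave_times_absolutely_integrable:
  fixes f :: "real \<Rightarrow> 'a::euclidean_space"
  shows "f absolutely_integrable_on {0..1} \<Longrightarrow> (\<lambda>x. wave k a x *\<^sub>R f x) integrable_on {0..1}"
  using continuous_times_absolutely_integrable[OF bounded_bilinear_scaleR wave_continuous_on, where g = f and a = 0 and b = 1]
    set_lebesgue_integral_eq_integral(1) by blast

lemma wave_coeff_diff:
  assumes "f absolutely_integrable_on {0..1}" "g absolutely_integrable_on {0..1}"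
  shows "wave_coeff (\<lambda>x. f x - g x) k a = wave_coeff f k a - wave_coeff g k a"
  using assms by (simp add: wave_coeff_def scaleR_diff_right integral_diff wave_times_absolutely_integrable)

lemma wave_coeff_zero_freq: "wave_coeff f 0 a = cos a *\<^sub>R integral {0..1} f"
  by (simp add: wave_coeff_def wave_zero_freq)

lemma wave_derivative_integral_0:
  assumes "wave_derivative f g" shows "integral {0..1} g = 0"
proof -
  have "wave_coeff g 0 0 = 0"
    using assms[unfolded wave_derivative_def, rule_format, of 0 0] by simp
  then show ?thesis
    by (simp add: wave_coeff_zero_freq)
qed

lemma has_weak_derivative_imp_wave_derivative:
  assumes "has_weak_derivative f g" shows "wave_derivative f g"
  unfolding wave_derivative_def
proof (intro allI)
  fix k a
  have "deriv (wave k a) x = 2 * pi * of_int k * wave k (a + pi / 2) x" for x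
    using wave_has_real_derivative by (intro DERIV_imp_deriv)
  then have "integral {0..1} (\<lambda>x. (2 * pi * of_int k) *\<^sub>R (wave k (a + pi / 2) x *\<^sub>R f x))
      = - integral {0..1} (\<lambda>x. wave k a x *\<^sub>R g x)"
    using assms test_function_wave[of k a] unfolding has_weak_derivative_def by auto
  then show "(2 * pi * of_int k) *\<^sub>R wave_coeff f k (a + pi / 2) = - wave_coeff g k a"
    by (simp add: wave_coeff_def del: scaleR_scaleR)
qed

lemma is_primitive_by_parts:
  fixes f :: "real \<Rightarrow> 'a::euclidean_space"
  assumes f: "is_primitive f g" "f 0 = f 1" and \<phi>: "is_primitive \<phi> \<psi>" "\<phi> 0 = \<phi> 1"
  shows "integral {0..1} (\<lambda>x. \<psi> x *\<^sub>R f x) = - integral {0..1} (\<lambda>x. \<phi> x *\<^sub>R g x)"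
proof -
  have "((\<lambda>x. \<phi> x *\<^sub>R g x + \<psi> x *\<^sub>R f x) has_integral 0) {0..1}"
    using is_primitive_increment[OF is_primitive_bilinear[OF bounded_bilinear_scaleR \<phi>(1) f(1)], of 0 1]
      f(2) \<phi>(2) by simp
  moreover have "(\<lambda>x. \<phi> x *\<^sub>R g x) integrable_on {0..1}"
    using continuous_times_absolutely_integrable[OF bounded_bilinear_scaleR
        is_primitive_continuous_on[OF \<phi>(1)] is_primitive_absolutely_integrable[OF f(1)]]
    by (simp add: absolutely_integrable_on_def)
  moreover have "(\<lambda>x. \<psi> x *\<^sub>R f x) integrable_on {0..1}"
    using continuous_times_absolutely_integrable[OF bounded_bilinear.flip[OF bounded_bilinear_scaleR]
        is_primitive_continuous_on[OF f(1)] is_primitive_absolutely_integrable[OF \<phi>(1)]]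
    by (simp add: absolutely_integrable_on_def)
  ultimately have "integral {0..1} (\<lambda>x. \<phi> x *\<^sub>R g x) + integral {0..1} (\<lambda>x. \<psi> x *\<^sub>R f x) = 0"
    by (metis integral_add integral_unique)
  then show ?thesis
    by (simp add: eq_neg_iff_add_eq_0 add.commute)
qed

lemma is_primitive_imp_wave_derivative:
  assumes "is_primitive f g" "f 0 = f 1"
  shows "wave_derivative f g"
  unfolding wave_derivative_def
proof (intro allI)
  fix k a
  have "is_primitive (wave k a) (\<lambda>x. 2 * pi * of_int k * wave k (a + pi / 2) x)"
    using wave_has_real_derivative
    by (intro C1_is_primitive) (auto simp: has_real_derivative_iff_has_vector_derivative intro!: continuous_intros)
  from is_primitive_by_parts[OF assms this]
  have "integral {0..1} (\<lambda>x. (2 * pi * of_int k) *\<^sub>R (wave k (a + pi / 2) x *\<^sub>R f x))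
      = - integral {0..1} (\<lambda>x. wave k a x *\<^sub>R g x)"
    using wave_periodic[of k a 0] by simp
  then show "(2 * pi * of_int k) *\<^sub>R wave_coeff f k (a + pi / 2) = - wave_coeff g k a"
    by (simp add: wave_coeff_def del: scaleR_scaleR)
qed

lemma test_function_is_primitive:
  assumes "test_function \<phi>"
  shows "is_primitive \<phi> (deriv \<phi>)" and "\<phi> 0 = \<phi> 1"
proof -
  have d: "\<phi> field_differentiable at x" "deriv \<phi> field_differentiable at x" for x
    using assms[unfolded test_function_def, THEN conjunct2, rule_format, of 0 x]
      assms[unfolded test_function_def, THEN conjunct2, rule_format, of 1 x] by simp_all
  show "is_primitive \<phi> (deriv \<phi>)"
  proof (rule C1_is_primitive)
    show "(\<phi> has_vector_derivative deriv \<phi> x) (at x within {0..1})" for x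
      using d(1)[of x] by (auto simp: field_differentiable_derivI
        simp flip: has_real_derivative_iff_has_vector_derivative intro: has_field_derivative_at_within)
    show "continuous_on {0..1} (deriv \<phi>)"
      using d(2) by (intro continuous_at_imp_continuous_on ballI field_differentiable_imp_continuous_at)
  qed
  show "\<phi> 0 = \<phi> 1"
    using assms unfolding test_function_def periodic1_def by (metis add_0)
qed

text \<open>
  Integration by parts is the product rule for primitives, since the boundary terms cancel.
\<close>

lemma is_primitive_imp_has_weak_derivative:
  assumes "is_primitive f g" "f 0 = f 1"
  shows "has_weak_derivative f g"
  unfolding has_weak_derivative_def
proof (intro conjI allI impI)
  show "f absolutely_integrable_on {0..1}"
    using is_primitive_continuous_on[OF assms(1)] by (rule absolutely_integrable_continuous_real)
  show "g absolutely_integrable_on {0..1}"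
    using assms(1) by (rule is_primitive_absolutely_integrable)
  show "integral {0..1} (\<lambda>x. deriv \<phi> x *\<^sub>R f x) = - integral {0..1} (\<lambda>x. \<phi> x *\<^sub>R g x)"
    if "test_function \<phi>" for \<phi>
    using is_primitive_by_parts[OF assms test_function_is_primitive[OF that]] .
qed

text \<open>
  The primitive \<open>P\<close> of \<open>g\<close> has the same weak derivative as \<open>f\<close>, so \<open>f - P\<close> is orthogonal to all waves
  of nonzero frequency and hence constant.
\<close>

lemma wave_derivative_imp_is_primitive:
  fixes f :: "real \<Rightarrow> 'a::euclidean_space"
  assumes f: "continuous_on {0..1} f" "f 0 = f 1" and g: "g absolutely_integrable_on {0..1}"
    and fg: "wave_derivative f g"
  shows "is_primitive f g"
proof -
  define P where "P x = integral {0..x} g" for x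
  have P: "is_primitive P g"
    using is_primitiveI_integral[OF g, of 0] unfolding P_def by simp
  have P0: "P 0 = 0" and P1: "P 1 = 0"
    using wave_derivative_integral_0[OF fg] by (auto simp: P_def)
  have Pc: "continuous_on {0..1} P"
    by (rule is_primitive_continuous_on[OF P])
  have orth: "wave_coeff (\<lambda>x. f x - P x) k a = 0" if "k \<noteq> 0" for k a
  proof -
    have "wave_derivative P g"
      using is_primitive_imp_wave_derivative[OF P] P0 P1 by simp
    with fg have "(2 * pi * of_int k) *\<^sub>R wave_coeff f k a = (2 * pi * of_int k) *\<^sub>R wave_coeff P k a"
      unfolding wave_derivative_def by (metis diff_add_cancel)
    then have "wave_coeff f k a = wave_coeff P k a"
      using that by simp
    then show ?thesis
      using f Pc by (simp add: wave_coeff_diff absolutely_integrable_continuous_real)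
  qed
  have C: "f x - P x = f 0 - P 0" if "x \<in> {0..1}" for x
    using f P0 P1 Pc orth that
    by (intro orthogonal_to_waves_imp_constant[where f = "\<lambda>x. f x - P x"])
      (auto intro!: continuous_intros simp: wave_coeff_def wave_def)
  have "f x = f 0 + integral {0..x} g" if "x \<in> {0..1}" for x
    using C[OF that] by (simp add: P_def algebra_simps)
  then show ?thesis
    using g unfolding is_primitive_def by blast
qed

text \<open>
  The first weak derivative \<open>g\<close> is merely integrable, so the previous lemma does not apply to it.
  But the primitive \<open>p\<close> of \<open>h\<close> with mean zero has the same wave coefficients as \<open>g\<close> and can replace it
  as weak derivative of the continuous function \<open>f\<close>.
\<close>

lemma second_wave_derivative_imp_C1:
  fixes f :: "real \<Rightarrow> 'a::euclidean_space"
  assumes f: "continuous_on {0..1} f" "f 0 = f 1"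
    and g: "g absolutely_integrable_on {0..1}" and h: "h absolutely_integrable_on {0..1}"
    and fg: "wave_derivative f g" and gh: "wave_derivative g h"
  obtains p where "is_primitive f p" "is_primitive p h" "p 0 = p 1"
proof -
  define c where "c = - integral {0..1} (\<lambda>x. integral {0..x} h)"
  \<comment> \<open>The constant \<open>c\<close> makes the mean of \<open>p\<close> zero, which is the wave of frequency zero.\<close>
  define p where "p x = c + integral {0..x} h" for x
  have p: "is_primitive p h"
    unfolding p_def by (rule is_primitiveI_integral[OF h])
  have p01: "p 0 = p 1"
    using wave_derivative_integral_0[OF gh] by (simp add: p_def)
  have pc: "continuous_on {0..1} p"
    by (rule is_primitive_continuous_on[OF p])
  have "(\<lambda>x. integral {0..x} h) integrable_on {0..1}"
    using is_primitive_continuous_on[OF is_primitiveI_integral[OF h, of 0]]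
    by (intro integrable_continuous_real) simp
  then have p_int: "integral {0..1} p = 0"
    using integral_add[OF integrable_const_ivl, of "\<lambda>x. integral {0..x} h" 0 1 c]
    unfolding p_def by (simp add: c_def)
  have "wave_coeff p k a = wave_coeff g k a" for k a
  proof (cases "k = 0")
    case True
    then show ?thesis
      using p_int wave_derivative_integral_0[OF fg] by (simp add: wave_coeff_zero_freq)
  next
    case False
    have "(2 * pi * of_int k) *\<^sub>R wave_coeff p k a = (2 * pi * of_int k) *\<^sub>R wave_coeff g k a"
      using gh is_primitive_imp_wave_derivative[OF p p01]
      unfolding wave_derivative_def by (metis diff_add_cancel)
    then show ?thesis
      using False by simp
  qed
  then have "wave_derivative f p"
    using fg unfolding wave_derivative_def by simp
  then have "is_primitive f p"
    using f pc by (intro wave_derivative_imp_is_primitive absolutely_integrable_continuous_real)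
  then show ?thesis
    using that p p01 by blast
qed

text \<open>
  The previous lemma describes the curve on the fundamental domain only. The antiderivative \<open>G\<close> of
  the periodic extension of the derivative is periodic as well and agrees with the curve there up
  to a constant, hence everywhere; this settles differentiability at the integers.
\<close>

lemma W21_curve_C1:
  assumes "W21_curve \<gamma>"
  shows "(\<gamma> has_vector_derivative dx \<gamma> x) (at x)"
    and "continuous_on UNIV (dx \<gamma>)"
    and "\<exists>h. is_primitive (dx \<gamma>) h"
proof -
  have per: "\<gamma> (x + 1) = \<gamma> x" for x
    using assms by (simp add: W21_curve_def periodic1_def)
  have cont: "continuous_on {0..1} \<gamma>"
    using assms continuous_on_subset unfolding W21_curve_def by blast
  obtain g h where gh: "has_weak_derivative \<gamma> g" "has_weak_derivative g h"
    using assms unfolding W21_curve_def by blast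
  have end_eq: "\<gamma> 0 = \<gamma> 1"
    using per[of 0] by simp
  have "g absolutely_integrable_on {0..1}" "h absolutely_integrable_on {0..1}"
    using gh unfolding has_weak_derivative_def by blast+
  then obtain p where p: "is_primitive \<gamma> p" "is_primitive p h" "p 0 = p 1"
    using second_wave_derivative_imp_C1[OF cont end_eq _ _
        gh[THEN has_weak_derivative_imp_wave_derivative]] by blast
  obtain P where P: "continuous_on UNIV P" "\<And>x. P (x + 1) = P x" "\<And>x. x \<in> {0..1} \<Longrightarrow> P x = p x"
    using periodic_continuous_extension[OF is_primitive_continuous_on[OF p(2)] p(3)] by blast
  obtain G where G: "\<And>x. (G has_vector_derivative P x) (at x)"
    using einterval_antiderivative[of "-\<infinity>" "\<infinity>" P] P(1)
    by (auto simp: continuous_on_eq_continuous_at)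
  have G\<gamma>: "G x - \<gamma> x = G 0 - \<gamma> 0" if x: "x \<in> {0..1}" for x
  proof -
    have "(P has_integral (G x - G 0)) {0..x}"
      using x by (intro fundamental_theorem_of_calculus) (auto intro: has_vector_derivative_at_within[OF G])
    moreover have "(P has_integral (\<gamma> x - \<gamma> 0)) {0..x}"
      using is_primitive_increment[OF p(1), of 0 x] x P(3)
      by (subst has_integral_cong[of _ P p]) auto
    ultimately have "G x - G 0 = \<gamma> x - \<gamma> 0"
      by (rule has_integral_unique)
    then show ?thesis
      by (simp add: algebra_simps)
  qed
  have G1: "G (x + 1) = G x" for x
  proof -
    have "((\<lambda>x. G (x + 1)) has_vector_derivative P x) (at x)" for x
      using has_vector_derivative_shift[OF G[of "x + 1"]] P(2)[of x] by simp
    from equal_derivatives_imp_equal_differences[OF this G, of x 0]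
    have "G (x + 1) - G 1 = G x - G 0" by simp
    moreover have "G 1 = G 0"
      using G\<gamma>[of 1] per[of 0] by simp
    ultimately show ?thesis by simp
  qed
  define D where "D x = G x - \<gamma> x" for x
  have D_int: "D (x + of_int k * 1) = D x" for x k
    using quasi_periodic_of_int[of D 1 0 x k] G1 per by (simp add: D_def)
  have "D x = D 0" for x
  proof -
    have "D x = D (frac x)"
      using D_int[of "frac x" "\<lfloor>x\<rfloor>"] by (simp add: frac_def)
    also have "\<dots> = D 0"
      using G\<gamma>[of "frac x"] frac_ge_0[of x] frac_lt_1[of x] by (simp add: D_def)
    finally show ?thesis .
  qed
  then have \<gamma>_eq: "\<gamma> x = G x - D 0" for x
    by (metis D_def add_diff_cancel_left' diff_add_cancel)
  have d: "(\<gamma> has_vector_derivative P x) (at x)" for x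
    unfolding \<gamma>_eq[abs_def] using G[of x] by (auto intro!: derivative_eq_intros)
  then have dx: "dx \<gamma> x = P x" for x
    unfolding dx_def by (rule vector_derivative_at)
  show "(\<gamma> has_vector_derivative dx \<gamma> x) (at x)"
    using d dx by simp
  show "continuous_on UNIV (dx \<gamma>)"
    using P(1) dx by (simp add: continuous_on_cong[of UNIV UNIV "dx \<gamma>" P])
  show "\<exists>h. is_primitive (dx \<gamma>) h"
    using is_primitive_cong[OF p(2), of "dx \<gamma>"] P(3) dx by auto
qed

lemma W21_curveI:
  assumes per: "\<And>x. \<gamma> (x + 1) = \<gamma> x"
    and d1: "\<And>x. (\<gamma> has_vector_derivative \<gamma>' x) (at x)"
    and d2: "\<And>x. (\<gamma>' has_vector_derivative \<gamma>'' x) (at x)"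
    and cont: "continuous_on UNIV \<gamma>''"
  shows "W21_curve \<gamma>"
proof -
  have c0: "continuous_on UNIV \<gamma>" and c1: "continuous_on UNIV \<gamma>'"
    using d1 d2 by (auto intro!: continuous_at_imp_continuous_on has_vector_derivative_continuous)
  have "((\<lambda>x. \<gamma> (x + 1)) has_vector_derivative \<gamma>' (x + 1)) (at x)" for x
    using has_vector_derivative_shift[OF d1[of "x + 1"]] .
  then have "\<gamma>' (x + 1) = \<gamma>' x" for x
    using per d1 by (metis (no_types, lifting) ext vector_derivative_at)
  from this[of 0] have "\<gamma>' 0 = \<gamma>' 1" by simp
  moreover have "\<gamma> 0 = \<gamma> 1"
    using per[of 0] by simp
  moreover have "is_primitive \<gamma> \<gamma>'"
    by (rule C1_is_primitive[OF has_vector_derivative_at_within[OF d1] continuous_on_subset[OF c1]]) simp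
  moreover have "is_primitive \<gamma>' \<gamma>''"
    by (rule C1_is_primitive[OF has_vector_derivative_at_within[OF d2] continuous_on_subset[OF cont]]) simp
  ultimately have "has_weak_derivative \<gamma> \<gamma>'" "has_weak_derivative \<gamma>' \<gamma>''"
    by (auto intro: is_primitive_imp_has_weak_derivative)
  then show ?thesis
    using per c0 unfolding W21_curve_def periodic1_def by blast
qed

section \<open>Curves in the complex plane and their rotation number\<close>

definition to_complex :: "real^2 \<Rightarrow> complex" where
  "to_complex v = Complex (v $ 1) (v $ 2)"

definition of_complex :: "complex \<Rightarrow> real^2" where
  "of_complex z = vector [Re z, Im z]"

lemma to_complex_of_complex [simp]: "to_complex (of_complex z) = z"
  by (simp add: to_complex_def of_complex_def)

lemma of_complex_to_complex [simp]: "of_complex (to_complex v) = v"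
  by (simp add: to_complex_def of_complex_def vec_eq_iff forall_2)

lemma norm_to_complex [simp]: "norm (to_complex v) = norm v"
  by (simp add: to_complex_def norm_vec_def L2_set_def sum_2 cmod_def)

lemma norm_of_complex [simp]: "norm (of_complex z) = norm z"
  by (metis norm_to_complex to_complex_of_complex)

lemma bounded_linear_to_complex: "bounded_linear to_complex"
  by (rule bounded_linear_intro[of _ 1]) (auto simp: to_complex_def complex_eq_iff simp flip: norm_to_complex)

lemma bounded_linear_of_complex: "bounded_linear of_complex"
  by (rule bounded_linear_intro[of _ 1]) (auto simp: of_complex_def vec_eq_iff forall_2 simp flip: norm_of_complex)

lemma inner_to_complex: "v \<bullet> w = Re (cnj (to_complex v) * to_complex w)"
  by (simp add: to_complex_def inner_vec_def sum_2)

lemma to_complex_rot: "to_complex (rot t *v v) = cis t * to_complex v"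
  by (simp add: to_complex_def rot_def matrix_vector_mult_def sum_2 complex_eq_iff)

lemma to_complex_rot90: "to_complex (rot90 *v v) = \<i> * to_complex v"
  by (simp add: to_complex_rot)

lemma to_complex_scaleR: "to_complex (c *\<^sub>R v) = c *\<^sub>R to_complex v"
  by (simp add: to_complex_def complex_eq_iff)

lemma unit_tangent_complex:
  "to_complex (unit_tangent \<gamma> x) = to_complex (dx \<gamma> x) / norm (dx \<gamma> x)"
proof -
  have "to_complex (unit_tangent \<gamma> x) = (1 / norm (dx \<gamma> x)) *\<^sub>R to_complex (dx \<gamma> x)"
    unfolding unit_tangent_def to_complex_scaleR ..
  then show ?thesis
    by (simp add: scaleR_conv_of_real)
qed

lemma regular_curve_nonzero: "regular_curve \<gamma> \<Longrightarrow> dx \<gamma> x \<noteq> 0"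
  unfolding regular_curve_def by (metis norm_zero not_le)

lemma unit_tangent_norm:
  assumes "regular_curve \<gamma>" shows "norm (unit_tangent \<gamma> x) = 1"
  using regular_curve_nonzero[OF assms] by (simp add: unit_tangent_def)

lemma dx_periodic:
  assumes "W21_curve \<gamma>" shows "dx \<gamma> (x + 1) = dx \<gamma> x"
proof -
  have "\<gamma> (y + 1) = \<gamma> y" for y
    using assms by (simp add: W21_curve_def periodic1_def)
  then have "((\<lambda>x. \<gamma> x) has_vector_derivative dx \<gamma> (x + 1)) (at x)"
    using has_vector_derivative_shift[OF W21_curve_C1(1)[OF assms, of "x + 1"]] by simp
  then show ?thesis
    using W21_curve_C1(1)[OF assms] vector_derivative_at by (metis eta_contract_eq)
qed

lemma unit_tangent_continuous_on:
  assumes "W21_curve \<gamma>" "regular_curve \<gamma>"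
  shows "continuous_on S (unit_tangent \<gamma>)"
proof -
  have "continuous_on S (dx \<gamma>)"
    using W21_curve_C1(2)[OF assms(1)] by (rule continuous_on_subset) simp
  then show ?thesis
    unfolding unit_tangent_def[abs_def]
    using regular_curve_nonzero[OF assms(2)] by (intro continuous_intros) auto
qed

text \<open>
  Writing \<open>\<gamma>' = p 0 exp \<theta>\<close> with \<open>\<theta>\<close> a primitive, the unit tangent is \<open>(p 0/|p 0|) exp(\<i> Im \<theta>)\<close>,
  which is a primitive by the chain rule for the exponential. Thus the weak derivative selected
  in the definition of the curvature is a genuine one.
\<close>

lemma unit_tangent_weakly_differentiable:
  assumes \<gamma>: "W21_curve \<gamma>" "regular_curve \<gamma>"
  shows "\<exists>h. has_weak_derivative (unit_tangent \<gamma>) h"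
proof -
  define p where "p x = to_complex (dx \<gamma> x)" for x
  obtain h where h: "is_primitive (dx \<gamma>) h"
    using W21_curve_C1(3)[OF \<gamma>(1)] by blast
  have p: "is_primitive p (\<lambda>x. to_complex (h x))"
    unfolding p_def by (rule is_primitive_linear[OF bounded_linear_to_complex h])
  have nz: "p x \<noteq> 0" for x
    using regular_curve_nonzero[OF \<gamma>(2), of x] norm_to_complex[of "dx \<gamma> x"]
    by (auto simp: p_def simp del: norm_to_complex)
  define q where "q x = to_complex (h x) / p x" for x
  define \<theta> where "\<theta> x = integral {0..x} q" for x
  have q: "q absolutely_integrable_on {0..1}"
    unfolding q_def using is_primitive_log(1)[OF p] nz by blast
  have polar: "p x = p 0 * exp (\<theta> x)" if "x \<in> {0..1}" for x
    unfolding \<theta>_def q_def using is_primitive_log(2)[OF p _ that] nz by blast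
  have "is_primitive \<theta> q"
    using is_primitiveI_integral[OF q, of 0] by (simp add: \<theta>_def[abs_def])
  moreover have "bounded_linear (\<lambda>z. \<i> * complex_of_real (Im z))"
    by (intro bounded_linear_const_mult bounded_linear_compose[OF bounded_linear_of_real] bounded_linear_Im)
  ultimately have "is_primitive (\<lambda>x. \<i> * complex_of_real (Im (\<theta> x))) (\<lambda>x. \<i> * complex_of_real (Im (q x)))"
    using is_primitive_linear by blast
  from is_primitive_linear[OF bounded_linear_const_mult[OF bounded_linear_ident] is_primitive_exp[OF this],
      of "p 0 / norm (p 0)"]
  have "is_primitive (\<lambda>x. p 0 / norm (p 0) * exp (\<i> * complex_of_real (Im (\<theta> x))))
     (\<lambda>x. p 0 / norm (p 0) * (exp (\<i> * complex_of_real (Im (\<theta> x))) * (\<i> * complex_of_real (Im (q x)))))"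
    by simp
  from is_primitive_linear[OF bounded_linear_of_complex this]
  obtain g where g: "is_primitive (\<lambda>x. of_complex (p 0 / norm (p 0) * exp (\<i> * complex_of_real (Im (\<theta> x))))) g"
    by blast
  have "is_primitive (unit_tangent \<gamma>) g"
  proof (rule is_primitive_cong[OF g])
    fix x :: real assume x: "x \<in> {0..1}"
    define r where "r = exp (Re (\<theta> x))"
    have "exp (\<theta> x) = r * cis (Im (\<theta> x))" and r: "r > 0"
      by (simp_all add: r_def exp_eq_polar)
    then have "p x = p 0 * (r * cis (Im (\<theta> x)))"
      using polar[OF x] by simp
    then have "p x / norm (p x) = p 0 / norm (p 0) * exp (\<i> * complex_of_real (Im (\<theta> x)))"
      using r by (simp add: norm_mult cis_conv_exp)
    then show "of_complex (p 0 / norm (p 0) * exp (\<i> * complex_of_real (Im (\<theta> x)))) = unit_tangent \<gamma> x"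
      using unit_tangent_complex[of \<gamma> x] by (metis norm_to_complex of_complex_to_complex p_def)
  qed
  moreover have "unit_tangent \<gamma> 0 = unit_tangent \<gamma> 1"
    using dx_periodic[OF \<gamma>(1), of 0] by (simp add: unit_tangent_def)
  ultimately show ?thesis
    using is_primitive_imp_has_weak_derivative by blast
qed

text \<open>
  The unit tangent \<open>T\<close> has modulus one, so the real part of its logarithm \<open>\<integral> T'/T\<close> vanishes, and
  the imaginary part of \<open>T'/T\<close> is the integrand \<open>\<kappa> |\<gamma>'|\<close> of the total curvature.
\<close>

lemma rotation_number_total_angle:
  assumes \<gamma>: "W21_curve \<gamma>" "regular_curve \<gamma>"
  obtains K where "continuous_on {0..1} K"
    "\<And>x. x \<in> {0..1} \<Longrightarrow> to_complex (unit_tangent \<gamma> x) = to_complex (unit_tangent \<gamma> 0) * cis (K x)"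
    "K 1 - K 0 = 2 * pi * rotation_number \<gamma>"
proof -
  define h where "h = weak_dx (unit_tangent \<gamma>)"
  have h: "has_weak_derivative (unit_tangent \<gamma>) h"
    unfolding h_def weak_dx_def using unit_tangent_weakly_differentiable[OF \<gamma>] by (rule someI_ex)
  have "is_primitive (unit_tangent \<gamma>) h"
  proof (rule wave_derivative_imp_is_primitive)
    show "continuous_on {0..1} (unit_tangent \<gamma>)"
      by (rule unit_tangent_continuous_on[OF \<gamma>])
    show "unit_tangent \<gamma> 0 = unit_tangent \<gamma> 1"
      using dx_periodic[OF \<gamma>(1), of 0] by (simp add: unit_tangent_def)
    show "h absolutely_integrable_on {0..1}"
      using h unfolding has_weak_derivative_def by blast
  qed (rule has_weak_derivative_imp_wave_derivative[OF h])
  define T where "T x = to_complex (unit_tangent \<gamma> x)" for x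
  have T: "is_primitive T (\<lambda>x. to_complex (h x))"
    unfolding T_def by (rule is_primitive_linear[OF bounded_linear_to_complex]) fact
  have normT: "norm (T x) = 1" for x
    using unit_tangent_norm[OF \<gamma>(2)] by (simp add: T_def)
  then have nz: "T x \<noteq> 0" for x
    by (metis norm_zero zero_neq_one)
  define q where "q x = to_complex (h x) / T x" for x
  define \<theta> where "\<theta> x = integral {0..x} q" for x
  have q: "q absolutely_integrable_on {0..1}"
    unfolding q_def using is_primitive_log(1)[OF T] nz by blast
  have polar: "T x = T 0 * exp (\<theta> x)" if "x \<in> {0..1}" for x
    unfolding \<theta>_def q_def using is_primitive_log(2)[OF T _ that] nz by blast
  have \<theta>: "is_primitive \<theta> q"
    using is_primitiveI_integral[OF q, of 0] by (simp add: \<theta>_def[abs_def])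
  show ?thesis
  proof
    show "continuous_on {0..1} (\<lambda>x. Im (\<theta> x))"
      using is_primitive_continuous_on[OF \<theta>] by (rule continuous_on_Im)
    show "to_complex (unit_tangent \<gamma> x) = to_complex (unit_tangent \<gamma> 0) * cis (Im (\<theta> x))"
      if "x \<in> {0..1}" for x
    proof -
      have "norm (exp (\<theta> x)) = 1"
        using arg_cong[OF polar[OF that], of norm] normT by (simp add: norm_mult)
      then have "exp (Re (\<theta> x)) = 1"
        unfolding norm_exp_eq_Re .
      then have "exp (\<theta> x) = cis (Im (\<theta> x))"
        using exp_eq_polar[of "\<theta> x"] by simp
      then show ?thesis
        using polar[OF that] by (simp add: T_def)
    qed
    have "curvature \<gamma> x * norm (dx \<gamma> x) = Im (q x)" for x
    proof -
      have "curvature \<gamma> x * norm (dx \<gamma> x) = h x \<bullet> unit_normal \<gamma> x"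
        using regular_curve_nonzero[OF \<gamma>(2), of x] by (simp add: curvature_def h_def)
      also have "\<dots> = Im (to_complex (h x) * cnj (T x))"
        by (simp add: inner_to_complex unit_normal_def to_complex_rot90 T_def)
      also have "cnj (T x) = inverse (T x)"
        using normT[of x] by (metis complex_norm_square inverse_unique of_real_1 power_one)
      finally show ?thesis by (simp add: q_def divide_inverse)
    qed
    then have "2 * pi * rotation_number \<gamma> = integral {0..1} (\<lambda>x. Im (q x))"
      by (simp add: rotation_number_def)
    also have "\<dots> = Im (\<theta> 1)"
      using integral_linear[OF _ bounded_linear_Im, of q "{0..1}"] set_lebesgue_integral_eq_integral(1)[OF q]
      by (simp add: \<theta>_def o_def)
    finally show "Im (\<theta> 1) - Im (\<theta> 0) = 2 * pi * rotation_number \<gamma>"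
      by (simp add: \<theta>_def)
  qed
qed

lemma cis_eq_1D:
  assumes "cis t = 1" obtains n :: int where "t = 2 * pi * of_int n"
  using assms by (auto simp: cis_conv_exp exp_eq_1)

text \<open>
  The difference of the two angles is continuous with values in a translate of \<open>2\<pi>\<int>\<close>, hence
  constant.
\<close>

lemma cis_lift_unique:
  fixes f g :: "real \<Rightarrow> real"
  assumes "continuous_on {a..b} f" "continuous_on {a..b} g" and "a \<le> b"
    and eq: "\<And>x. x \<in> {a..b} \<Longrightarrow> cis (f x) = c * cis (g x)"
  shows "f b - f a = g b - g a"
proof -
  define d where "d x = f x - g x" for x
  have c: "cis (d x) = c" if "x \<in> {a..b}" for x
    using eq[OF that] by (simp add: d_def flip: cis_divide)
  have "d constant_on {a..b}"
  proof (rule continuous_discrete_range_constant)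
    show "continuous_on {a..b} d"
      unfolding d_def using assms by (intro continuous_intros)
    \<comment> \<open>Distinct values differ by at least a full turn.\<close>
    have far: "2 * pi \<le> norm (d y - d x)" if "x \<in> {a..b}" "y \<in> {a..b}" "d y \<noteq> d x" for x y
    proof -
      have "cis (d y - d x) = 1"
        using c[OF that(1)] c[OF that(2)] by (metis cis_divide cis_neq_zero divide_self)
      then obtain n :: int where n: "d y - d x = 2 * pi * of_int n"
        using cis_eq_1D by blast
      then have "n \<noteq> 0"
        using that(3) by auto
      then have "1 \<le> \<bar>real_of_int n\<bar>"
        by linarith
      then show ?thesis
        unfolding n by (simp add: abs_mult)
    qed
    show "\<exists>e>0. \<forall>y. y \<in> {a..b} \<and> d y \<noteq> d x \<longrightarrow> e \<le> norm (d y - d x)" if "x \<in> {a..b}" for x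
      using far[OF that] by (intro exI[of _ "2 * pi"]) auto
  qed (rule connected_Icc)
  then have "d b = d a"
    using \<open>a \<le> b\<close> unfolding constant_on_def by auto
  then show ?thesis by (simp add: d_def)
qed

lemma rotation_number_eq:
  assumes \<gamma>: "W21_curve \<gamma>" "regular_curve \<gamma>" and f: "continuous_on {0..1} f"
    and eq: "\<And>x. x \<in> {0..1} \<Longrightarrow> to_complex (unit_tangent \<gamma> x) = cis (f x)"
  shows "2 * pi * rotation_number \<gamma> = f 1 - f 0"
proof -
  obtain K where K: "continuous_on {0..1} K"
    "\<And>x. x \<in> {0..1} \<Longrightarrow> to_complex (unit_tangent \<gamma> x) = to_complex (unit_tangent \<gamma> 0) * cis (K x)"
    "K 1 - K 0 = 2 * pi * rotation_number \<gamma>"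
    using rotation_number_total_angle[OF \<gamma>] by blast
  have "f 1 - f 0 = K 1 - K 0"
  proof (rule cis_lift_unique[OF f K(1)])
    show "cis (f x) = to_complex (unit_tangent \<gamma> 0) * cis (K x)" if "x \<in> {0..1}" for x
      using eq[OF that] K(2)[OF that] by metis
  qed simp
  then show ?thesis using K(3) by simp
qed

lemma symmetric_tangent:
  assumes \<gamma>: "W21_curve \<gamma>" and sym: "\<And>x. \<gamma> (x + d) = rot a *v \<gamma> x"
  shows "to_complex (dx \<gamma> (x + d)) = cis a * to_complex (dx \<gamma> x)"
proof -
  note d = bounded_linear.has_vector_derivative[OF bounded_linear_to_complex W21_curve_C1(1)[OF \<gamma>]]
  have "((\<lambda>x. to_complex (\<gamma> (x + d))) has_vector_derivative to_complex (dx \<gamma> (x + d))) (at x)"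
    using has_vector_derivative_shift[OF d[of "x + d"]] .
  moreover have "((\<lambda>x. to_complex (\<gamma> (x + d))) has_vector_derivative cis a * to_complex (dx \<gamma> x)) (at x)"
    unfolding sym to_complex_rot using d by (rule has_vector_derivative_mult_right)
  ultimately show ?thesis
    by (metis vector_derivative_at)
qed

text \<open>
  The symmetry rotates the tangent by \<open>2\<pi>i/m\<close>, so the tangent angle increases by the same amount
  \<open>D = 2\<pi>i/m + 2\<pi>j\<close> over each of the \<open>m\<close> periods. The total increase \<open>m D\<close> is \<open>2\<pi>n\<close>.
\<close>

lemma symmetry_index_cong:
  assumes \<gamma>: "W21_curve \<gamma>" "regular_curve \<gamma>" and N: "rotation_number \<gamma> = of_int n"
    and m: "m > (0::int)"
    and sym: "\<And>x. \<gamma> (x + 1 / of_int m) = rot (2 * pi * of_int i / of_int m) *v \<gamma> x"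
  shows "\<exists>j. n = i + m * j"
proof -
  define T where "T x = to_complex (unit_tangent \<gamma> x)" for x
  define w where "w = 1 / real_of_int m"
  have w: "0 < w" "w \<le> 1" "real_of_int m * w = 1"
    using m by (auto simp: w_def)
  define \<omega> where "\<omega> = cis (2 * pi * of_int i / of_int m)"
  have Tw: "T (x + w) = \<omega> * T x" for x
  proof -
    have e: "to_complex (dx \<gamma> (x + w)) = \<omega> * to_complex (dx \<gamma> x)"
      unfolding \<omega>_def w_def by (rule symmetric_tangent[OF \<gamma>(1) sym])
    then have "norm (dx \<gamma> (x + w)) = norm (dx \<gamma> x)"
      by (metis norm_to_complex norm_mult \<omega>_def norm_cis mult_1)
    then show ?thesis
      using e by (simp add: T_def unit_tangent_complex)
  qed
  obtain K where K: "continuous_on {0..1} K"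
    "\<And>x. x \<in> {0..1} \<Longrightarrow> T x = T 0 * cis (K x)"
    "K 1 - K 0 = 2 * pi * rotation_number \<gamma>"
    using rotation_number_total_angle[OF \<gamma>] unfolding T_def by blast
  have "norm (T 0) = 1"
    by (simp add: T_def unit_tangent_norm[OF \<gamma>(2)])
  then have T0: "T 0 \<noteq> 0"
    by auto
  have lift: "cis (K (x + w)) = \<omega> * cis (K x)" if "0 \<le> x" "x + w \<le> 1" for x
    using Tw[of x] K(2)[of x] K(2)[of "x + w"] that w T0 by simp
  define D where "D = K w - K 0"
  have step: "K (x + w) - K x = D" if x: "0 \<le> x" "x + w \<le> 1" for x
  proof -
    have "K (x + w) - K (0 + w) = K x - K 0"
    proof (rule cis_lift_unique[where f = "\<lambda>x. K (x + w)" and g = K])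
      show "continuous_on {0..x} (\<lambda>x. K (x + w))"
        by (rule continuous_on_compose2[OF K(1)]) (use x w in \<open>auto intro!: continuous_intros\<close>)
      show "continuous_on {0..x} K"
        by (rule continuous_on_subset[OF K(1)]) (use x w in auto)
      show "cis (K (y + w)) = \<omega> * cis (K y)" if "y \<in> {0..x}" for y
        using lift[of y] that x by auto
    qed (use x in auto)
    then show ?thesis by (simp add: D_def)
  qed
  have "K (of_nat j * w) - K 0 = of_nat j * D" if "int j \<le> m" for j
    using that
  proof (induction j)
    case (Suc j)
    have "of_nat j * w + w = of_int (int (Suc j)) * w"
      by (simp add: algebra_simps)
    also have "\<dots> \<le> of_int m * w"
      using Suc.prems w(1) by (intro mult_right_mono) auto
    finally have "K (of_nat j * w + w) - K (of_nat j * w) = D"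
      using w by (intro step) auto
    then show ?case
      using Suc by (simp add: algebra_simps)
  qed simp
  from this[of "nat m"] have K1: "K 1 - K 0 = of_int m * D"
    using m w by simp
  have "cis D = \<omega>"
    using lift[of 0] w by (simp add: D_def flip: cis_divide)
  then have "cis (D - 2 * pi * of_int i / of_int m) = 1"
    by (simp add: \<omega>_def flip: cis_divide)
  then obtain j :: int where j: "D - 2 * pi * of_int i / of_int m = 2 * pi * of_int j"
    using cis_eq_1D by blast
  have "2 * pi * of_int n = of_int m * D"
    using K1 K(3) N by simp
  also have "\<dots> = 2 * pi * (of_int i + of_int m * of_int j)"
    using j m by (simp add: field_simps)
  finally have "real_of_int n = of_int (i + m * j)"
    by simp
  then show ?thesis
    by (metis of_int_eq_iff)
qed

section \<open>A weighted Wirtinger inequality\<close>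

text \<open>
  Let \<open>\<tau> x\<close> lie half a period after \<open>x\<close>, measured by \<open>s\<close>. Then \<open>f (\<tau> x) - f x\<close> changes sign when \<open>x\<close>
  is replaced by \<open>\<tau> x\<close>, so it vanishes somewhere by the intermediate value theorem.
\<close>

lemma half_period_pair:
  fixes s f :: "real \<Rightarrow> real"
  assumes w_pos: "w > 0"
    and s_strict_mono: "\<And>x y. x < y \<Longrightarrow> s x < s y"
    and s_continuous: "\<And>A. continuous_on A s" and s_shift: "\<And>x. s (x + w) = s x + w"
    and f_continuous: "\<And>A. continuous_on A f" and f_shift: "\<And>x. f (x + w) = f x"
  obtains y1 y2 where "s y2 = s y1 + w / 2" "f y2 = f y1"
proof -
  have s_inj: "x = y" if "s x = s y" for x y
    using s_strict_mono[of x y] s_strict_mono[of y x] that by linarith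
  define g where "g = inv_into {0..2 * w} s"
  have s2w: "s (2 * w) = s 0 + 2 * w" "s w = s 0 + w"
    using s_shift[of 0] s_shift[of w] by simp_all
  have inj: "inj_on s {0..2 * w}"
    using s_inj by (auto simp: inj_on_def)
  have g: "continuous_on (s ` {0..2 * w}) g"
    using inj by (intro continuous_on_inv s_continuous) (auto simp: g_def)
  have sub: "{s 0..s 0 + 2 * w} \<subseteq> s ` {0..2 * w}"
  proof
    fix v assume v: "v \<in> {s 0..s 0 + 2 * w}"
    then have "\<exists>x\<ge>0. x \<le> 2 * w \<and> s x = v"
      using w_pos s_continuous[of "{0..2 * w}"] by (intro IVT') (auto simp: s2w)
    then show "v \<in> s ` {0..2 * w}" by auto
  qed
  define \<tau> where "\<tau> x = g (s x + w / 2)" for x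
  have s_le: "s x \<le> s y" if "x \<le> y" for x y
    using s_strict_mono[of x y] that by (cases "x = y") auto
  have rng: "s x + w / 2 \<in> {s 0..s 0 + 2 * w}" if "x \<in> {0..w}" for x
    using s_le[of 0 x] s_le[of x w] that s2w w_pos by auto
  have \<tau>: "s (\<tau> x) = s x + w / 2" if "x \<in> {0..w}" for x
    unfolding \<tau>_def g_def using rng[OF that] sub by (intro f_inv_into_f) blast
  define t where "t = \<tau> 0"
  have st: "s t = s 0 + w / 2"
    using \<tau>[of 0] w_pos by (simp add: t_def)
  have t: "0 < t" "t < w"
    using s_le[of t 0] s_le[of w t] s2w w_pos by (auto simp: st not_le[symmetric])
  have "s (\<tau> t) = s w"
    using \<tau>[of t] t st s2w by simp
  then have \<tau>t: "\<tau> t = w"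
    by (rule s_inj)
  have \<tau>c: "continuous_on {0..t} \<tau>"
    unfolding \<tau>_def
    by (rule continuous_on_compose2[OF g]) (use rng sub t in \<open>auto intro!: continuous_intros s_continuous\<close>)
  define D where "D x = f (\<tau> x) - f x" for x
  have Dc: "continuous_on {0..t} D"
    unfolding D_def by (intro continuous_intros continuous_on_compose2[OF f_continuous \<tau>c] f_continuous) auto
  have "D t = - D 0"
    using \<tau>t f_shift[of 0] by (simp add: D_def t_def)
  then have "\<exists>y\<in>{0..t}. D y = 0"
    using t(1) IVT'[OF _ _ _ Dc, of 0] IVT2'[OF _ _ _ Dc, of 0] by (cases "D 0 \<ge> 0") force+
  then obtain y where "y \<in> {0..t}" "D y = 0" by blast
  then show ?thesis
    using that[of "\<tau> y" y] \<tau>[of y] t by (auto simp: D_def)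
qed

text \<open>
  With \<open>c\<close> the common value at two points half a period apart, \<open>g = f - c\<close> vanishes wherever
  \<open>sin X\<close> does, for \<open>X = a (s - s y1)\<close> and \<open>a = 2\<pi>m\<close>. Therefore \<open>G = a g\<^sup>2 cot X\<close> is continuous, and
  away from the zeros \<open>f'\<^sup>2/\<sigma> - a\<^sup>2 \<sigma> g\<^sup>2 - G' = (f' - a \<sigma> g cot X)\<^sup>2/\<sigma>\<close>. The periodic function \<open>G\<close>
  contributes nothing to the integral. The weight \<open>\<sigma>\<close> makes a reparametrization by \<open>s\<close> superfluous.
\<close>

lemma weighted_wirtinger:
  fixes s \<sigma> f f' :: "real \<Rightarrow> real" and m :: nat
  assumes m: "m > 0" and w: "w = 1 / real m"
    and s_deriv: "\<And>x. (s has_real_derivative \<sigma> x) (at x)"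
    and \<sigma>_pos: "\<And>x. \<sigma> x > 0" and \<sigma>_cont: "continuous_on UNIV \<sigma>"
    and s_shift: "\<And>x. s (x + w) = s x + w"
    and f_deriv: "\<And>x. (f has_real_derivative f' x) (at x)"
    and f'_cont: "continuous_on UNIV f'"
    and f_shift: "\<And>x. f (x + w) = f x"
  obtains c where "(2 * pi * m)\<^sup>2 * integral {0..1} (\<lambda>x. \<sigma> x * (f x - c)\<^sup>2)
    \<le> integral {0..1} (\<lambda>x. (f' x)\<^sup>2 / \<sigma> x)"
proof -
  have s_strict_mono: "s x < s y" if "x < y" for x y
    using that by (rule DERIV_pos_imp_increasing) (use s_deriv \<sigma>_pos in blast)+
  have s_inj: "x = y" if "s x = s y" for x y
    using s_strict_mono[of x y] s_strict_mono[of y x] that by linarith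
  have f_continuous: "continuous_on A f" for A
    by (intro continuous_at_imp_continuous_on ballI DERIV_isCont[OF f_deriv])
  have s_continuous: "continuous_on A s" for A
    by (intro continuous_at_imp_continuous_on ballI DERIV_isCont[OF s_deriv])
  have w_pos: "w > 0"
    using m w by simp
  obtain y1 y2 where y: "s y2 = s y1 + w / 2" "f y2 = f y1"
    using half_period_pair[OF w_pos s_strict_mono s_continuous s_shift f_continuous f_shift] by blast
  define c where "c = f y1"
  define g where "g x = f x - c" for x
  define a where "a = 2 * pi * m"
  have a: "a > 0"
    using m by (simp add: a_def)
  define X where "X x = a * (s x - s y1)" for x
  have s_int: "s (x + of_int k * w) = s x + of_int k * w" for x k
    by (rule quasi_periodic_of_int[where g = s, OF s_shift])
  have f_int: "f (x + of_int k * w) = f x" for x k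
    using quasi_periodic_of_int[of f w 0 x k] f_shift by auto
  have zero: "g x = 0" if sin0: "sin (X x) = 0" for x
  proof -
    obtain j :: int where "X x = of_int j * pi"
      using iffD1[OF sin_zero_iff_int2 sin0] by blast
    then have "pi * (2 * m * (s x - s y1)) = pi * of_int j"
      by (simp add: X_def a_def mult_ac)
    then have "2 * m * (s x - s y1) = of_int j"
      by (simp only: mult_left_cancel[OF pi_neq_zero])
    then have sx: "s x = s y1 + of_int j * (w / 2)"
      using m by (simp add: w field_simps)
    show ?thesis
    proof (cases "even j")
      case True
      then obtain l where "j = 2 * l" by blast
      then have "s x = s (y1 + of_int l * w)"
        using sx by (simp add: s_int)
      then show ?thesis
        using s_inj[of x "y1 + of_int l * w"] f_int[of y1 l] by (simp add: g_def c_def)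
    next
      case False
      then obtain l where "j = 2 * l + 1" by (blast elim: oddE)
      then have "s x = s (y2 + of_int l * w)"
        using sx unfolding s_int y(1) by (simp add: algebra_simps)
      then show ?thesis
        using s_inj[of x "y2 + of_int l * w"] f_int[of y2 l] y(2) by (simp add: g_def c_def)
    qed
  qed
  have g_deriv: "(g has_real_derivative f' x) (at x)" for x
    unfolding g_def using f_deriv[of x] by (auto intro!: derivative_eq_intros)
  have X_deriv: "(X has_real_derivative a * \<sigma> x) (at x)" for x
    unfolding X_def using s_deriv[of x] by (auto intro!: derivative_eq_intros)
  define G where "G x = a * (g x)\<^sup>2 * cot (X x)" for x
  define G' where "G' x = a * (2 * g x * f' x * cot (X x) - (g x)\<^sup>2 * (a * \<sigma> x) * inverse ((sin (X x))\<^sup>2))" for x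
  have G_deriv: "(G has_real_derivative G' x) (at x)" if "sin (X x) \<noteq> 0" for x
  proof -
    have "((\<lambda>x. cot (X x)) has_real_derivative - inverse ((sin (X x))\<^sup>2) * (a * \<sigma> x)) (at x)"
      by (rule DERIV_chain2[OF DERIV_cot[OF that] X_deriv])
    then show ?thesis
      unfolding G_def G'_def using g_deriv[of x]
      by (auto intro!: derivative_eq_intros simp: algebra_simps)
  qed
  have G_cont: "isCont G x" for x
  proof (cases "sin (X x) = 0")
    case False
    then show ?thesis
      using G_deriv DERIV_isCont by blast
  next
    case True
    have "((\<lambda>y. sin (X y)) has_real_derivative cos (X x) * (a * \<sigma> x)) (at x)"
      by (rule DERIV_chain2[OF DERIV_sin X_deriv])
    then have 1: "((\<lambda>y. (sin (X y) - sin (X x)) / (y - x)) \<longlongrightarrow> cos (X x) * (a * \<sigma> x)) (at x)"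
      by (simp add: has_field_derivative_iff)
    have 2: "((\<lambda>y. (g y - g x) / (y - x)) \<longlongrightarrow> f' x) (at x)"
      using g_deriv[of x] by (simp add: has_field_derivative_iff)
    have "cos (X x) \<noteq> 0"
      using sin_cos_squared_add[of "X x"] True by auto
    then have "cos (X x) * (a * \<sigma> x) \<noteq> 0"
      using a \<sigma>_pos[of x] by simp
    \<comment> \<open>Both \<open>g\<close> and \<open>sin X\<close> have a zero at \<open>x\<close>, that of \<open>sin X\<close> being simple, so \<open>g / sin X\<close> has a
        finite limit; the other factor \<open>g\<close> of \<open>G\<close> tends to zero.\<close>
    from tendsto_divide[OF 2 1 this]
    have "((\<lambda>y. ((g y - g x) / (y - x)) / ((sin (X y) - sin (X x)) / (y - x)))
        \<longlongrightarrow> f' x / (cos (X x) * (a * \<sigma> x))) (at x)" .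
    moreover have "eventually (\<lambda>y. ((g y - g x) / (y - x)) / ((sin (X y) - sin (X x)) / (y - x))
        = g y / sin (X y)) (at x)"
      using zero[OF True] True by (auto simp: eventually_at_filter)
    ultimately have q: "((\<lambda>y. g y / sin (X y)) \<longlongrightarrow> f' x / (cos (X x) * (a * \<sigma> x))) (at x)"
      by (rule Lim_transform_eventually)
    have "isCont g x"
      by (rule DERIV_isCont[OF g_deriv])
    moreover have "isCont (\<lambda>y. cos (X y)) x"
      by (rule DERIV_isCont[OF DERIV_chain2[OF DERIV_cos X_deriv]])
    ultimately have "((\<lambda>y. a * cos (X y) * g y * (g y / sin (X y)))
        \<longlongrightarrow> a * cos (X x) * g x * (f' x / (cos (X x) * (a * \<sigma> x)))) (at x)"
      unfolding isCont_def by (intro tendsto_mult tendsto_const q)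
    moreover have "(\<lambda>y. a * cos (X y) * g y * (g y / sin (X y))) = G"
      by (simp add: fun_eq_iff G_def cot_def power2_eq_square)
    ultimately show ?thesis
      using zero[OF True] by (simp add: isCont_def G_def)
  qed
  \<comment> \<open>The exceptional points are finite in number, as \<open>X\<close> is injective with bounded image.\<close>
  define Z where "Z = {x \<in> {0..1}. sin (X x) = 0}"
  have X_mono: "X x \<le> X y" if "x \<le> y" for x y
    using s_strict_mono[of x y] that a by (cases "x = y") (auto simp: X_def)
  have X_inj: "inj_on X Z"
    using s_inj a by (auto simp: inj_on_def X_def)
  have "X ` Z \<subseteq> (\<lambda>j. of_int j * pi) ` {\<lceil>X 0 / pi\<rceil>..\<lfloor>X 1 / pi\<rfloor>}"
  proof
    fix v assume "v \<in> X ` Z"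
    then obtain x where x: "x \<in> {0..1}" "sin (X x) = 0" "v = X x"
      by (auto simp: Z_def)
    then obtain j :: int where j: "X x = of_int j * pi"
      using iffD1[OF sin_zero_iff_int2 x(2)] by blast
    have "X 0 / pi \<le> of_int j" "of_int j \<le> X 1 / pi"
      using X_mono[of 0 x] X_mono[of x 1] x(1) j by (auto simp: field_simps)
    then show "v \<in> (\<lambda>j. of_int j * pi) ` {\<lceil>X 0 / pi\<rceil>..\<lfloor>X 1 / pi\<rfloor>}"
      using x(3) j by (auto simp: ceiling_le_iff le_floor_iff)
  qed
  then have "finite (X ` Z)"
    by (rule finite_subset) simp
  then have "finite Z"
    using X_inj by (rule finite_imageD)
  then have "(G' has_integral (G 1 - G 0)) {0..1}"
    using G_deriv G_cont
    by (intro fundamental_theorem_of_calculus_interior_strong[of Z])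
      (auto simp: Z_def has_real_derivative_iff_has_vector_derivative[symmetric]
        intro: continuous_at_imp_continuous_on)
  moreover have "G 1 = G 0"
  proof -
    have "s 1 = s 0 + 1" "f 1 = f 0"
      using s_int[of 0 "int m"] f_int[of 0 "int m"] m by (simp_all add: w)
    then have "X 1 = X 0 + 2 * pi * of_int (int m)" "g 1 = g 0"
      by (simp_all add: X_def g_def a_def algebra_simps)
    then show ?thesis
      by (simp add: G_def cot_def sin_add cos_add sin_integer_2pi cos_integer_2pi)
  qed
  ultimately have G'_int: "(G' has_integral 0) {0..1}" by simp
  have cont: "continuous_on {0..1} \<sigma>" "continuous_on {0..1} f'" "continuous_on {0..1} g"
    using \<sigma>_cont f'_cont f_continuous[of "{0..1}"] unfolding g_def
    by (auto intro: continuous_on_subset intro!: continuous_intros)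
  have int1: "(\<lambda>x. (f' x)\<^sup>2 / \<sigma> x) integrable_on {0..1}"
    and int2: "(\<lambda>x. \<sigma> x * (g x)\<^sup>2) integrable_on {0..1}"
    using cont \<sigma>_pos by (auto intro!: integrable_continuous_real continuous_intros simp: less_imp_neq[symmetric])
  have "((\<lambda>x. (f' x)\<^sup>2 / \<sigma> x - a\<^sup>2 * (\<sigma> x * (g x)\<^sup>2)) has_integral
      (integral {0..1} (\<lambda>x. (f' x)\<^sup>2 / \<sigma> x) - a\<^sup>2 * integral {0..1} (\<lambda>x. \<sigma> x * (g x)\<^sup>2))) {0..1}"
    using int1 int2 by (intro has_integral_diff has_integral_mult_right integrable_integral)
  moreover have "G' x \<le> (f' x)\<^sup>2 / \<sigma> x - a\<^sup>2 * (\<sigma> x * (g x)\<^sup>2)" for x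
  proof (cases "sin (X x) = 0")
    case True
    then show ?thesis
      using zero[OF True] \<sigma>_pos[of x] by (simp add: G'_def)
  next
    case False
    have inv: "inverse ((sin (X x))\<^sup>2) = 1 + (cot (X x))\<^sup>2"
      using False sin_cos_squared_add[of "X x"] by (simp add: cot_def field_simps)
    have "(f' x)\<^sup>2 / \<sigma> x - a\<^sup>2 * (\<sigma> x * (g x)\<^sup>2) - G' x
        = (f' x - a * \<sigma> x * g x * cot (X x))\<^sup>2 / \<sigma> x"
      unfolding G'_def inv using \<sigma>_pos[of x]
      by (simp add: field_simps power2_eq_square)
    also have "\<dots> \<ge> 0"
      using \<sigma>_pos[of x] by simp
    finally show ?thesis by simp
  qed
  ultimately have "0 \<le> integral {0..1} (\<lambda>x. (f' x)\<^sup>2 / \<sigma> x) - a\<^sup>2 * integral {0..1} (\<lambda>x. \<sigma> x * (g x)\<^sup>2)"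
    using has_integral_le[OF G'_int] by blast
  then show ?thesis
    using that[of c] by (simp add: a_def g_def)
qed

section \<open>The isoperimetric inequality under rotational symmetry\<close>

lemma has_vector_derivative_cis:
  assumes "(g has_real_derivative g') (at x within S)"
  shows "((\<lambda>x. cis (g x)) has_vector_derivative (\<i> * of_real g' * cis (g x))) (at x within S)"
  unfolding has_vector_derivative_complex_iff
  using assms by (auto intro!: derivative_eq_intros)

lemma norm_add_rotated_square:
  "(norm (b + \<i> * of_real r * a))\<^sup>2 = (norm b)\<^sup>2 + 2 * r * Im (cnj a * b) + r\<^sup>2 * (norm a)\<^sup>2"
  unfolding cmod_power2 by (simp add: power2_eq_square algebra_simps)

text \<open>
  Here \<open>e a\<close> and \<open>e (b + \<i>\<kappa>\<sigma>a)\<close> stand for the curve and its derivative, and \<open>a\<close>, \<open>b\<close> for the curve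
  and its derivative in the frame rotating with angular velocity \<open>\<kappa>\<sigma>\<close>.
\<close>

lemma rotating_frame_identity:
  assumes e: "norm e = 1" and \<sigma>: "\<sigma> > (0::real)"
  shows "(norm (e * (b + \<i> * of_real (\<kappa> * \<sigma>) * a)))\<^sup>2 / \<sigma>
      - \<kappa> * Im (cnj (e * a) * (e * (b + \<i> * of_real (\<kappa> * \<sigma>) * a)))
    = (norm b)\<^sup>2 / \<sigma> + \<kappa> * Im (cnj a * b)"
proof -
  have "cnj e * e = 1"
    using e complex_norm_square[of e] by (simp add: mult.commute)
  moreover have "cnj (e * a) * (e * c) = cnj e * e * (cnj a * c)" for c
    by (simp add: mult_ac)
  ultimately have cancel: "cnj (e * a) * (e * c) = cnj a * c" for c
    by (simp only: mult_1)
  have "norm (e * c) = norm c" for c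
    using e by (simp add: norm_mult)
  moreover have "Im (cnj a * (b + \<i> * of_real (\<kappa> * \<sigma>) * a)) = Im (cnj a * b) + \<kappa> * \<sigma> * (norm a)\<^sup>2"
    unfolding cmod_power2 by (simp add: power2_eq_square algebra_simps)
  ultimately show ?thesis
    unfolding cancel using \<sigma> by (simp only: norm_add_rotated_square) (simp add: field_simps power2_eq_square)
qed

text \<open>
  Both sides are affine in \<open>t\<close> and agree for \<open>t = 0\<close>. For \<open>t = 1\<close> this is completion of the square,
  with half of \<open>|b|\<^sup>2/\<sigma>\<close> set aside to be compared with \<open>|a|\<^sup>2\<close> by Wirtinger's inequality.
\<close>

lemma square_completion_identity:
  assumes \<sigma>: "\<sigma> > (0::real)"
  shows "(norm b)\<^sup>2 / \<sigma> + t * \<alpha> * Im (cnj a * b)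
    = (1 - t) * ((norm b)\<^sup>2 / \<sigma>) + t / 2 * ((norm b)\<^sup>2 / \<sigma> - \<alpha>\<^sup>2 * (\<sigma> * (norm a)\<^sup>2))
      + t / 2 * ((norm (b + \<i> * of_real (\<alpha> * \<sigma>) * a))\<^sup>2 / \<sigma>)"
  unfolding norm_add_rotated_square using \<sigma> by (simp add: field_simps power2_eq_square)

lemma weighted_wirtinger_complex:
  fixes w w' :: "real \<Rightarrow> complex" and s \<sigma> :: "real \<Rightarrow> real" and m :: nat
  assumes m: "m > 0"
    and s_deriv: "\<And>x. (s has_real_derivative \<sigma> x) (at x)"
    and \<sigma>_pos: "\<And>x. \<sigma> x > 0" and \<sigma>_cont: "continuous_on UNIV \<sigma>"
    and s_shift: "\<And>x. s (x + 1 / m) = s x + 1 / m"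
    and w_deriv: "\<And>x. (w has_vector_derivative w' x) (at x)"
    and w'_cont: "continuous_on UNIV w'"
    and w_shift: "\<And>x. w (x + 1 / m) = w x"
  obtains c where "(2 * pi * m)\<^sup>2 * integral {0..1} (\<lambda>x. \<sigma> x * (norm (w x - c))\<^sup>2)
    \<le> integral {0..1} (\<lambda>x. (norm (w' x))\<^sup>2 / \<sigma> x)"
proof -
  have Re_deriv: "((\<lambda>x. Re (w x)) has_real_derivative Re (w' x)) (at x)"
    and Im_deriv: "((\<lambda>x. Im (w x)) has_real_derivative Im (w' x)) (at x)" for x
    using w_deriv[of x] by (auto simp: has_vector_derivative_complex_iff)
  obtain c1 where c1: "(2 * pi * m)\<^sup>2 * integral {0..1} (\<lambda>x. \<sigma> x * (Re (w x) - c1)\<^sup>2)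
      \<le> integral {0..1} (\<lambda>x. (Re (w' x))\<^sup>2 / \<sigma> x)"
    using weighted_wirtinger[OF m refl s_deriv \<sigma>_pos \<sigma>_cont s_shift Re_deriv
        continuous_on_Re[OF w'_cont]] w_shift by auto
  obtain c2 where c2: "(2 * pi * m)\<^sup>2 * integral {0..1} (\<lambda>x. \<sigma> x * (Im (w x) - c2)\<^sup>2)
      \<le> integral {0..1} (\<lambda>x. (Im (w' x))\<^sup>2 / \<sigma> x)"
    using weighted_wirtinger[OF m refl s_deriv \<sigma>_pos \<sigma>_cont s_shift Im_deriv
        continuous_on_Im[OF w'_cont]] w_shift by auto
  have "continuous_on UNIV w"
    using w_deriv by (auto intro!: continuous_at_imp_continuous_on has_vector_derivative_continuous)
  then have cont: "continuous_on {0..1} w" "continuous_on {0..1} w'" "continuous_on {0..1} \<sigma>"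
    using w'_cont \<sigma>_cont by (auto elim: continuous_on_subset)
  have \<sigma>_nz: "\<sigma> x \<noteq> 0" for x
    using \<sigma>_pos[of x] by simp
  have int: "(\<lambda>x. \<sigma> x * (Re (w x) - c1)\<^sup>2) integrable_on {0..1}"
    "(\<lambda>x. \<sigma> x * (Im (w x) - c2)\<^sup>2) integrable_on {0..1}"
    "(\<lambda>x. (Re (w' x))\<^sup>2 / \<sigma> x) integrable_on {0..1}"
    "(\<lambda>x. (Im (w' x))\<^sup>2 / \<sigma> x) integrable_on {0..1}"
    using cont \<sigma>_nz by (auto intro!: integrable_continuous_real continuous_intros)
  have "integral {0..1} (\<lambda>x. \<sigma> x * (norm (w x - Complex c1 c2))\<^sup>2)
      = integral {0..1} (\<lambda>x. \<sigma> x * (Re (w x) - c1)\<^sup>2) + integral {0..1} (\<lambda>x. \<sigma> x * (Im (w x) - c2)\<^sup>2)"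
    using integral_add[OF int(1,2)] by (simp add: cmod_power2 distrib_left)
  moreover have "integral {0..1} (\<lambda>x. (norm (w' x))\<^sup>2 / \<sigma> x)
      = integral {0..1} (\<lambda>x. (Re (w' x))\<^sup>2 / \<sigma> x) + integral {0..1} (\<lambda>x. (Im (w' x))\<^sup>2 / \<sigma> x)"
    using integral_add[OF int(3,4)] by (simp add: cmod_power2 add_divide_distrib)
  ultimately show ?thesis
    using that[of "Complex c1 c2"] c1 c2 by (simp add: distrib_left)
qed

lemma continuous_integral_square_eq_0:
  fixes f :: "real \<Rightarrow> 'a::real_normed_vector"
  assumes "continuous_on {0..1} f" "continuous_on {0..1} \<sigma>" "\<And>x. \<sigma> x > (0::real)"
    and "integral {0..1} (\<lambda>x. (norm (f x))\<^sup>2 / \<sigma> x) = 0" and "x \<in> {0..1}"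
  shows "f x = 0"
proof -
  have nz: "\<sigma> x \<noteq> 0" for x
    using assms(3)[of x] by simp
  have c: "continuous_on {0..1} (\<lambda>x. (norm (f x))\<^sup>2 / \<sigma> x)"
    using assms(1,2) nz by (intro continuous_intros) auto
  then have "((\<lambda>x. (norm (f x))\<^sup>2 / \<sigma> x) has_integral 0) (cbox 0 1)"
    using assms(4) integrable_continuous_real by (auto simp: has_integral_iff)
  then have "(norm (f x))\<^sup>2 / \<sigma> x = 0"
    using c assms(3,5) by (intro has_integral_0_cbox_imp_0[of 0 1 "\<lambda>x. (norm (f x))\<^sup>2 / \<sigma> x"])
      (auto simp: less_imp_le)
  then show ?thesis
    using nz[of x] by simp
qed

text \<open>
  The increment of \<open>s\<close> over \<open>1/m\<close> is constant because the speed is \<open>1/m\<close>-periodic, and \<open>m\<close> of these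
  increments add up to one.
\<close>

lemma normalized_arclength:
  fixes z' :: "real \<Rightarrow> complex" and m :: nat
  assumes m: "m > 0" and cont: "continuous_on UNIV z'" and nz: "\<And>x. z' x \<noteq> 0"
    and shift: "\<And>x. norm (z' (x + 1 / m)) = norm (z' x)"
  defines "L \<equiv> integral {0..1} (\<lambda>x. norm (z' x))"
  obtains s where "L > 0" "\<And>x. (s has_real_derivative norm (z' x) / L) (at x)"
    "\<And>x. s (x + 1 / m) = s x + 1 / m" "\<And>x. s (x + 1) = s x + 1"
proof -
  have c: "continuous_on S (\<lambda>x. norm (z' x))" for S
    using cont by (intro continuous_intros) (auto elim: continuous_on_subset)
  have "L \<noteq> 0"
  proof
    assume "L = 0"
    then have "((\<lambda>x. norm (z' x)) has_integral 0) (cbox 0 1)"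
      using integrable_continuous_real[OF c] by (auto simp: L_def has_integral_iff)
    then have "norm (z' 0) = 0"
      using c by (intro has_integral_0_cbox_imp_0[of 0 1 "\<lambda>x. norm (z' x)"]) auto
    then show False
      using nz[of 0] by simp
  qed
  moreover have "L \<ge> 0"
    unfolding L_def by (intro integral_nonneg integrable_continuous_real c) auto
  ultimately have L: "L > 0" by simp
  obtain s where "\<And>x. (s has_vector_derivative norm (z' x) / L) (at x)"
    using einterval_antiderivative[of "-\<infinity>" "\<infinity>" "\<lambda>x. norm (z' x) / L"] c[of UNIV] L
    by (auto simp: continuous_on_eq_continuous_at)
  then have s: "(s has_real_derivative norm (z' x) / L) (at x)" for x
    by (simp add: has_real_derivative_iff_has_vector_derivative)
  define d where "d = s (1 / m) - s 0"
  have sd: "s (x + 1 / m) = s x + d" for x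
  proof -
    have "((\<lambda>x. s (x + 1 / m) - s x) has_real_derivative 0) (at x)" for x
      using s[of "x + 1 / m"] s[of x] shift[of x]
      by (auto intro!: derivative_eq_intros simp: DERIV_shift)
    then have "s (x + 1 / m) - s x = s (0 + 1 / m) - s 0"
      by (intro DERIV_isconst_all) blast
    then show ?thesis by (simp add: d_def)
  qed
  have s1: "s (x + 1) = s x + of_int (int m) * d" for x
    using quasi_periodic_of_int[where g = s, OF sd, of x "int m"] m by simp
  have "((\<lambda>x. norm (z' x) / L) has_integral (s 1 - s 0)) {0..1}"
    using s by (intro fundamental_theorem_of_calculus)
      (auto simp: has_real_derivative_iff_has_vector_derivative[symmetric] intro: has_field_derivative_at_within)
  then have "s 1 - s 0 = integral {0..1} (\<lambda>x. norm (z' x) / L)"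
    by (rule integral_unique[symmetric])
  also have "\<dots> = 1"
    using L by (simp add: L_def)
  finally have "of_int (int m) * d = 1"
    using s1[of 0] by simp
  then have "d = 1 / m"
    using m by (simp add: field_simps)
  then show ?thesis
    using that[of s] L s sd s1 m by simp
qed

text \<open>
  In the rotating frame the symmetric curve becomes \<open>1/m\<close>-periodic, so Wirtinger's inequality is
  available with the large constant \<open>2\<pi>m\<close>. That \<open>k \<le> m\<close> is what makes the remaining quadratic form
  nonnegative.
\<close>

lemma symmetric_isoperimetric:
  fixes z z' :: "real \<Rightarrow> complex" and m k :: nat
  assumes k: "1 \<le> k" "k \<le> m"
    and z_deriv: "\<And>x. (z has_vector_derivative z' x) (at x)"
    and z'_cont: "continuous_on UNIV z'" and nz: "\<And>x. z' x \<noteq> 0"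
    and sym: "\<And>x. z (x + 1 / m) = cis (2 * pi * k / m) * z x"
    and sym': "\<And>x. z' (x + 1 / m) = cis (2 * pi * k / m) * z' x"
  defines "L \<equiv> integral {0..1} (\<lambda>x. norm (z' x))"
    and "A \<equiv> integral {0..1} (\<lambda>x. Im (cnj (z x) * z' x)) / 2"
  shows "4 * pi * k * A \<le> L\<^sup>2"
    and "4 * pi * k * A = L\<^sup>2 \<Longrightarrow> \<exists>d c s \<sigma>. c \<noteq> 0 \<and> (\<forall>x. (s has_real_derivative \<sigma> x) (at x) \<and> \<sigma> x > 0) \<and>
      (\<forall>x. s (x + 1) = s x + 1) \<and> (\<forall>x. z x = d + c * cis (2 * pi * k * s x))"
proof -
  have m: "m > 0"
    using k by simp
  have nshift: "norm (z' (x + 1 / m)) = norm (z' x)" for x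
    by (simp add: sym' norm_mult)
  obtain s where L: "L > 0" and s: "\<And>x. (s has_real_derivative norm (z' x) / L) (at x)"
    and s_shift: "\<And>x. s (x + 1 / m) = s x + 1 / m" and s1: "\<And>x. s (x + 1) = s x + 1"
    using normalized_arclength[OF m z'_cont nz nshift] unfolding L_def by blast
  define \<sigma> where "\<sigma> x = norm (z' x) / L" for x
  have s\<sigma>: "(s has_real_derivative \<sigma> x) (at x)" for x
    using s by (simp add: \<sigma>_def)
  have \<sigma>_pos: "\<sigma> x > 0" for x
    using nz L by (simp add: \<sigma>_def)
  have \<sigma>_cont: "continuous_on UNIV \<sigma>"
    unfolding \<sigma>_def using z'_cont L by (intro continuous_intros) auto
  define \<kappa> where "\<kappa> = 2 * pi * k"
  define \<alpha> where "\<alpha> = 2 * pi * m"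
  define t where "t = real k / real m"
  have t: "0 < t" "t \<le> 1" "\<kappa> = t * \<alpha>"
    using k m by (auto simp: t_def \<kappa>_def \<alpha>_def)
  define e where "e x = cis (\<kappa> * s x)" for x
  define w where "w x = cnj (e x) * z x" for x
  define w' where "w' x = cnj (e x) * (z' x - \<i> * of_real (\<kappa> * \<sigma> x) * z x)" for x
  have ne: "norm (e x) = 1" for x
    by (simp add: e_def)
  have ee: "e x * cnj (e x) = 1" for x
    using ne complex_norm_square[of "e x"] by simp
  have zw: "z x = e x * w x" for x
    unfolding w_def mult.assoc[symmetric] ee by simp
  have zw': "z' x = e x * (w' x + \<i> * of_real (\<kappa> * \<sigma> x) * w x)" for x
  proof -
    have "e x * (w' x + \<i> * of_real (\<kappa> * \<sigma> x) * w x) = (e x * cnj (e x)) * z' x"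
      by (simp add: w'_def w_def algebra_simps)
    then show ?thesis by (simp add: ee)
  qed
  have e_shift: "e (x + 1 / m) = cis (2 * pi * k / m) * e x" for x
    unfolding e_def s_shift by (simp add: cis_mult \<kappa>_def algebra_simps)
  have w_shift: "w (x + 1 / m) = w x" for x
  proof -
    have "cnj (cis (2 * pi * k / m)) * cis (2 * pi * k / m) = 1"
      by (simp add: cis_cnj cis_mult)
    then show ?thesis
      unfolding w_def e_shift sym by (simp add: mult_ac)
  qed
  have e_eq: "cnj (e x) = cis (- \<kappa> * s x)" for x
    by (simp add: e_def cis_cnj)
  have e_deriv: "((\<lambda>x. cnj (e x)) has_vector_derivative \<i> * of_real (- \<kappa> * \<sigma> x) * cnj (e x)) (at x)" for x
    unfolding e_eq by (intro has_vector_derivative_cis DERIV_cmult s\<sigma>)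
  have w_deriv: "(w has_vector_derivative w' x) (at x)" for x
    using has_vector_derivative_mult[OF e_deriv z_deriv, of x]
    by (simp add: w_def[abs_def] w'_def algebra_simps)
  have z_cont: "continuous_on UNIV z"
    using z_deriv by (auto intro!: continuous_at_imp_continuous_on has_vector_derivative_continuous)
  have s_cont: "continuous_on UNIV s"
    using s\<sigma> by (auto intro!: continuous_at_imp_continuous_on DERIV_isCont)
  have e_cont: "continuous_on UNIV (\<lambda>x. cnj (e x))"
    unfolding e_eq using s_cont by (intro continuous_intros)
  have w'_cont: "continuous_on UNIV w'"
    unfolding w'_def by (intro continuous_intros e_cont z'_cont z_cont \<sigma>_cont)
  have w_cont: "continuous_on UNIV w"
    unfolding w_def by (intro continuous_intros e_cont z_cont)
  obtain c where c: "\<alpha>\<^sup>2 * integral {0..1} (\<lambda>x. \<sigma> x * (norm (w x - c))\<^sup>2)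
      \<le> integral {0..1} (\<lambda>x. (norm (w' x))\<^sup>2 / \<sigma> x)"
    using weighted_wirtinger_complex[OF m s\<sigma> \<sigma>_pos \<sigma>_cont s_shift w_deriv w'_cont w_shift]
    unfolding \<alpha>_def by blast
  define u where "u x = w x - c" for x
  define q where "q x = w' x + \<i> * of_real (\<alpha> * \<sigma> x) * u x" for x
  define J1 where "J1 = integral {0..1} (\<lambda>x. (norm (w' x))\<^sup>2 / \<sigma> x)"
  define J2 where "J2 = integral {0..1} (\<lambda>x. \<sigma> x * (norm (u x))\<^sup>2)"
  define J3 where "J3 = integral {0..1} (\<lambda>x. (norm (q x))\<^sup>2 / \<sigma> x)"
  have u_cont: "continuous_on UNIV u"
    unfolding u_def by (intro continuous_intros w_cont)
  have q_cont: "continuous_on UNIV q"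
    unfolding q_def by (intro continuous_intros u_cont w'_cont \<sigma>_cont)
  note cont = z_cont z'_cont w_cont w'_cont u_cont q_cont \<sigma>_cont
  note cont01 = cont[THEN continuous_on_subset[OF _ subset_UNIV], of "{0..1}"]
  have \<sigma>_nz: "\<sigma> x \<noteq> 0" for x
    using \<sigma>_pos[of x] by simp
  have I1: "((\<lambda>x. (norm (w' x))\<^sup>2 / \<sigma> x) has_integral J1) {0..1}"
    unfolding J1_def using cont01 \<sigma>_nz
    by (intro integrable_integral integrable_continuous_real continuous_intros) auto
  have I2: "((\<lambda>x. \<sigma> x * (norm (u x))\<^sup>2) has_integral J2) {0..1}"
    unfolding J2_def using cont01
    by (intro integrable_integral integrable_continuous_real continuous_intros) auto
  have I3: "((\<lambda>x. (norm (q x))\<^sup>2 / \<sigma> x) has_integral J3) {0..1}"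
    unfolding J3_def using cont01 \<sigma>_nz
    by (intro integrable_integral integrable_continuous_real continuous_intros) auto
  have J: "0 \<le> J1" "\<alpha>\<^sup>2 * J2 \<le> J1" "0 \<le> J3"
    using c \<sigma>_pos has_integral_nonneg[OF I1] has_integral_nonneg[OF I3]
    by (auto simp: J1_def J2_def u_def less_imp_le)
  \<comment> \<open>Replacing \<open>w\<close> by \<open>u = w - c\<close> in the area term costs nothing, because \<open>w\<close> is closed.\<close>
  have "((\<lambda>x. Im (cnj c * w' x)) has_integral 0) {0..1}"
  proof -
    have "(w' has_integral (w 1 - w 0)) {0..1}"
      using w_deriv by (intro fundamental_theorem_of_calculus) (auto intro: has_vector_derivative_at_within)
    moreover have "w 1 = w 0"
      using quasi_periodic_of_int[of w "1 / m" 0 0 "int m"] w_shift m by simp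
    ultimately have "((\<lambda>x. cnj c * w' x) has_integral cnj c * 0) {0..1}"
      using has_integral_mult_right[of w' "w 1 - w 0" "{0..1}" "cnj c"] by simp
    from has_integral_linear[OF this bounded_linear_Im] show ?thesis
      by (simp add: o_def)
  qed
  note Ic = has_integral_mult_right[OF this, of \<kappa>]
  have IL: "((\<lambda>x. norm (z' x)) has_integral L) {0..1}"
    unfolding L_def using cont01
    by (intro integrable_integral integrable_continuous_real continuous_intros)
  have "((\<lambda>x. Im (cnj (z x) * z' x)) has_integral integral {0..1} (\<lambda>x. Im (cnj (z x) * z' x))) {0..1}"
    using cont01 by (intro integrable_integral integrable_continuous_real continuous_intros)
  then have IA: "((\<lambda>x. Im (cnj (z x) * z' x)) has_integral 2 * A) {0..1}"
    by (simp add: A_def)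
  have "L\<^sup>2 - \<kappa> * (2 * A) = (1 - t) * J1 + t / 2 * (J1 - \<alpha>\<^sup>2 * J2) + t / 2 * J3"
  proof (rule has_integral_unique)
    have "((\<lambda>x. L * norm (z' x) - \<kappa> * Im (cnj (z x) * z' x)) has_integral (L * L - \<kappa> * (2 * A))) {0..1}"
      using has_integral_diff[OF has_integral_mult_right[OF IL, of L] has_integral_mult_right[OF IA, of \<kappa>]] .
    moreover have "L * norm (z' x) - \<kappa> * Im (cnj (z x) * z' x)
        = (norm (w' x))\<^sup>2 / \<sigma> x + \<kappa> * Im (cnj (w x) * w' x)" for x
    proof -
      have "L * norm (z' x) = (norm (z' x))\<^sup>2 / \<sigma> x"
        using nz[of x] L by (simp add: \<sigma>_def power2_eq_square)
      moreover have "(norm (z' x))\<^sup>2 / \<sigma> x - \<kappa> * Im (cnj (z x) * z' x)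
          = (norm (w' x))\<^sup>2 / \<sigma> x + \<kappa> * Im (cnj (w x) * w' x)"
        using rotating_frame_identity[of "e x" "\<sigma> x" "w' x" \<kappa> "w x", OF ne \<sigma>_pos]
        unfolding zw[of x, symmetric] zw'[of x, symmetric] .
      ultimately show ?thesis by (simp only:)
    qed
    moreover have "\<kappa> * Im (cnj (w x) * w' x) = t * \<alpha> * Im (cnj (u x) * w' x) + \<kappa> * Im (cnj c * w' x)" for x
      by (simp add: u_def t(3) algebra_simps)
    ultimately have "((\<lambda>x. ((norm (w' x))\<^sup>2 / \<sigma> x + t * \<alpha> * Im (cnj (u x) * w' x)) + \<kappa> * Im (cnj c * w' x))
        has_integral (L * L - \<kappa> * (2 * A))) {0..1}"
      by (simp add: add.assoc)
    from has_integral_diff[OF this Ic]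
    show "((\<lambda>x. (norm (w' x))\<^sup>2 / \<sigma> x + t * \<alpha> * Im (cnj (u x) * w' x)) has_integral (L\<^sup>2 - \<kappa> * (2 * A))) {0..1}"
      by (simp add: power2_eq_square)
    show "((\<lambda>x. (norm (w' x))\<^sup>2 / \<sigma> x + t * \<alpha> * Im (cnj (u x) * w' x)) has_integral
        ((1 - t) * J1 + t / 2 * (J1 - \<alpha>\<^sup>2 * J2) + t / 2 * J3)) {0..1}"
      unfolding square_completion_identity[OF \<sigma>_pos] q_def[symmetric]
      by (intro has_integral_add has_integral_diff has_integral_mult_right I1 I2 I3)
  qed
  then have main: "L\<^sup>2 - 4 * pi * k * A = (1 - t) * J1 + t / 2 * (J1 - \<alpha>\<^sup>2 * J2) + t / 2 * J3"
    by (simp add: \<kappa>_def)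
  have nn: "0 \<le> (1 - t) * J1" "0 \<le> t / 2 * (J1 - \<alpha>\<^sup>2 * J2)" "0 \<le> t / 2 * J3"
    using t J by auto
  show "4 * pi * k * A \<le> L\<^sup>2"
    using main nn by linarith
  show "\<exists>d c s \<sigma>. c \<noteq> 0 \<and> (\<forall>x. (s has_real_derivative \<sigma> x) (at x) \<and> \<sigma> x > 0) \<and>
      (\<forall>x. s (x + 1) = s x + 1) \<and> (\<forall>x. z x = d + c * cis (2 * pi * k * s x))"
    if eq: "4 * pi * k * A = L\<^sup>2"
  proof -
    have "(1 - t) * J1 = 0" "t / 2 * J3 = 0"
      using main nn eq by linarith+
    then have J3: "J3 = 0" and J1: "t < 1 \<Longrightarrow> J1 = 0"
      using t by auto
    have w1: "w (x + 1) = w x" for x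
      using quasi_periodic_of_int[of w "1 / m" 0 x "int m"] w_shift m by simp
    have w'1: "w' (x + 1) = w' x" for x
      using has_vector_derivative_shift[OF w_deriv[of "x + 1"]] w_deriv[of x]
      unfolding w1 by (rule vector_derivative_unique_at)
    have \<sigma>1: "\<sigma> (x + 1) = \<sigma> x" for x
    proof -
      have "((\<lambda>x. s x + 1) has_real_derivative \<sigma> (x + 1)) (at x)"
        using s\<sigma>[of "x + 1"] unfolding DERIV_shift s1 .
      moreover have "((\<lambda>x. s x + 1) has_real_derivative \<sigma> x) (at x)"
        using s\<sigma>[of x] by (auto intro!: derivative_eq_intros)
      ultimately show ?thesis
        by (rule DERIV_unique)
    qed
    have q0: "q x = 0" if "x \<in> {0..1}" for x
      using continuous_integral_square_eq_0[OF _ _ \<sigma>_pos J3[unfolded J3_def] that] cont01 by blast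
    have q: "q x = 0" for x
    proof -
      have "q (x + 1) = q x" for x
        by (simp add: q_def u_def w1 w'1 \<sigma>1)
      then have "q (frac x + of_int \<lfloor>x\<rfloor> * 1) = q (frac x) + of_int \<lfloor>x\<rfloor> * 0"
        by (intro quasi_periodic_of_int) simp
      then show ?thesis
        using q0[of "frac x"] frac_lt_1[of x] by (simp add: frac_def)
    qed
    \<comment> \<open>\<open>q = 0\<close> is a linear differential equation for \<open>u\<close> with the integrating factor \<open>cis (\<alpha> s)\<close>.\<close>
    have "u x * cis (\<alpha> * s x) = u 0 * cis (\<alpha> * s 0)" for x
    proof -
      have "((\<lambda>x. u x * cis (\<alpha> * s x)) has_vector_derivative 0) (at x)" for x
      proof -
        have "(u has_vector_derivative w' x) (at x)"
          unfolding u_def[abs_def] using w_deriv[of x] by (auto intro!: derivative_eq_intros)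
        from has_vector_derivative_mult[OF this has_vector_derivative_cis[OF DERIV_cmult[OF s\<sigma>]], of \<alpha>]
        have "((\<lambda>x. u x * cis (\<alpha> * s x)) has_vector_derivative q x * cis (\<alpha> * s x)) (at x)"
          by (simp add: q_def algebra_simps)
        then show ?thesis by (simp add: q)
      qed
      from equal_derivatives_imp_equal_differences[OF this, of "\<lambda>x. 0" x 0] show ?thesis by simp
    qed
    note u_const = this
    have u: "u x = u 0 * cis (\<alpha> * s 0) * cis (- (\<alpha> * s x))" for x
    proof -
      have "u x = u x * cis (\<alpha> * s x) * cis (- (\<alpha> * s x))"
        by (simp add: mult.assoc cis_mult)
      then show ?thesis
        unfolding u_const[of x] .
    qed
    define u0 where "u0 = u 0 * cis (\<alpha> * s 0)"
    have z: "z x = u0 * cis ((\<kappa> - \<alpha>) * s x) + c * cis (\<kappa> * s x)" for x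
    proof -
      have "z x = e x * (u x + c)"
        by (simp add: zw u_def)
      also have "\<dots> = u0 * (e x * cis (- (\<alpha> * s x))) + c * e x"
        unfolding u[of x] u0_def[symmetric] by (simp add: algebra_simps)
      finally show ?thesis
        by (simp add: e_def cis_mult algebra_simps)
    qed
    obtain d where zd: "\<And>x. z x = d + c * cis (\<kappa> * s x)"
    proof (cases "t < 1")
      case True
      have "w' 0 = 0"
        using continuous_integral_square_eq_0[OF cont01(4,7) \<sigma>_pos J1[OF True, unfolded J1_def], of 0] by simp
      then have "u 0 = 0"
        using q[of 0] \<sigma>_nz[of 0] m by (simp add: q_def \<alpha>_def)
      then show ?thesis
        using that[of 0] z by (simp add: u0_def)
    next
      case False
      then have "\<kappa> = \<alpha>"
        using t by simp
      then show ?thesis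
        using that[of u0] z by simp
    qed
    have "c \<noteq> 0"
    proof
      assume "c = 0"
      then have "z = (\<lambda>x. d)"
        using zd by (simp add: fun_eq_iff)
      then have "((\<lambda>x. d) has_vector_derivative z' 0) (at 0)"
        using z_deriv[of 0] by simp
      then show False
        using nz[of 0] vector_derivative_unique_at[OF _ has_vector_derivative_const] by blast
    qed
    then show ?thesis
      using s\<sigma> \<sigma>_pos s1 zd unfolding \<kappa>_def by blast
  qed
qed

section \<open>The symmetry index and the equality case\<close>

lemma idx_range:
  assumes "m > 0" shows "1 \<le> idx n m" "idx n m \<le> m"
proof -
  define c where "c = \<lceil>real_of_int n / real_of_int m\<rceil>"
  have "real_of_int n / real_of_int m \<le> of_int c" "of_int c < real_of_int n / real_of_int m + 1"
    unfolding c_def by linarith+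
  then have "real_of_int n \<le> of_int c * real_of_int m" "of_int c * real_of_int m < real_of_int n + real_of_int m"
    using assms by (simp_all add: field_simps)
  then have "n \<le> c * m" "c * m < n + m"
    by (simp_all flip: of_int_mult of_int_add)
  then show "1 \<le> idx n m" "idx n m \<le> m"
    by (simp_all add: idx_def c_def[symmetric] mult.commute)
qed

lemma idx_cong: "idx n m = n + m * (1 - \<lceil>real_of_int n / real_of_int m\<rceil>)"
  by (simp add: idx_def algebra_simps)

text \<open>
  Two elements of \<open>n + m\<int>\<close> in \<open>{1..m}\<close> differ by a multiple of \<open>m\<close> of absolute value below \<open>m\<close>.
\<close>

lemma idx_unique:
  assumes "m > 0" "i \<in> {1..m}" "i = n + m * j"
  shows "i = idx n m"
proof -
  define l where "l = j - (1 - \<lceil>real_of_int n / real_of_int m\<rceil>)"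
  have i: "i - idx n m = m * l"
    unfolding assms(3) idx_cong l_def by (simp add: algebra_simps)
  moreover have "\<bar>i - idx n m\<bar> < m"
    using assms(2) idx_range[OF assms(1), of n] by auto
  ultimately have "\<bar>m * l\<bar> < m * 1"
    by simp
  then have "l = 0"
    using assms(1) by (simp add: abs_mult)
  then show ?thesis using i by simp
qed

lemma curve_complex:
  assumes "W21_curve \<gamma>"
  shows "((\<lambda>x. to_complex (\<gamma> x)) has_vector_derivative to_complex (dx \<gamma> x)) (at x)"
    and "continuous_on UNIV (\<lambda>x. to_complex (dx \<gamma> x))"
    and "continuous_on UNIV (\<lambda>x. to_complex (\<gamma> x))"
proof -
  show d: "((\<lambda>x. to_complex (\<gamma> x)) has_vector_derivative to_complex (dx \<gamma> x)) (at x)" for x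
    by (rule bounded_linear.has_vector_derivative[OF bounded_linear_to_complex W21_curve_C1(1)[OF assms]])
  show "continuous_on UNIV (\<lambda>x. to_complex (dx \<gamma> x))"
    by (rule bounded_linear.continuous_on[OF bounded_linear_to_complex W21_curve_C1(2)[OF assms]])
  show "continuous_on UNIV (\<lambda>x. to_complex (\<gamma> x))"
    using d by (auto intro!: continuous_at_imp_continuous_on has_vector_derivative_continuous)
qed

lemma curve_length_complex: "curve_length \<gamma> = integral {0..1} (\<lambda>x. norm (to_complex (dx \<gamma> x)))"
  by (simp add: curve_length_def)

text \<open>
  The quarter turn is multiplication by \<open>\<i>\<close>, and \<open>Re (cnj z * \<i> w) = - Im (cnj z * w)\<close>.
\<close>

lemma signed_area_complex:
  "signed_area \<gamma> = integral {0..1} (\<lambda>x. Im (cnj (to_complex (\<gamma> x)) * to_complex (dx \<gamma> x))) / 2"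
proof -
  have "\<gamma> x \<bullet> (rot90 *v dx \<gamma> x) = - Im (cnj (to_complex (\<gamma> x)) * to_complex (dx \<gamma> x))" for x
    unfolding inner_to_complex to_complex_rot90 by simp
  then show ?thesis
    by (simp add: signed_area_def del: times_complex.sel)
qed

lemma to_complex_nonzero: "regular_curve \<gamma> \<Longrightarrow> to_complex (dx \<gamma> x) \<noteq> 0"
  using regular_curve_nonzero norm_to_complex by (metis norm_eq_zero)

text \<open>
  The tangent angle is \<open>2\<pi>k s\<close> up to a constant, and \<open>s\<close> grows by one.
\<close>

lemma rotation_number_circle:
  assumes \<gamma>: "W21_curve \<gamma>" "regular_curve \<gamma>" and k: "k > 0" and c: "c \<noteq> 0"
    and s: "\<And>x. (s has_real_derivative \<sigma> x) (at x)" "\<And>x. \<sigma> x > 0" "\<And>x. s (x + 1) = s x + 1"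
    and z: "\<And>x. to_complex (\<gamma> x) = d + c * cis (2 * pi * k * s x)"
  shows "rotation_number \<gamma> = k"
proof -
  define R where "R = norm c"
  define \<alpha> where "\<alpha> = Arg c"
  have cpol: "c = of_real R * cis \<alpha>" and R: "R > 0"
    using rcis_cmod_Arg[of c] c by (simp_all add: rcis_def R_def \<alpha>_def)
  define f where "f x = \<alpha> + pi / 2 + 2 * pi * k * s x" for x
  have "to_complex (unit_tangent \<gamma> x) = cis (f x)" for x
  proof -
    define r where "r = R * (2 * pi * k * \<sigma> x)"
    have r: "r > 0"
      using R k s(2)[of x] by (simp add: r_def)
    have "((\<lambda>x. d + c * cis (2 * pi * k * s x)) has_vector_derivative
        c * (\<i> * of_real (2 * pi * k * \<sigma> x) * cis (2 * pi * k * s x))) (at x)"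
      using has_vector_derivative_add[OF has_vector_derivative_const
          has_vector_derivative_mult_right[OF has_vector_derivative_cis[OF DERIV_cmult[OF s(1)]]],
          of d c "2 * pi * k" x] by simp
    then have "to_complex (dx \<gamma> x) = c * (\<i> * of_real (2 * pi * k * \<sigma> x) * cis (2 * pi * k * s x))"
      using curve_complex(1)[OF \<gamma>(1), of x] unfolding z by (rule vector_derivative_unique_at[rotated])
    also have "\<dots> = of_real r * (cis \<alpha> * cis (pi / 2) * cis (2 * pi * k * s x))"
      unfolding cpol r_def by (simp add: mult_ac)
    also have "cis \<alpha> * cis (pi / 2) * cis (2 * pi * k * s x) = cis (f x)"
      unfolding f_def cis_mult ..
    finally have e: "to_complex (dx \<gamma> x) = of_real r * cis (f x)" .
    moreover have "norm (dx \<gamma> x) = r"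
      using arg_cong[OF e, of norm] r by (simp add: norm_mult)
    ultimately show ?thesis
      using r by (simp add: unit_tangent_complex)
  qed
  moreover have "continuous_on {0..1} f"
    unfolding f_def using s(1) by (intro continuous_intros continuous_at_imp_continuous_on ballI DERIV_isCont)
  ultimately have "2 * pi * rotation_number \<gamma> = f 1 - f 0"
    by (intro rotation_number_eq[OF \<gamma>])
  also have "\<dots> = 2 * pi * k"
    using s(3)[of 0] by (simp add: f_def algebra_simps)
  finally show ?thesis by simp
qed

lemma ccw_round_circleI:
  assumes k: "k \<ge> 1" and c: "c \<noteq> 0"
    and s: "\<And>x. (s has_real_derivative \<sigma> x) (at x)" "\<And>x. \<sigma> x > 0" "\<And>x. s (x + 1) = s x + 1"
    and z: "\<And>x. to_complex (\<gamma> x) = d + c * cis (2 * pi * of_int k * s x)"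
  shows "ccw_round_circle k \<gamma>"
proof -
  define R where "R = norm c"
  define \<alpha> where "\<alpha> = Arg c"
  have cpol: "c = of_real R * cis \<alpha>" and R: "R > 0"
    using rcis_cmod_Arg[of c] c by (simp_all add: rcis_def R_def \<alpha>_def)
  \<comment> \<open>The argument of \<open>c\<close> is absorbed into the parametrization.\<close>
  define \<phi> where "\<phi> x = s x + \<alpha> / (2 * pi * of_int k)" for x
  have "continuous_on UNIV \<phi>"
    unfolding \<phi>_def using s(1)
    by (intro continuous_intros continuous_at_imp_continuous_on ballI DERIV_isCont)
  moreover have "strict_mono \<phi>"
  proof (rule strict_monoI)
    fix x y :: real assume "x < y"
    then have "s x < s y"
      by (rule DERIV_pos_imp_increasing) (use s(1,2) in blast)+
    then show "\<phi> x < \<phi> y"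
      by (simp add: \<phi>_def)
  qed
  moreover have "\<phi> (x + 1) = \<phi> x + 1" for x
    by (simp add: \<phi>_def s(3))
  moreover have "\<gamma> x = of_complex d + R *\<^sub>R
      vector [cos (2 * pi * of_int k * \<phi> x), sin (2 * pi * of_int k * \<phi> x)]" for x
  proof -
    have \<phi>: "2 * pi * of_int k * \<phi> x = \<alpha> + 2 * pi * of_int k * s x"
      using k by (simp add: \<phi>_def distrib_left)
    have "to_complex (\<gamma> x) = d + of_real R * cis (2 * pi * of_int k * \<phi> x)"
      unfolding z \<phi> cis_mult[symmetric] unfolding cpol by (simp only: mult.assoc)
    from arg_cong[OF this, of of_complex]
    have "\<gamma> x = of_complex (d + of_real R * cis (2 * pi * of_int k * \<phi> x))"
      by simp
    then show ?thesis
      by (simp add: of_complex_def vec_eq_iff forall_2)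
  qed
  ultimately show ?thesis
    unfolding ccw_round_circle_def using k R by blast
qed

text \<open>
  The symmetry index of the curve is \<open>idx n m\<close>. In the case of equality the curve is a circle
  covered \<open>idx n m\<close> times, and comparing rotation numbers gives \<open>idx n m = n\<close>.
\<close>

lemma A_set_isoperimetric:
  assumes m: "m > 0" and \<gamma>: "\<gamma> \<in> A_set n m"
  shows "4 * pi * of_int (idx n m) * signed_area \<gamma> \<le> (curve_length \<gamma>)\<^sup>2"
    and "4 * pi * of_int (idx n m) * signed_area \<gamma> = (curve_length \<gamma>)\<^sup>2 \<Longrightarrow>
      idx n m = n \<and> ccw_round_circle n \<gamma>"
proof -
  have W: "W21_curve \<gamma>" and reg: "regular_curve \<gamma>" and N: "rotation_number \<gamma> = of_int n"
    and rs: "rotationally_symmetric m \<gamma>"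
    using \<gamma> by (auto simp: A_set_def)
  obtain i where i: "i \<in> {1..m}"
    and sym: "\<And>x. \<gamma> (x + 1 / of_int m) = rot (2 * pi * of_int i / of_int m) *v \<gamma> x"
    using rs unfolding rotationally_symmetric_def by blast
  obtain j where "n = i + m * j"
    using symmetry_index_cong[OF W reg N m sym] by blast
  then have ik: "i = idx n m"
    using idx_unique[OF m i, of n "- j"] by simp
  define k where "k = nat i"
  define M where "M = nat m"
  have kM: "real k = of_int i" "real M = of_int m" "1 \<le> k" "k \<le> M"
    using i m by (auto simp: k_def M_def)
  have sym': "to_complex (\<gamma> (x + 1 / real M)) = cis (2 * pi * real k / real M) * to_complex (\<gamma> x)" for x
    unfolding kM using sym to_complex_rot by metis
  have sym'': "to_complex (dx \<gamma> (x + 1 / real M)) = cis (2 * pi * real k / real M) * to_complex (dx \<gamma> x)" for x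
    unfolding kM by (rule symmetric_tangent[OF W sym])
  note iso = symmetric_isoperimetric[OF kM(3,4) curve_complex(1,2)[OF W] to_complex_nonzero[OF reg] sym' sym'',
      folded curve_length_complex signed_area_complex, unfolded kM(1) ik]
  show "4 * pi * of_int (idx n m) * signed_area \<gamma> \<le> (curve_length \<gamma>)\<^sup>2"
    by (rule iso(1))
  show "idx n m = n \<and> ccw_round_circle n \<gamma>"
    if eq: "4 * pi * of_int (idx n m) * signed_area \<gamma> = (curve_length \<gamma>)\<^sup>2"
  proof -
    obtain d c s \<sigma> where *: "c \<noteq> 0" "\<And>x. (s has_real_derivative \<sigma> x) (at x)" "\<And>x. \<sigma> x > 0"
      "\<And>x. s (x + 1) = s x + 1"
      "\<And>x. to_complex (\<gamma> x) = d + c * cis (2 * pi * of_int (idx n m) * s x)"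
      using iso(2)[OF eq] by blast
    have "of_int (idx n m) > (0::real)"
      using idx_range(1)[OF m, of n] by simp
    from rotation_number_circle[OF W reg this *] have "idx n m = n"
      using N by simp
    then show ?thesis
      using ccw_round_circleI[OF idx_range(1)[OF m, of n] *] by simp
  qed
qed

section \<open>The isoperimetric ratio of a multiply covered circle\<close>

lemma continuous_nonzero_positive:
  fixes g :: "real \<Rightarrow> real"
  assumes "continuous_on {0..1} g" "\<And>x. x \<in> {0..1} \<Longrightarrow> g x \<noteq> 0" "integral {0..1} g > 0" "x \<in> {0..1}"
  shows "g x > 0"
proof (rule ccontr)
  assume "\<not> g x > 0"
  have "connected (g ` {0..1})"
    using assms(1) by (rule connected_continuous_image) simp
  have nonpos: "g y \<le> 0" if y: "y \<in> {0..1}" for y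
  proof (rule ccontr)
    assume "\<not> g y \<le> 0"
    then have "0 \<in> g ` {0..1}"
      using connectedD_interval[OF \<open>connected (g ` {0..1})\<close>, of "g x" "g y" 0] \<open>\<not> g x > 0\<close> y assms(4) by auto
    then show False
      using assms(2) by fastforce
  qed
  have "integral {0..1} g \<le> integral {0..1} (\<lambda>x::real. 0)"
    by (intro integral_le integrable_continuous_real assms(1) nonpos) auto
  then show False
    using assms(3) by simp
qed

text \<open>
  The parametrization \<open>\<phi>\<close> is merely continuous, but the logarithm of the radius vector \<open>p\<close> shows
  that \<open>2\<pi>n \<phi>\<close> is, up to a constant, a primitive of \<open>g = Im (z'/p)\<close>, so \<open>\<integral> g = 2\<pi>n\<close>. As the curve
  is regular, \<open>g\<close> has no zero and is positive. Hence \<open>|z'| = r g\<close>, which gives the length \<open>2\<pi>n r\<close> and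
  the area \<open>\<pi>n r\<^sup>2\<close>.
\<close>

lemma ccw_round_circle_isoperimetric_ratio:
  assumes \<gamma>: "W21_curve \<gamma>" "regular_curve \<gamma>" and circ: "ccw_round_circle n \<gamma>"
  shows "isoperimetric_ratio \<gamma> = ereal (of_int n)"
proof -
  obtain c r \<phi> where n: "n \<ge> 1" and r: "r > 0" and \<phi>: "continuous_on UNIV \<phi>" "\<And>x. \<phi> (x + 1) = \<phi> x + 1"
    and eq: "\<And>x. \<gamma> x = c + r *\<^sub>R vector [cos (2 * pi * of_int n * \<phi> x), sin (2 * pi * of_int n * \<phi> x)]"
    using circ unfolding ccw_round_circle_def by blast
  define z where "z x = to_complex (\<gamma> x)" for x
  define z' where "z' x = to_complex (dx \<gamma> x)" for x
  define p where "p x = of_real r * cis (2 * pi * of_int n * \<phi> x)" for x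
  have zp: "z x = to_complex c + p x" for x
    by (simp add: z_def p_def eq to_complex_def complex_eq_iff)
  have np: "norm (p x) = r" for x
    using r by (simp add: p_def norm_mult)
  have p_nz: "p x \<noteq> 0" for x
    using np[of x] r by auto
  have z_deriv: "(z has_vector_derivative z' x) (at x)" for x
    using curve_complex(1)[OF \<gamma>(1)] by (simp add: z_def[abs_def] z'_def)
  have z'_cont: "continuous_on UNIV z'"
    using curve_complex(2)[OF \<gamma>(1)] by (simp add: z'_def[abs_def])
  have "p = (\<lambda>x. z x - to_complex c)"
    by (simp add: zp fun_eq_iff)
  then have p_deriv: "(p has_vector_derivative z' x) (at x)" for x
    using z_deriv[of x] by (auto intro!: derivative_eq_intros)
  have p_cont: "continuous_on UNIV p"
    using p_deriv by (auto intro!: continuous_at_imp_continuous_on has_vector_derivative_continuous)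
  define h where "h x = z' x / p x" for x
  have h_cont: "continuous_on S h" for S
    unfolding h_def using p_nz by (intro continuous_intros continuous_on_subset[OF z'_cont] continuous_on_subset[OF p_cont]) auto
  \<comment> \<open>The velocity is orthogonal to the radius, whose length is constant.\<close>
  have Re_h: "Re (h x) = 0" for x
  proof -
    have "((\<lambda>x. cnj (p x) * p x) has_vector_derivative cnj (p x) * z' x + cnj (z' x) * p x) (at x)"
      by (intro has_vector_derivative_mult p_deriv bounded_linear.has_vector_derivative[OF bounded_linear_cnj])
    moreover have "(\<lambda>x. cnj (p x) * p x) = (\<lambda>x. of_real (r\<^sup>2))"
      using complex_norm_square[of "p _"] np by (simp add: mult.commute)
    ultimately have "cnj (p x) * z' x + cnj (z' x) * p x = 0"
      using vector_derivative_unique_at[OF _ has_vector_derivative_const] by metis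
    then have "Re (cnj (p x) * z' x + cnj (z' x) * p x) = 0"
      by simp
    then have "Re (cnj (p x) * z' x) = 0"
      by simp
    moreover have "h x = cnj (p x) * z' x / of_real (r\<^sup>2)"
      using complex_norm_square[of "p x"] np[of x] p_nz[of x] by (simp add: h_def field_simps)
    ultimately show ?thesis
      by (simp add: Re_divide_of_real del: of_real_power)
  qed
  define g where "g x = Im (h x)" for x
  have z'_eq: "z' x = \<i> * of_real (g x) * p x" for x
  proof -
    have "h x = \<i> * of_real (g x)"
      using Re_h[of x] by (simp add: g_def complex_eq_iff)
    then show ?thesis
      using p_nz[of x] by (simp add: h_def field_simps)
  qed
  have g_cont: "continuous_on {0..1} g"
    unfolding g_def by (intro continuous_intros h_cont)
  have prim: "is_primitive p z'"
    using p_deriv continuous_on_subset[OF z'_cont]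
    by (intro C1_is_primitive) (auto intro: has_vector_derivative_at_within)
  define K where "K x = integral {0..x} g" for x
  have K_cont: "continuous_on {0..1} K"
    unfolding K_def using g_cont by (intro indefinite_integral_continuous_1 integrable_continuous_real)
  have polar: "p x = p 0 * cis (K x)" if x: "x \<in> {0..1}" for x
  proof -
    have "h integrable_on {0..x}"
      by (rule integrable_continuous_real[OF h_cont])
    then have "Im (integral {0..x} h) = K x" "Re (integral {0..x} h) = 0"
      using integral_linear[OF _ bounded_linear_Im, of h "{0..x}"] integral_linear[OF _ bounded_linear_Re, of h "{0..x}"]
      by (simp_all add: K_def g_def[abs_def] o_def Re_h)
    then have "exp (integral {0..x} h) = cis (K x)"
      by (simp add: exp_eq_polar)
    then show ?thesis
      using is_primitive_log(2)[OF prim p_nz x] by (simp add: h_def[abs_def])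
  qed
  have "cis (K x) = cis (- (2 * pi * of_int n * \<phi> 0)) * cis (2 * pi * of_int n * \<phi> x)"
    if "x \<in> {0..1}" for x
  proof -
    have "cis (2 * pi * of_int n * \<phi> x) = cis (2 * pi * of_int n * \<phi> 0) * cis (K x)"
      using polar[OF that] r by (simp add: p_def)
    then have "cis (- (2 * pi * of_int n * \<phi> 0)) * cis (2 * pi * of_int n * \<phi> x)
        = (cis (- (2 * pi * of_int n * \<phi> 0)) * cis (2 * pi * of_int n * \<phi> 0)) * cis (K x)"
      by (simp only: mult.assoc)
    then show ?thesis
      by (simp add: cis_mult)
  qed
  then have "K 1 - K 0 = 2 * pi * of_int n * \<phi> 1 - 2 * pi * of_int n * \<phi> 0"
    by (intro cis_lift_unique[OF K_cont]) (auto intro!: continuous_intros continuous_on_subset[OF \<phi>(1)])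
  then have K1: "integral {0..1} g = 2 * pi * of_int n"
    using \<phi>(2)[of 0] by (simp add: K_def algebra_simps)
  have g_pos: "g x > 0" if "x \<in> {0..1}" for x
  proof (rule continuous_nonzero_positive[OF g_cont _ _ that])
    show "g x \<noteq> 0" for x
      using z'_eq[of x] to_complex_nonzero[OF \<gamma>(2), of x] by (auto simp: z'_def)
    show "integral {0..1} g > 0"
      using K1 n by simp
  qed
  have L: "curve_length \<gamma> = 2 * pi * of_int n * r"
  proof -
    have "curve_length \<gamma> = integral {0..1} (\<lambda>x. norm (z' x))"
      by (simp add: curve_length_complex z'_def)
    also have "\<dots> = integral {0..1} (\<lambda>x. g x * r)"
      using g_pos by (intro integral_cong) (simp add: z'_eq norm_mult np less_imp_le)
    also have "\<dots> = 2 * pi * of_int n * r"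
      by (simp add: K1)
    finally show ?thesis .
  qed
  have A: "signed_area \<gamma> = pi * of_int n * r\<^sup>2"
  proof -
    have "(z' has_integral (p 1 - p 0)) {0..1}"
      using p_deriv by (intro fundamental_theorem_of_calculus) (auto intro: has_vector_derivative_at_within)
    moreover have "p 1 = p 0"
      using \<phi>(2)[of 0] by (simp add: p_def distrib_left flip: cis_mult)
    ultimately have "((\<lambda>x. cnj (to_complex c) * z' x) has_integral cnj (to_complex c) * 0) {0..1}"
      using has_integral_mult_right[of z' "p 1 - p 0"] by simp
    from has_integral_linear[OF this bounded_linear_Im]
    have 1: "((\<lambda>x. Im (cnj (to_complex c) * z' x)) has_integral 0) {0..1}"
      by (simp add: o_def)
    have 2: "((\<lambda>x. g x * r\<^sup>2) has_integral (2 * pi * of_int n * r\<^sup>2)) {0..1}"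
      using has_integral_mult_left[OF integrable_integral[OF integrable_continuous_real[OF g_cont]], of "r\<^sup>2"] K1
      by simp
    have "Im (cnj (z x) * z' x) = Im (cnj (to_complex c) * z' x) + g x * r\<^sup>2" for x
    proof -
      have "cnj (p x) * z' x = \<i> * of_real (g x) * of_real (r\<^sup>2)"
        using complex_norm_square[of "p x"] np[of x] by (simp add: z'_eq mult_ac)
      then show ?thesis
        by (simp add: zp distrib_right)
    qed
    then have "((\<lambda>x. Im (cnj (z x) * z' x)) has_integral (0 + 2 * pi * of_int n * r\<^sup>2)) {0..1}"
      using has_integral_add[OF 1 2] by (simp only:)
    then have "integral {0..1} (\<lambda>x. Im (cnj (z x) * z' x)) = 2 * pi * of_int n * r\<^sup>2"
      by (simp add: integral_unique del: times_complex.sel)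
    then show ?thesis
      unfolding signed_area_complex z_def z'_def by simp
  qed
  then have "signed_area \<gamma> > 0"
    using n r by simp
  moreover have "(curve_length \<gamma>)\<^sup>2 / (4 * pi * signed_area \<gamma>) = of_int n"
    using n r by (simp add: L A field_simps power2_eq_square)
  ultimately show ?thesis
    by (simp add: isoperimetric_ratio_def)
qed

section \<open>Curves with a prescribed tangent angle\<close>

text \<open>
  Subtracting the mean \<open>\<delta>\<close> of \<open>cis \<theta>\<close> closes the curve. As \<open>|\<delta>| < 1\<close>, the factor by which the
  velocity \<open>cis \<theta> - \<delta>\<close> differs from \<open>cis \<theta>\<close> has positive real part, so the rotation number is still
  given by \<open>\<theta>\<close>. The symmetry survives because \<open>\<delta>\<close> is invariant under the rotation \<open>\<omega>\<close> (it is zero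
  unless \<open>\<omega> = 1\<close>); for \<open>\<omega> \<noteq> 1\<close> the curve still has to be centred at the fixed point of its symmetry.
\<close>

lemma curve_with_given_direction:
  fixes \<theta> \<theta>' :: "real \<Rightarrow> real" and m k q :: int
  assumes m: "m > 0" and k: "k \<in> {1..m}"
    and \<theta>: "\<And>x. (\<theta> has_real_derivative \<theta>' x) (at x)" and \<theta>'_cont: "continuous_on UNIV \<theta>'"
    and shift: "\<And>x. \<theta> (x + 1 / of_int m) = \<theta> x + 2 * pi * of_int k / of_int m + 2 * pi * of_int q"
  defines "\<delta> \<equiv> integral {0..1} (\<lambda>x. cis (\<theta> x))"
  assumes \<delta>: "norm \<delta> < 1"
  obtains \<gamma> where "\<gamma> \<in> A_set (k + m * q) m" "\<And>x. to_complex (dx \<gamma> x) = cis (\<theta> x) - \<delta>"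
    "\<And>x. ((\<lambda>x. to_complex (\<gamma> x)) has_vector_derivative (cis (\<theta> x) - \<delta>)) (at x)"
proof -
  define w where "w = 1 / real_of_int m"
  define \<omega> where "\<omega> = cis (2 * pi * of_int k / of_int m)"
  have \<theta>_cont: "continuous_on S \<theta>" for S
    by (intro continuous_at_imp_continuous_on ballI DERIV_isCont[OF \<theta>])
  have cis_shift: "cis (\<theta> (x + w)) = \<omega> * cis (\<theta> x)" for x
  proof -
    have "cis (\<theta> (x + w)) = cis (\<theta> x) * \<omega> * cis (2 * pi * of_int q)"
      unfolding w_def shift \<omega>_def cis_mult ..
    then show ?thesis by simp
  qed
  have \<theta>1: "\<theta> (x + 1) = \<theta> x + 2 * pi * of_int (k + m * q)" for x
  proof -
    have "\<theta> (x + of_int m * w) = \<theta> x + of_int m * (2 * pi * of_int k / of_int m + 2 * pi * of_int q)"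
      using shift by (intro quasi_periodic_of_int) (simp add: w_def)
    then show ?thesis
      using m by (simp add: w_def algebra_simps)
  qed
  have cis1: "cis (\<theta> (x + 1)) = cis (\<theta> x)" for x
  proof -
    have "cis (\<theta> (x + 1)) = cis (\<theta> x) * cis (2 * pi * of_int (k + m * q))"
      unfolding \<theta>1 cis_mult ..
    then show ?thesis by (simp del: of_int_add of_int_mult)
  qed
  have cis_cont: "continuous_on S (\<lambda>x. cis (\<theta> x))" for S
    by (intro continuous_intros \<theta>_cont)
  obtain C where C: "\<And>x. (C has_vector_derivative cis (\<theta> x)) (at x)"
    using einterval_antiderivative[of "-\<infinity>" "\<infinity>" "\<lambda>x. cis (\<theta> x)"] cis_cont[of UNIV]
    by (auto simp: continuous_on_eq_continuous_at)
  have "((\<lambda>x. cis (\<theta> x)) has_integral (C 1 - C 0)) {0..1}"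
    using C by (intro fundamental_theorem_of_calculus) (auto intro: has_vector_derivative_at_within)
  then have C\<delta>: "C 1 - C 0 = \<delta>"
    unfolding \<delta>_def by (rule integral_unique[symmetric])
  have Cw: "C (x + w) - C (y + w) = \<omega> * (C x - C y)" for x y
  proof -
    have "((\<lambda>x. C (x + w)) has_vector_derivative \<omega> * cis (\<theta> x)) (at x)" for x
      using has_vector_derivative_shift[OF C[of "x + w"]] by (simp only: cis_shift)
    from equal_derivatives_imp_equal_differences[OF this has_vector_derivative_mult_right[OF C], of x y]
    show ?thesis by (simp add: algebra_simps)
  qed
  have C1: "C (x + 1) - C x = \<delta>" for x
  proof -
    have "((\<lambda>x. C (x + 1)) has_vector_derivative cis (\<theta> x)) (at x)" for x
      using has_vector_derivative_shift[OF C[of "x + 1"]] by (simp only: cis1)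
    from equal_derivatives_imp_equal_differences[OF this C, of x 0] C\<delta>
    show ?thesis by (simp add: algebra_simps)
  qed
  have \<omega>\<delta>: "\<omega> * \<delta> = \<delta>"
    using Cw[of 1 0] C1[of w] C\<delta> by (simp add: add.commute)
  define Z where "Z x = C x - of_real x * \<delta>" for x
  have Z: "(Z has_vector_derivative (cis (\<theta> x) - \<delta>)) (at x)" for x
  proof -
    have "((\<lambda>x. of_real x * \<delta>) has_vector_derivative (1 * \<delta>)) (at x)"
      by (intro has_vector_derivative_mult_left) (auto intro!: derivative_eq_intros)
    then show ?thesis
      unfolding Z_def[abs_def] using has_vector_derivative_diff[OF C] by simp
  qed
  have Z1: "Z (x + 1) = Z x" for x
    using C1[of x] by (simp add: Z_def algebra_simps)
  define e where "e = Z w - \<omega> * Z 0"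
  have Ze: "Z (x + w) = \<omega> * Z x + e" for x
  proof -
    have *: "\<omega> * (of_real x * \<delta>) = of_real x * \<delta>"
      using \<omega>\<delta> by (metis mult.left_commute)
    have "Z (x + w) - (\<omega> * Z x + e)
        = (C (x + w) - C (0 + w) - \<omega> * (C x - C 0)) + (\<omega> * (of_real x * \<delta>) - of_real x * \<delta>)"
      by (simp add: Z_def e_def algebra_simps)
    also have "\<dots> = 0"
      unfolding Cw[of x 0] * by simp
    finally show ?thesis by simp
  qed
  \<comment> \<open>The fixed point \<open>b\<close> of \<open>z \<mapsto> \<omega> z + e\<close> becomes the origin; if \<open>\<omega> = 1\<close>, this map is a translation,
      which must be trivial because the curve closes up.\<close>
  have "\<exists>b. e = (1 - \<omega>) * b"
  proof (cases "\<omega> = 1")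
    case True
    have "Z (0 + of_int m * w) = Z 0 + of_int m * e"
      using Ze True by (intro quasi_periodic_of_int) simp
    then have "e = 0"
      using Z1[of 0] m by (simp add: w_def)
    then show ?thesis by (intro exI[of _ 0]) simp
  next
    case False
    then show ?thesis by (intro exI[of _ "e / (1 - \<omega>)"]) simp
  qed
  then obtain b where b: "e = (1 - \<omega>) * b" by blast
  define \<gamma> where "\<gamma> x = of_complex (Z x - b)" for x
  have zd: "((\<lambda>x. Z x - b) has_vector_derivative (cis (\<theta> x) - \<delta>)) (at x)" for x
    using has_vector_derivative_diff[OF Z has_vector_derivative_const] by simp
  have \<gamma>d: "(\<gamma> has_vector_derivative of_complex (cis (\<theta> x) - \<delta>)) (at x)" for x
    unfolding \<gamma>_def[abs_def]
    by (rule bounded_linear.has_vector_derivative[OF bounded_linear_of_complex zd])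
  have v_deriv: "((\<lambda>x. of_complex (cis (\<theta> x) - \<delta>)) has_vector_derivative of_complex (\<i> * of_real (\<theta>' x) * cis (\<theta> x))) (at x)" for x
    using bounded_linear.has_vector_derivative[OF bounded_linear_of_complex
        has_vector_derivative_diff[OF has_vector_derivative_cis[OF \<theta>] has_vector_derivative_const]] by simp
  have W: "W21_curve \<gamma>"
  proof (rule W21_curveI[OF _ \<gamma>d v_deriv])
    show "\<gamma> (x + 1) = \<gamma> x" for x
      by (simp add: \<gamma>_def Z1)
    show "continuous_on UNIV (\<lambda>x. of_complex (\<i> * of_real (\<theta>' x) * cis (\<theta> x)))"
      by (intro bounded_linear.continuous_on[OF bounded_linear_of_complex] continuous_intros \<theta>'_cont \<theta>_cont)
  qed
  have dx: "dx \<gamma> x = of_complex (cis (\<theta> x) - \<delta>)" for x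
    unfolding dx_def by (rule vector_derivative_at[OF \<gamma>d])
  have lower: "1 - norm \<delta> \<le> norm (cis (\<theta> x) - \<delta>)" for x
    using norm_triangle_ineq2[of "cis (\<theta> x)" \<delta>] by simp
  have reg: "regular_curve \<gamma>"
    unfolding regular_curve_def using lower \<delta> by (intro exI[of _ "1 - norm \<delta>"]) (auto simp: dx)
  \<comment> \<open>\<open>cis \<theta> - \<delta> = cis \<theta> * y\<close>, and the argument of \<open>y\<close> is a continuous periodic function.\<close>
  define y where "y x = 1 - \<delta> * cnj (cis (\<theta> x))" for x
  have y_Re: "Re (y x) > 0" for x
  proof -
    have "Re (\<delta> * cnj (cis (\<theta> x))) \<le> norm \<delta>"
      using complex_Re_le_cmod[of "\<delta> * cnj (cis (\<theta> x))"] by (simp add: norm_mult del: times_complex.sel)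
    then show ?thesis
      using \<delta> by (simp add: y_def del: times_complex.sel)
  qed
  then have y_nn: "y x \<notin> \<real>\<^sub>\<le>\<^sub>0" for x
    by (auto simp: complex_nonpos_Reals_iff not_le[symmetric])
  define f where "f x = \<theta> x + Im (Ln (y x))" for x
  have "2 * pi * rotation_number \<gamma> = f 1 - f 0"
  proof (rule rotation_number_eq[OF W reg])
    have "continuous_on {0..1} y"
      unfolding y_def by (intro continuous_intros cis_cont)
    then have "continuous_on {0..1} (\<lambda>x. Ln (y x))"
      using y_nn by (intro continuous_intros) auto
    then show "continuous_on {0..1} f"
      unfolding f_def by (intro continuous_on_add continuous_on_Im \<theta>_cont)
    show "to_complex (unit_tangent \<gamma> x) = cis (f x)" for x
    proof -
      have "y x \<noteq> 0"
        using y_Re[of x] by auto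
      then have "y x = of_real (norm (y x)) * cis (Im (Ln (y x)))"
        using exp_eq_polar[of "Ln (y x)"] by (simp add: Re_Ln)
      moreover have "cis (\<theta> x) - \<delta> = cis (\<theta> x) * y x"
      proof -
        have "cis (\<theta> x) * cnj (cis (\<theta> x)) = 1"
          by (simp add: cis_cnj cis_mult)
        then have "cis (\<theta> x) * (\<delta> * cnj (cis (\<theta> x))) = \<delta>"
          by (metis mult.left_commute mult.right_neutral)
        then show ?thesis by (simp add: y_def right_diff_distrib)
      qed
      ultimately have "cis (\<theta> x) - \<delta> = of_real (norm (y x)) * cis (f x)"
        unfolding f_def cis_mult[symmetric] by (metis mult.left_commute)
      moreover from this have "norm (cis (\<theta> x) - \<delta>) = norm (y x)"
        by (simp add: norm_mult)
      ultimately show ?thesis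
        using \<open>y x \<noteq> 0\<close> by (simp add: unit_tangent_complex dx)
    qed
  qed
  also have "f 1 - f 0 = 2 * pi * of_int (k + m * q)"
    using \<theta>1[of 0] cis1[of 0] by (simp add: f_def y_def)
  finally have N: "rotation_number \<gamma> = of_int (k + m * q)"
    by simp
  have "\<gamma> (x + 1 / of_int m) = rot (2 * pi * of_int k / of_int m) *v \<gamma> x" for x
  proof -
    have "to_complex (\<gamma> (x + w)) = \<omega> * to_complex (\<gamma> x)"
      unfolding \<gamma>_def to_complex_of_complex Ze b by (simp add: algebra_simps)
    then have "to_complex (\<gamma> (x + w)) = to_complex (rot (2 * pi * of_int k / of_int m) *v \<gamma> x)"
      by (simp add: to_complex_rot \<omega>_def)
    from arg_cong[OF this, of of_complex] show ?thesis
      by (simp add: w_def)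
  qed
  then have "rotationally_symmetric m \<gamma>"
    unfolding rotationally_symmetric_def using k by blast
  then have "\<gamma> \<in> A_set (k + m * q) m"
    using W reg N by (simp add: A_set_def)
  moreover have "((\<lambda>x. to_complex (\<gamma> x)) has_vector_derivative (cis (\<theta> x) - \<delta>)) (at x)" for x
    using zd by (simp add: \<gamma>_def)
  ultimately show ?thesis
    using that[of \<gamma>] dx by simp
qed

text \<open>
  The comparison circle \<open>z0\<close> has velocity \<open>e0 cis (2\<pi>k x)\<close> and length one, so twice its area is
  \<open>1/(2\<pi>k)\<close>. A velocity \<open>v\<close> that is close to it in \<open>L\<^sup>1\<close> gives a uniformly close curve, and the area
  depends continuously on both.
\<close>

lemma area_close_to_circle:
  fixes z v :: "real \<Rightarrow> complex" and k :: nat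
  assumes k: "k \<ge> 1" and e0: "norm e0 = 1"
    and z: "\<And>x. (z has_vector_derivative v x) (at x)" and v_cont: "continuous_on UNIV v"
    and closed: "z 1 = z 0" and v_bound: "\<And>x. norm (v x) \<le> B"
  defines "E \<equiv> integral {0..1} (\<lambda>x. norm (v x - e0 * cis (2 * pi * k * x)))"
  shows "\<bar>integral {0..1} (\<lambda>x. Im (cnj (z x) * v x)) - 1 / (2 * pi * k)\<bar> \<le> E * B + E"
proof -
  define v0 where "v0 x = e0 * cis (2 * pi * k * x)" for x
  define z0 where "z0 x = - \<i> / (2 * pi * k) * v0 x" for x
  have v0_deriv: "(v0 has_vector_derivative (2 * pi * k) * \<i> * v0 x) (at x)" for x
    using has_vector_derivative_mult_right[OF has_vector_derivative_cis[OF DERIV_cmult[OF DERIV_ident]], of e0 "2 * pi * k" x]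
    by (simp add: v0_def[abs_def] mult_ac)
  have z0_deriv: "(z0 has_vector_derivative v0 x) (at x)" for x
    using has_vector_derivative_mult_right[OF v0_deriv, of "- \<i> / (2 * pi * k)" x] k
    by (simp add: z0_def[abs_def] field_simps)
  have v0_cont: "continuous_on S v0" for S
    unfolding v0_def by (intro continuous_intros)
  have nv0: "norm (v0 x) = 1" for x
    by (simp add: v0_def norm_mult e0)
  have nz0: "norm (z0 x) \<le> 1" for x
  proof -
    have "1 * 1 \<le> 2 * pi * k"
      using k pi_gt3 by (intro mult_mono) auto
    then show ?thesis
      by (simp add: z0_def norm_mult norm_divide nv0)
  qed
  \<comment> \<open>A translation does not change the area of a closed curve, so the starting points may be
      assumed to coincide.\<close>
  define \<zeta> where "\<zeta> x = z x - z 0 + z0 0" for x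
  have \<zeta>_deriv: "(\<zeta> has_vector_derivative v x) (at x)" for x
    unfolding \<zeta>_def[abs_def] using z[of x] by (auto intro!: derivative_eq_intros)
  have cont: "continuous_on S v" "continuous_on S z" "continuous_on S \<zeta>" "continuous_on S z0" for S
    using continuous_on_subset[OF v_cont, of S] has_vector_derivative_continuous[OF z]
      has_vector_derivative_continuous[OF \<zeta>_deriv] has_vector_derivative_continuous[OF z0_deriv]
    by (auto intro!: continuous_at_imp_continuous_on)
  have E_int: "(\<lambda>x. norm (v x - v0 x)) integrable_on {a..b}" for a b
    by (intro integrable_continuous_real continuous_intros cont v0_cont)
  have close: "norm (\<zeta> x - z0 x) \<le> E" if x: "x \<in> {0..1}" for x
  proof -
    have "((\<lambda>x. v x - v0 x) has_integral ((\<zeta> x - z0 x) - (\<zeta> 0 - z0 0))) {0..x}"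
      using x by (intro fundamental_theorem_of_calculus has_vector_derivative_diff)
        (auto intro: has_vector_derivative_at_within \<zeta>_deriv z0_deriv)
    then have I: "((\<lambda>x. v x - v0 x) has_integral (\<zeta> x - z0 x)) {0..x}"
      by (simp add: \<zeta>_def)
    have "norm (integral {0..x} (\<lambda>x. v x - v0 x)) \<le> integral {0..x} (\<lambda>x. norm (v x - v0 x))"
      using I E_int by (intro integral_norm_bound_integral) auto
    also have "\<dots> \<le> integral {0..1} (\<lambda>x. norm (v x - v0 x))"
      using x E_int by (intro integral_subset_le) auto
    finally show ?thesis
      using integral_unique[OF I] by (simp add: E_def v0_def)
  qed
  have E0: "E \<ge> 0"
    unfolding E_def v0_def[symmetric] using E_int by (intro integral_nonneg) auto
  have v0: "((\<lambda>x. Im (cnj (z0 x) * v0 x)) has_integral 1 / (2 * pi * k)) {0..1}"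
  proof -
    have "Im (cnj (z0 x) * v0 x) = 1 / (2 * pi * k)" for x
    proof -
      have "cnj (z0 x) * v0 x = \<i> / (2 * pi * k) * of_real ((norm (v0 x))\<^sup>2)"
        using complex_norm_square[of "v0 x"] by (simp add: z0_def mult_ac)
      then show ?thesis by (simp add: nv0 Im_divide_of_real[of \<i> "2 * pi * k", simplified])
    qed
    then show ?thesis
      using has_integral_const_real[of "1 / (2 * pi * k)" 0 1] by simp
  qed
  have z_\<zeta>: "((\<lambda>x. Im (cnj (\<zeta> x) * v x)) has_integral integral {0..1} (\<lambda>x. Im (cnj (z x) * v x))) {0..1}"
  proof -
    define c where "c = z0 0 - z 0"
    have "(v has_integral (z 1 - z 0)) {0..1}"
      by (intro fundamental_theorem_of_calculus) (auto intro: has_vector_derivative_at_within z)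
    from has_integral_linear[OF has_integral_mult_right[OF this, of "cnj c"] bounded_linear_Im]
    have 1: "((\<lambda>x. Im (cnj c * v x)) has_integral 0) {0..1}"
      by (simp add: closed o_def)
    have "(\<lambda>x. Im (cnj (z x) * v x)) integrable_on {0..1}"
      by (intro integrable_continuous_real continuous_intros cont)
    from has_integral_add[OF integrable_integral[OF this] 1] show ?thesis
      by (simp add: \<zeta>_def c_def algebra_simps)
  qed
  have "((\<lambda>x. Im (cnj (\<zeta> x) * v x) - Im (cnj (z0 x) * v0 x)) has_integral
      (integral {0..1} (\<lambda>x. Im (cnj (z x) * v x)) - 1 / (2 * pi * k))) {0..1}"
    by (rule has_integral_diff[OF z_\<zeta> v0])
  note I = this
  have "norm (integral {0..1} (\<lambda>x. Im (cnj (\<zeta> x) * v x) - Im (cnj (z0 x) * v0 x)))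
      \<le> integral {0..1} (\<lambda>x. E * B + norm (v x - v0 x))"
  proof (rule integral_norm_bound_integral)
    show "(\<lambda>x. E * B + norm (v x - v0 x)) integrable_on {0..1}"
      by (intro integrable_add E_int integrable_const_ivl)
    fix x :: real assume x: "x \<in> {0..1}"
    have "cnj (\<zeta> x) * v x - cnj (z0 x) * v0 x = cnj (\<zeta> x - z0 x) * v x + cnj (z0 x) * (v x - v0 x)"
      by (simp add: algebra_simps)
    then have "norm (cnj (\<zeta> x) * v x - cnj (z0 x) * v0 x)
        \<le> norm (\<zeta> x - z0 x) * norm (v x) + norm (z0 x) * norm (v x - v0 x)"
      by (metis norm_triangle_ineq norm_mult complex_mod_cnj)
    also have "\<dots> \<le> E * B + 1 * norm (v x - v0 x)"
      using close[OF x] v_bound[of x] nz0[of x] E0 by (intro add_mono mult_mono) auto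
    finally have "norm (cnj (\<zeta> x) * v x - cnj (z0 x) * v0 x) \<le> E * B + norm (v x - v0 x)"
      by simp
    then show "norm (Im (cnj (\<zeta> x) * v x) - Im (cnj (z0 x) * v0 x)) \<le> E * B + norm (v x - v0 x)"
      using abs_Im_le_cmod[of "cnj (\<zeta> x) * v x - cnj (z0 x) * v0 x"]
      by (simp del: times_complex.sel)
  qed (use I in auto)
  also have "\<dots> = E * B + E"
    using E_int[of 0 1] by (subst integral_add) (auto simp: E_def v0_def)
  finally show ?thesis
    using integral_unique[OF I] by (simp del: times_complex.sel)
qed

section \<open>Curves with small loops\<close>

text \<open>
  For \<open>0 \<le> a < 1\<close>, \<open>cis (2\<pi> smooth_step a y)\<close> is the Blaschke factor \<open>(\<zeta> - a)/(1 - a \<zeta>)\<close> at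
  \<open>\<zeta> = cis (2\<pi>y)\<close>. As \<open>a\<close> tends to one it makes its full turn in a shrinking neighbourhood of \<open>\<zeta> = 1\<close>.
\<close>

definition smooth_step :: "real \<Rightarrow> real \<Rightarrow> real" where
  "smooth_step a y = y + arctan (a * sin (2 * pi * y) / (1 - a * cos (2 * pi * y))) / pi"

lemma smooth_step_shift: "smooth_step a (y + 1) = smooth_step a y + 1"
  by (simp add: smooth_step_def distrib_left sin_add cos_add)

lemma smooth_step_C1:
  assumes a: "0 \<le> a" "a < 1"
  obtains \<eta>' where "\<And>y. (smooth_step a has_real_derivative \<eta>' y) (at y)" "continuous_on UNIV \<eta>'"
proof -
  define N where "N y = a * sin (2 * pi * y)" for y
  define N' where "N' y = a * (2 * pi * cos (2 * pi * y))" for y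
  define D where "D y = 1 - a * cos (2 * pi * y)" for y
  define D' where "D' y = a * (2 * pi * sin (2 * pi * y))" for y
  have D: "D y \<noteq> 0" for y
  proof -
    have "a * cos (2 * pi * y) \<le> a * 1"
      using a by (intro mult_left_mono) auto
    then show ?thesis
      using a unfolding D_def by linarith
  qed
  have N_deriv: "(N has_real_derivative N' y) (at y)" for y
    unfolding N_def[abs_def] N'_def by (auto intro!: derivative_eq_intros)
  have D_deriv: "(D has_real_derivative D' y) (at y)" for y
    unfolding D_def[abs_def] D'_def by (auto intro!: derivative_eq_intros)
  define Q' where "Q' y = (N' y * D y - N y * D' y) / (D y * D y)" for y
  have Q_deriv: "((\<lambda>y. N y / D y) has_real_derivative Q' y) (at y)" for y
    unfolding Q'_def by (rule DERIV_divide[OF N_deriv D_deriv D])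
  define \<eta>' where "\<eta>' y = 1 + inverse (1 + (N y / D y)\<^sup>2) * Q' y / pi" for y
  have "smooth_step a = (\<lambda>y. y + arctan (N y / D y) / pi)"
    by (simp add: smooth_step_def N_def D_def fun_eq_iff)
  then have "(smooth_step a has_real_derivative \<eta>' y) (at y)" for y
    unfolding \<eta>'_def
    using DERIV_add[OF DERIV_ident DERIV_cdivide[OF DERIV_chain2[OF DERIV_arctan Q_deriv]]] by simp
  moreover have "1 + (N y / D y)\<^sup>2 \<noteq> 0" for y
    by (metis add_pos_nonneg less_irrefl zero_le_power2 zero_less_one)
  then have "continuous_on UNIV \<eta>'"
    unfolding \<eta>'_def Q'_def using D
    by (auto intro!: continuous_intros simp: N_def N'_def D_def D'_def)
  ultimately show ?thesis
    by (rule that)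
qed

text \<open>
  For \<open>a = 1\<close> the argument of the arctangent is \<open>cot (\<pi>y)\<close>, and \<open>t + arctan (cot t)\<close> is an odd
  multiple of \<open>\<pi>/2\<close>. So in the limit \<open>cis (2\<pi> smooth_step a y)\<close> is \<open>-1\<close>, whose \<open>q\<close>-th power is
  \<open>cis (\<pi>q)\<close>.
\<close>

lemma smooth_step_limit:
  assumes a: "\<alpha> \<longlonglongrightarrow> 1" and y: "cos (2 * pi * y) \<noteq> 1"
  shows "(\<lambda>j. cis (2 * pi * of_int q * smooth_step (\<alpha> j) y)) \<longlonglongrightarrow> cis (pi * of_int q)"
proof -
  define t where "t = pi * y"
  define \<eta> where "\<eta> = y + arctan (sin (2 * pi * y) / (1 - cos (2 * pi * y))) / pi"
  have st: "sin t \<noteq> 0"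
    using y cos_double_sin[of t] by (auto simp: t_def mult_ac)
  have "(\<lambda>j. smooth_step (\<alpha> j) y) \<longlonglongrightarrow> y + arctan (1 * sin (2 * pi * y) / (1 - 1 * cos (2 * pi * y))) / pi"
    unfolding smooth_step_def using a y by (intro tendsto_intros) auto
  then have "(\<lambda>j. cis (2 * pi * of_int q * smooth_step (\<alpha> j) y)) \<longlonglongrightarrow> cis (2 * pi * of_int q * \<eta>)"
    by (intro tendsto_cis tendsto_mult tendsto_const) (simp add: \<eta>_def)
  moreover have "cis (2 * pi * of_int q * \<eta>) = cis (pi * of_int q)"
  proof -
    define c where "c = arctan (cos t / sin t)"
    have "sin (2 * pi * y) / (1 - cos (2 * pi * y)) = cos t / sin t"
      using st sin_double[of t] cos_double_sin[of t] by (simp add: t_def mult_ac power2_eq_square)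
    then have \<eta>: "2 * pi * \<eta> = 2 * t + 2 * c"
      by (simp add: \<eta>_def c_def t_def distrib_left)
    have "cos c \<noteq> 0" "tan c = cos t / sin t"
      by (simp_all add: c_def tan_arctan)
    then have "sin c * sin t = cos t * cos c"
      using st by (simp add: tan_def field_simps)
    then have "cos (t + c) = 0"
      by (simp add: cos_add mult.commute)
    then have "cos (2 * (t + c)) = - 1"
      by (simp only: cos_double_cos) simp
    then have "cos (2 * pi * \<eta>) = - 1"
      by (simp add: \<eta> distrib_left)
    then have "cis (2 * pi * \<eta> - pi) = 1"
      using sin_cos_squared_add[of "2 * pi * \<eta>"] by (simp add: complex_eq_iff cos_diff sin_diff)
    then obtain l :: int where "2 * pi * \<eta> - pi = 2 * pi * of_int l"
      using cis_eq_1D by blast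
    then have l: "2 * pi * \<eta> = pi + 2 * pi * of_int l"
      by simp
    have "2 * pi * of_int q * \<eta> = of_int q * (2 * pi * \<eta>)"
      by simp
    also have "\<dots> = pi * of_int q + 2 * pi * of_int (q * l)"
      unfolding l by (simp add: algebra_simps)
    finally have "cis (2 * pi * of_int q * \<eta>) = cis (pi * of_int q) * cis (2 * pi * of_int (q * l))"
      by (simp only: cis_mult)
    then show ?thesis by (simp del: of_int_mult)
  qed
  ultimately show ?thesis by simp
qed

lemma integral_full_turns:
  assumes "k \<ge> (1::nat)"
  shows "((\<lambda>x. c * cis (2 * pi * k * x)) has_integral 0) {0..1}"
proof -
  have "((\<lambda>x. - \<i> / (2 * pi * k) * c * cis (2 * pi * k * x)) has_vector_derivative c * cis (2 * pi * k * x)) (at x)" for x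
    using has_vector_derivative_mult_right[OF has_vector_derivative_cis[OF DERIV_cmult[OF DERIV_ident]],
        of "- \<i> / (2 * pi * k) * c" "2 * pi * k" x] assms
    by (simp add: field_simps)
  then have "((\<lambda>x. c * cis (2 * pi * k * x)) has_integral
      (- \<i> / (2 * pi * k) * c * cis (2 * pi * k * 1) - - \<i> / (2 * pi * k) * c * cis (2 * pi * k * 0))) {0..1}"
    by (intro fundamental_theorem_of_calculus) (auto intro: has_vector_derivative_at_within)
  moreover have "cis (2 * pi * real k) = 1"
    by simp
  ultimately show ?thesis
    by simp
qed

text \<open>
  All errors are controlled by the \<open>L\<^sup>1\<close> distance \<open>D\<close> of \<open>cis \<theta>\<close> from the direction of the circle:
  the mean \<open>\<delta>\<close> is at most \<open>D\<close> because the mean of the circle's direction is zero, so the length is at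
  most \<open>1 + D\<close> and the \<open>L\<^sup>1\<close> distance of the velocities is at most \<open>2 D\<close>.
\<close>

lemma ratio_of_curve_with_given_direction:
  fixes \<theta> \<theta>' :: "real \<Rightarrow> real" and m q :: int and k :: nat
  assumes m: "m > 0" and k: "1 \<le> k" "int k \<le> m" and e0: "norm e0 = 1"
    and \<theta>: "\<And>x. (\<theta> has_real_derivative \<theta>' x) (at x)" and \<theta>'_cont: "continuous_on UNIV \<theta>'"
    and shift: "\<And>x. \<theta> (x + 1 / of_int m) = \<theta> x + 2 * pi * of_int (int k) / of_int m + 2 * pi * of_int q"
  defines "D \<equiv> integral {0..1} (\<lambda>x. norm (cis (\<theta> x) - e0 * cis (2 * pi * k * x)))"
  assumes D: "D < 1" and den: "1 / (2 * pi * k) - (2 * D * (1 + D) + 2 * D) > 0"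
  shows "\<exists>\<gamma>\<in>A_set (int k + m * q) m. isoperimetric_ratio \<gamma> \<le>
    ereal ((1 + D)\<^sup>2 / (2 * pi * (1 / (2 * pi * k) - (2 * D * (1 + D) + 2 * D))))"
proof -
  define \<delta> where "\<delta> = integral {0..1} (\<lambda>x. cis (\<theta> x))"
  have \<theta>_cont: "continuous_on S \<theta>" for S
    by (intro continuous_at_imp_continuous_on ballI DERIV_isCont[OF \<theta>])
  have c_cont: "continuous_on S (\<lambda>x. cis (\<theta> x))" for S
    by (intro continuous_intros \<theta>_cont)
  have diff_cont: "continuous_on S (\<lambda>x. cis (\<theta> x) - e0 * cis (2 * pi * k * x))" for S
    by (intro continuous_intros c_cont)
  have D_int: "((\<lambda>x. norm (cis (\<theta> x) - e0 * cis (2 * pi * k * x))) has_integral D) {0..1}"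
    unfolding D_def by (intro integrable_integral integrable_continuous_real continuous_on_norm diff_cont)
  have D0: "D \<ge> 0"
    using has_integral_nonneg[OF D_int] by simp
  have "((\<lambda>x. cis (\<theta> x)) has_integral \<delta>) {0..1}"
    unfolding \<delta>_def by (intro integrable_integral integrable_continuous_real c_cont)
  from has_integral_diff[OF this integral_full_turns[OF k(1), of e0]]
  have I: "((\<lambda>x. cis (\<theta> x) - e0 * cis (2 * pi * k * x)) has_integral \<delta>) {0..1}"
    by simp
  have \<delta>D: "norm \<delta> \<le> D"
    using integral_norm_bound_integral[OF has_integral_integrable[OF I] has_integral_integrable[OF D_int]]
      integral_unique[OF I] integral_unique[OF D_int] by simp
  have "int k \<in> {1..m}" "norm (integral {0..1} (\<lambda>x. cis (\<theta> x))) < 1"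
    using k \<delta>D D by (auto simp: \<delta>_def)
  from curve_with_given_direction[OF m this(1) \<theta> \<theta>'_cont shift this(2)]
  obtain \<gamma> where \<gamma>: "\<gamma> \<in> A_set (int k + m * q) m" "\<And>x. to_complex (dx \<gamma> x) = cis (\<theta> x) - \<delta>"
    "\<And>x. ((\<lambda>x. to_complex (\<gamma> x)) has_vector_derivative (cis (\<theta> x) - \<delta>)) (at x)"
    unfolding \<delta>_def[symmetric] by blast
  define v where "v x = cis (\<theta> x) - \<delta>" for x
  have v_cont: "continuous_on S v" for S
    unfolding v_def by (intro continuous_intros c_cont)
  have v_bound: "norm (v x) \<le> 1 + D" for x
    using norm_triangle_ineq4[of "cis (\<theta> x)" \<delta>] \<delta>D by (simp add: v_def)
  have "W21_curve \<gamma>"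
    using \<gamma>(1) by (simp add: A_set_def)
  then have "\<gamma> (0 + 1) = \<gamma> 0"
    unfolding W21_curve_def periodic1_def by blast
  then have closed: "to_complex (\<gamma> 1) = to_complex (\<gamma> 0)"
    by simp
  define E where "E = integral {0..1} (\<lambda>x. norm (v x - e0 * cis (2 * pi * k * x)))"
  have E: "E \<le> 2 * D"
  proof -
    have "E \<le> integral {0..1} (\<lambda>x. norm (cis (\<theta> x) - e0 * cis (2 * pi * k * x)) + norm \<delta>)"
      unfolding E_def
    proof (rule integral_le)
      show "(\<lambda>x. norm (v x - e0 * cis (2 * pi * k * x))) integrable_on {0..1}"
        by (intro integrable_continuous_real continuous_intros v_cont)
      show "(\<lambda>x. norm (cis (\<theta> x) - e0 * cis (2 * pi * k * x)) + norm \<delta>) integrable_on {0..1}"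
        by (intro integrable_continuous_real continuous_intros c_cont)
      show "norm (v x - e0 * cis (2 * pi * k * x)) \<le> norm (cis (\<theta> x) - e0 * cis (2 * pi * k * x)) + norm \<delta>" for x
        using norm_triangle_ineq4[of "cis (\<theta> x) - e0 * cis (2 * pi * k * x)" \<delta>] by (simp add: v_def algebra_simps)
    qed
    also have "\<dots> = D + norm \<delta>"
      using integral_unique[OF has_integral_add[OF D_int has_integral_const_real[of "norm \<delta>" 0 1]]] by simp
    finally show ?thesis
      using \<delta>D by simp
  qed
  have v_eq: "to_complex (dx \<gamma> x) = v x" for x
    by (simp add: \<gamma>(2) v_def)
  have "\<bar>2 * signed_area \<gamma> - 1 / (2 * pi * k)\<bar> \<le> E * (1 + D) + E"
    using area_close_to_circle[OF k(1) e0 \<gamma>(3)[folded v_def] v_cont closed v_bound]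
    by (simp add: signed_area_complex v_eq E_def)
  also have "\<dots> \<le> 2 * D * (1 + D) + 2 * D"
    using E D0 by (intro add_mono mult_right_mono) auto
  finally have A: "1 / (2 * pi * k) - (2 * D * (1 + D) + 2 * D) \<le> 2 * signed_area \<gamma>"
    by linarith
  have "curve_length \<gamma> \<le> integral {0..1} (\<lambda>x::real. 1 + D)"
    unfolding curve_length_complex v_eq using v_bound
    by (intro integral_le integrable_continuous_real continuous_intros v_cont) auto
  then have L: "curve_length \<gamma> \<le> 1 + D"
    by simp
  have L0: "0 \<le> curve_length \<gamma>"
    unfolding curve_length_complex v_eq
    by (intro integral_nonneg integrable_continuous_real continuous_intros v_cont) auto
  have "(curve_length \<gamma>)\<^sup>2 / (4 * pi * signed_area \<gamma>) = (curve_length \<gamma>)\<^sup>2 / (2 * pi * (2 * signed_area \<gamma>))"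
    by simp
  also have "\<dots> \<le> (1 + D)\<^sup>2 / (2 * pi * (1 / (2 * pi * k) - (2 * D * (1 + D) + 2 * D)))"
    using A L L0 den by (intro frac_le power_mono mult_left_mono) auto
  finally show ?thesis
    using \<gamma>(1) A den by (intro bexI[of _ \<gamma>]) (auto simp: isoperimetric_ratio_def)
qed

text \<open>
  The angles \<open>\<theta> j\<close> increase by \<open>2\<pi>n\<close> in total, but as \<open>j\<close> grows the part that belongs to
  \<open>n - k = m q\<close> is concentrated near the multiples of \<open>1/m\<close>. By dominated convergence the directions
  approach, in \<open>L\<^sup>1\<close>, those of a circle covered \<open>k\<close> times.
\<close>

lemma near_optimal_curve:
  assumes m: "m > 0" and e: "e > (0::real)"
  shows "\<exists>\<gamma>\<in>A_set n m. isoperimetric_ratio \<gamma> \<le> ereal (of_int (idx n m) + e)"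
proof -
  define k where "k = nat (idx n m)"
  define q where "q = \<lceil>real_of_int n / real_of_int m\<rceil> - 1"
  have k: "1 \<le> k" "int k \<le> m" "int k = idx n m"
    using idx_range[OF m, of n] by (auto simp: k_def)
  have n: "n = int k + m * q"
    unfolding k(3) idx_cong q_def by (simp add: algebra_simps)
  define e0 where "e0 = cis (pi * of_int q)"
  define \<alpha> where "\<alpha> j = real j / real (Suc j)" for j
  have \<alpha>: "0 \<le> \<alpha> j" "\<alpha> j < 1" for j
    by (auto simp: \<alpha>_def)
  have \<alpha>_lim: "\<alpha> \<longlonglongrightarrow> 1"
    unfolding \<alpha>_def by (rule LIMSEQ_n_over_Suc_n)
  define \<theta> where "\<theta> j x = 2 * pi * k * x + 2 * pi * of_int q * smooth_step (\<alpha> j) (of_int m * x)" for j x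
  define D where "D j = integral {0..1} (\<lambda>x. norm (cis (\<theta> j x) - e0 * cis (2 * pi * k * x)))" for j
  have shift: "\<theta> j (x + 1 / of_int m) = \<theta> j x + 2 * pi * of_int (int k) / of_int m + 2 * pi * of_int q" for j x
  proof -
    have "smooth_step (\<alpha> j) (of_int m * (x + 1 / of_int m)) = smooth_step (\<alpha> j) (of_int m * x) + 1"
      using m smooth_step_shift[of "\<alpha> j" "of_int m * x"] by (simp add: distrib_left)
    then show ?thesis
      by (simp add: \<theta>_def algebra_simps)
  qed
  have \<theta>_C1: "\<exists>\<theta>'. (\<forall>x. (\<theta> j has_real_derivative \<theta>' x) (at x)) \<and> continuous_on UNIV \<theta>'" for j
  proof -
    obtain \<eta>' where \<eta>': "\<And>y. (smooth_step (\<alpha> j) has_real_derivative \<eta>' y) (at y)" "continuous_on UNIV \<eta>'"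
      using smooth_step_C1[OF \<alpha>] by blast
    have "((\<lambda>x. smooth_step (\<alpha> j) (of_int m * x)) has_real_derivative \<eta>' (of_int m * x) * of_int m) (at x)" for x
    proof -
      have "((\<lambda>x. of_int m * x) has_real_derivative of_int m) (at x)"
        by (auto intro!: derivative_eq_intros)
      from DERIV_chain2[OF \<eta>'(1) this] show ?thesis .
    qed
    then have "(\<theta> j has_real_derivative
        (2 * pi * k + 2 * pi * of_int q * (\<eta>' (of_int m * x) * of_int m))) (at x)" for x
      unfolding \<theta>_def by (auto intro!: derivative_eq_intros)
    moreover have "continuous_on UNIV (\<lambda>x. 2 * pi * k + 2 * pi * of_int q * (\<eta>' (of_int m * x) * of_int m))"
      by (intro continuous_intros continuous_on_compose2[OF \<eta>'(2)]) auto
    ultimately show ?thesis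
      by (intro exI[of _ "\<lambda>x. 2 * pi * k + 2 * pi * of_int q * (\<eta>' (of_int m * x) * of_int m)"] conjI allI)
  qed
  have D_lim: "D \<longlonglongrightarrow> 0"
  proof -
    define P where "P x \<longleftrightarrow> cos (2 * pi * (of_int m * x)) = 1" for x :: real
    define h where "h x = (if P x then norm (cis (2 * pi * of_int q * (of_int m * x)) - e0) else 0)" for x
    have norm_eq: "norm (cis (\<theta> j x) - e0 * cis (2 * pi * k * x))
        = norm (cis (2 * pi * of_int q * smooth_step (\<alpha> j) (of_int m * x)) - e0)" for j x
    proof -
      have "cis (\<theta> j x) - e0 * cis (2 * pi * k * x)
          = cis (2 * pi * k * x) * (cis (2 * pi * of_int q * smooth_step (\<alpha> j) (of_int m * x)) - e0)"
        by (simp add: \<theta>_def right_diff_distrib mult.commute flip: cis_mult)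
      then show ?thesis by (simp add: norm_mult)
    qed
    have "D \<longlonglongrightarrow> integral {0..1} h"
      unfolding D_def
    proof (rule dominated_convergence(2)[where h = "\<lambda>x. 2"])
      show "(\<lambda>x. norm (cis (\<theta> j x) - e0 * cis (2 * pi * k * x))) integrable_on {0..1}" for j
      proof -
        have "continuous_on {0..1} (\<theta> j)"
          using \<theta>_C1[of j] by (meson DERIV_isCont continuous_at_imp_continuous_on)
        then show ?thesis
          by (intro integrable_continuous_real continuous_intros)
      qed
      show "norm (norm (cis (\<theta> j x) - e0 * cis (2 * pi * k * x))) \<le> 2" for j x
        using norm_triangle_ineq4[of "cis (\<theta> j x)" "e0 * cis (2 * pi * k * x)"] by (simp add: norm_mult e0_def)
      show "(\<lambda>j. norm (cis (\<theta> j x) - e0 * cis (2 * pi * k * x))) \<longlonglongrightarrow> h x" for x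
      proof (cases "P x")
        \<comment> \<open>At the jumps the steps do not depend on \<open>j\<close>.\<close>
        case True
        then have "sin (2 * pi * (of_int m * x)) = 0"
          using sin_cos_squared_add[of "2 * pi * (of_int m * x)"] by (simp add: P_def)
        then show ?thesis
          using True by (simp add: norm_eq h_def smooth_step_def)
      next
        case False
        have "(\<lambda>j. cis (2 * pi * of_int q * smooth_step (\<alpha> j) (of_int m * x))) \<longlonglongrightarrow> e0"
          unfolding e0_def using False by (intro smooth_step_limit \<alpha>_lim) (simp add: P_def)
        then have "(\<lambda>j. norm (cis (2 * pi * of_int q * smooth_step (\<alpha> j) (of_int m * x)) - e0)) \<longlonglongrightarrow> norm (e0 - e0)"
          by (intro tendsto_intros)
        then show ?thesis
          using False by (simp add: norm_eq h_def)
      qed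
    qed auto
    \<comment> \<open>The limit \<open>h\<close> is nonzero at most at the multiples of \<open>1/m\<close>.\<close>
    moreover have "(h has_integral 0) {0..1}"
    proof (rule has_integral_spike_finite[OF _ _ has_integral_0])
      show "finite ((\<lambda>l. of_int l / of_int m :: real) ` {0..m})"
        by simp
      fix x :: real assume x: "x \<in> {0..1} - (\<lambda>l. of_int l / of_int m) ` {0..m}"
      have "\<not> P x"
      proof
        assume "P x"
        then obtain l :: int where "2 * pi * (of_int m * x) = of_int l * 2 * pi"
          unfolding P_def cos_one_2pi_int by blast
        then have l: "of_int m * x = of_int l"
          by simp
        then have "0 \<le> real_of_int l" "real_of_int l \<le> of_int m"
          using x m mult_left_le[of x "of_int m"] by (auto simp flip: l)
        then have "l \<in> {0..m}" by simp
        moreover have "x = of_int l / of_int m"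
          using l m by (simp add: field_simps)
        ultimately show False using x by blast
      qed
      then show "h x = 0" by (simp add: h_def)
    qed
    ultimately show ?thesis by (simp add: integral_unique)
  qed
  define den where "den x = 1 / (2 * pi * k) - (2 * x * (1 + x) + 2 * x)" for x :: real
  have den_lim: "(\<lambda>j. den (D j)) \<longlonglongrightarrow> den 0"
    unfolding den_def by (intro tendsto_intros D_lim)
  have den0: "den 0 > 0"
    using k(1) by (simp add: den_def)
  have "(\<lambda>j. (1 + D j)\<^sup>2 / (2 * pi * den (D j))) \<longlonglongrightarrow> (1 + 0)\<^sup>2 / (2 * pi * den 0)"
    using den0 by (intro tendsto_intros D_lim den_lim) auto
  moreover have "(1 + 0)\<^sup>2 / (2 * pi * den 0) = real k"
    using k(1) by (simp add: den_def)
  ultimately have "eventually (\<lambda>j. (1 + D j)\<^sup>2 / (2 * pi * den (D j)) < real k + e) sequentially"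
    using e by (intro order_tendstoD(2)[of _ "real k"]) auto
  moreover have "eventually (\<lambda>j. D j < 1) sequentially"
    by (rule order_tendstoD(2)[OF D_lim]) simp
  moreover have "eventually (\<lambda>j. den (D j) > 0) sequentially"
    by (rule order_tendstoD(1)[OF den_lim den0])
  ultimately have "eventually (\<lambda>j. (1 + D j)\<^sup>2 / (2 * pi * den (D j)) < real k + e \<and> D j < 1 \<and> den (D j) > 0) sequentially"
    by eventually_elim auto
  then obtain j where j: "(1 + D j)\<^sup>2 / (2 * pi * den (D j)) < real k + e" "D j < 1" "den (D j) > 0"
    using eventually_happens by (metis (mono_tags, lifting) trivial_limit_sequentially)
  obtain \<theta>' where \<theta>': "\<And>x. (\<theta> j has_real_derivative \<theta>' x) (at x)" "continuous_on UNIV \<theta>'"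
    using \<theta>_C1 by blast
  have "norm e0 = 1"
    by (simp add: e0_def)
  from ratio_of_curve_with_given_direction[OF m k(1,2) this \<theta>' shift, folded D_def, folded den_def, OF j(2,3)]
  obtain \<gamma> where "\<gamma> \<in> A_set n m" "isoperimetric_ratio \<gamma> \<le> ereal ((1 + D j)\<^sup>2 / (2 * pi * den (D j)))"
    unfolding n by blast
  moreover have "ereal ((1 + D j)\<^sup>2 / (2 * pi * den (D j))) \<le> ereal (of_int (idx n m) + e)"
    using j(1) k(3) by (metis less_imp_le ereal_less_eq(3) of_int_of_nat_eq)
  ultimately show ?thesis
    using order_trans by blast
qed

lemma round_circle_in_A_set:
  assumes "1 \<le> n" "n \<le> m"
  shows "\<exists>\<gamma>\<in>A_set n m. ccw_round_circle n \<gamma>"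
proof -
  define k where "k = nat n"
  have k: "1 \<le> k" "real_of_int n = real k"
    using assms by (auto simp: k_def)
  define \<theta> where "\<theta> x = 2 * pi * k * x + pi / 2" for x
  have "cis (\<theta> x) = \<i> * cis (2 * pi * k * x)" for x
    by (simp add: \<theta>_def mult.commute flip: cis_mult)
  then have \<delta>: "integral {0..1} (\<lambda>x. cis (\<theta> x)) = 0"
    using integral_unique[OF integral_full_turns[OF k(1), of \<i>]] by simp
  have \<theta>: "(\<theta> has_real_derivative 2 * pi * k) (at x)" for x
    unfolding \<theta>_def by (auto intro!: derivative_eq_intros)
  have shift: "\<theta> (x + 1 / of_int m) = \<theta> x + 2 * pi * of_int n / of_int m + 2 * pi * of_int 0" for x
    by (simp add: \<theta>_def k(2) distrib_left)
  have "m > 0" "n \<in> {1..m}" "norm (integral {0..1} (\<lambda>x. cis (\<theta> x))) < 1"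
    using assms \<delta> by auto
  note ex = curve_with_given_direction[OF this(1,2) \<theta> continuous_on_const shift this(3),
      unfolded \<delta> diff_zero mult_zero_right add_0_right]
  obtain \<gamma> where \<gamma>: "\<gamma> \<in> A_set n m"
    "\<And>x. ((\<lambda>x. to_complex (\<gamma> x)) has_vector_derivative cis (\<theta> x)) (at x)"
  proof (rule ex)
    fix \<gamma>
    assume "\<gamma> \<in> A_set n m" "\<And>x. ((\<lambda>x. to_complex (\<gamma> x)) has_vector_derivative cis (\<theta> x)) (at x)"
    then show thesis by (rule that)
  qed
  define c where "c = complex_of_real (1 / (2 * pi * k))"
  have "((\<lambda>x. c * cis (2 * pi * k * x)) has_vector_derivative cis (\<theta> x)) (at x)" for x
    using has_vector_derivative_mult_right[OF has_vector_derivative_cis[OF DERIV_cmult[OF DERIV_ident]], of c "2 * pi * k" x] k(1)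
    by (simp add: c_def \<open>cis (\<theta> x) = _\<close>)
  from equal_derivatives_imp_equal_differences[OF \<gamma>(2) this, of _ 0]
  have z: "to_complex (\<gamma> x) = (to_complex (\<gamma> 0) - c) + c * cis (2 * pi * of_int n * x)" for x
    by (simp add: k(2) algebra_simps)
  have "c \<noteq> 0"
    using k(1) by (simp add: c_def)
  have "ccw_round_circle n \<gamma>"
    by (rule ccw_round_circleI[where s = "\<lambda>x. x" and \<sigma> = "\<lambda>x. 1", OF assms(1) \<open>c \<noteq> 0\<close> DERIV_ident _ _ z]) auto
  then show ?thesis
    using \<gamma>(1) by blast
qed

section \<open>The infimum of the isoperimetric ratio\<close>

theorem theorem1p1:
  fixes n m :: int
  assumes "m > 0"
  shows "(INF \<gamma>\<in>A_set n m. isoperimetric_ratio \<gamma>) = ereal (of_int (idx n m))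
    \<and> {n + m * k |k. True} \<inter> {1..m} = {idx n m}
    \<and> (idx n m = n \<longleftrightarrow> 1 \<le> n \<and> n \<le> m)
    \<and> ((\<exists>\<gamma>\<in>A_set n m. isoperimetric_ratio \<gamma> = ereal (of_int (idx n m))) \<longleftrightarrow> idx n m = n)
    \<and> (\<forall>\<gamma>\<in>A_set n m. isoperimetric_ratio \<gamma> = ereal (of_int (idx n m))
          \<longleftrightarrow> idx n m = n \<and> ccw_round_circle n \<gamma>)"
proof -
  define i where "i = idx n m"
  have i: "1 \<le> i" "i \<le> m"
    using idx_range[OF assms] by (auto simp: i_def)
  have lower: "ereal (of_int i) \<le> isoperimetric_ratio \<gamma>" if "\<gamma> \<in> A_set n m" for \<gamma>
    using A_set_isoperimetric(1)[OF assms that]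
    by (auto simp: isoperimetric_ratio_def i_def field_simps)
  have "(INF \<gamma>\<in>A_set n m. isoperimetric_ratio \<gamma>) = ereal (of_int i)"
  proof (rule antisym)
    show "(INF \<gamma>\<in>A_set n m. isoperimetric_ratio \<gamma>) \<le> ereal (of_int i)"
    proof (rule ereal_le_epsilon2)
      fix e :: real assume "e > 0"
      then obtain \<gamma> where "\<gamma> \<in> A_set n m" "isoperimetric_ratio \<gamma> \<le> ereal (of_int i + e)"
        using near_optimal_curve[OF assms] unfolding i_def by blast
      then show "(INF \<gamma>\<in>A_set n m. isoperimetric_ratio \<gamma>) \<le> ereal (of_int i) + ereal e"
        by (auto intro: INF_lower2)
    qed
    show "ereal (of_int i) \<le> (INF \<gamma>\<in>A_set n m. isoperimetric_ratio \<gamma>)"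
      by (rule INF_greatest[OF lower])
  qed
  moreover have "{n + m * k |k. True} \<inter> {1..m} = {i}"
  proof (intro equalityI subsetI)
    fix j assume "j \<in> {n + m * k |k. True} \<inter> {1..m}"
    then show "j \<in> {i}"
      using idx_unique[OF assms, of j n] by (auto simp: i_def)
  next
    fix j assume "j \<in> {i}"
    then have "j = n + m * (1 - \<lceil>real_of_int n / real_of_int m\<rceil>)" "j \<in> {1..m}"
      using idx_cong[of n m] i by (simp_all add: i_def)
    then show "j \<in> {n + m * k |k. True} \<inter> {1..m}"
      by blast
  qed
  moreover have fixed_iff: "i = n \<longleftrightarrow> 1 \<le> n \<and> n \<le> m"
    using idx_unique[OF assms, of n n 0] i by (fastforce simp: i_def)
  moreover have circle_iff: "isoperimetric_ratio \<gamma> = ereal (of_int i) \<longleftrightarrow> i = n \<and> ccw_round_circle n \<gamma>"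
    if \<gamma>: "\<gamma> \<in> A_set n m" for \<gamma>
  proof
    assume eq: "isoperimetric_ratio \<gamma> = ereal (of_int i)"
    then have pos: "signed_area \<gamma> > 0"
      by (cases "signed_area \<gamma> > 0") (simp_all add: isoperimetric_ratio_def)
    then have "(curve_length \<gamma>)\<^sup>2 / (4 * pi * signed_area \<gamma>) = of_int i"
      using eq by (simp add: isoperimetric_ratio_def)
    then have "4 * pi * of_int i * signed_area \<gamma> = (curve_length \<gamma>)\<^sup>2"
      using pos by (simp add: field_simps)
    then show "i = n \<and> ccw_round_circle n \<gamma>"
      using A_set_isoperimetric(2)[OF assms \<gamma>] by (simp add: i_def)
  next
    assume "i = n \<and> ccw_round_circle n \<gamma>"
    then show "isoperimetric_ratio \<gamma> = ereal (of_int i)"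
      using \<gamma> ccw_round_circle_isoperimetric_ratio by (auto simp: A_set_def)
  qed
  moreover have "(\<exists>\<gamma>\<in>A_set n m. isoperimetric_ratio \<gamma> = ereal (of_int i)) \<longleftrightarrow> i = n"
    using circle_iff fixed_iff round_circle_in_A_set[of n m] by blast
  ultimately show ?thesis
    unfolding i_def by blast
qed

end
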